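(* Let $(\hat\Omega,\mathcal A,\mu)$ be a $\sigma$-finite measure space, $\Omega\subseteq\hat\Omega$ measurable, and let $\Phi:\hat\Omega\times\hat\Omega\times\mathbb R\to[0,\infty]$ satisfy the standard conditions. Let $\mathcal E(\hat u)=\frac12\int_{\hat\Omega}\int_{\hat\Omega}\Phi(x,y,\hat u(x)-\hat u(y))\,d\mu(y)d\mu(x)$ on $W^{\Phi,2}(\hat\Omega,\Omega)$, let $j:W^{\Phi,2}(\hat\Omega,\Omega)\to L^2(\Omega)$, $j(\hat u)=\hat u|_\Omega$, and assume that $j$ has dense range. Let $\mathcal E^{L^2}$ be the proper, lower semicontinuous, convex energy on $L^2(\Omega)$ associated with $\mathcal E$ and $j$, that is, $\partial_j\mathcal E=\partial\mathcal E^{L^2}$. Then $\mathcal E^{L^2}$ is a densely defined Dirichlet form, and therefore the semigroup $S^N$ generated by its negative subgradient is order preserving and $L^\infty$-contractive.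
   Context: $L^0(X)$ denotes real measurable functions on $X$ modulo a.e. equality. Condition (C) on $\Phi$: $\Phi(\cdot,\cdot,s)$ is measurable for every $s$; and for all $x,y$: $\Phi(x,y,0)=0$, $\Phi(x,y,\cdot)$ is lower semicontinuous, convex and even, and $\Phi(x,y,\cdot)=\Phi(y,x,\cdot)$. Fenchel conjugate: $\Phi^*(x,y,t)=\sup_{s}(st-\Phi(x,y,s))$. $\Delta_2$-condition: there are $K>0$ and an integrable $h:\hat\Omega\times\hat\Omega\to[0,\infty)$ with $\Phi(x,y,2s)\le K\Phi(x,y,s)+h(x,y)$ for all $x,y,s$. $\mathbf S_\Phi=(\hat\Omega\times\hat\Omega)\setminus\{(x,y):\Phi(x,y,s)=0\ \forall s\}$. Thickness condition on $\mathbf S_\Phi$: there exist a sequence $(A^{(0)}_n)_{n\in\mathbb N}$ of measurable subsets of $\Omega$, a $\mu$-null set $\hat N\subseteq\hat\Omega$ and, recursively for $j=0,1,2,\dots$, with $I^{(j)}:=\{n:\mu(A^{(j)}_n)>0\}$, sequences of measurable sets $(B^{(j+1)}_n)_n$ with $A^{(j)}_n\times B^{(j+1)}_n\subseteq\mathbf S_\Phi$ for every $n$, and $(A^{(j+1)}_n)_n$ with $\bigcup_nA^{(j+1)}_n=\bigcup_{n\in I^{(j)}}B^{(j+1)}_n$, such that $\hat\Omega\setminus\hat N=\bigcup_{j}\bigcup_{n\in I^{(j)}}A^{(j)}_n$. Standard conditions: $\Phi$ satisfies (C), $\Phi$ and $\Phi^*$ satisfy the $\Delta_2$-condition, $\mathbf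 S_\Phi$ satisfies the thickness condition. $W^{\Phi,0}(\hat\Omega)=\{\hat u\in L^0(\hat\Omega):\exists\lambda>0,\ \int\int\Phi(x,y,(\hat u(x)-\hat u(y))/\lambda)\,d\mu d\mu<\infty\}$ with seminorm $\|\hat u\|_{W^{\Phi,0}}=\inf\{\lambda>0:\int\int\Phi(x,y,(\hat u(x)-\hat u(y))/\lambda)\,d\mu d\mu\le1\}$; $W^{\Phi,2}(\hat\Omega,\Omega)=\{\hat u\in W^{\Phi,0}(\hat\Omega):\hat u|_\Omega\in L^2(\Omega)\}$ with norm $\|\hat u|_\Omega\|_{L^2(\Omega)}+\|\hat u\|_{W^{\Phi,0}}$. $\partial_j\mathcal E$: set of $(u,f)\in L^2(\Omega)^2$ for which there is $\hat u\in W^{\Phi,2}(\hat\Omega,\Omega)$ with $\mathcal E(\hat u)<\infty$, $j(\hat u)=u$ and $\mathcal E(\hat u+\hat v)-\mathcal E(\hat u)\ge\int_\Omega f\,j(\hat v)\,d\mu$ for all $\hat v$. It is known (general theory of $j$-subgradients) that $\partial_j\mathcal E=\partial\mathcal E^{L^2}$ for a proper lower semicontinuous convex $\mathcal E^{L^2}$, unique up to an additive constant and given, up to an additive constant, by $\mathcal E^{L^2}(u)=\inf_{j(\hat u)=u}\mathcal E(\hat u)$. A proper, lower semicontinuous, convex, densely defined function $\mathcal F:L^2(\Omega)\to(-\infty,\infty]$ is called a (nonlinear) Dirichlet form if the semigroup $S$ on $L^2(\Omega)$ generated by $-\partial\mathcal F$ is order preserving ($u_0\le v_0$ implies $S(t)u_0\le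 S(t)v_0$ for all $t\ge0$) and $L^\infty$-contractive ($\|S(t)u_0-S(t)v_0\|_{L^\infty}\le\|u_0-v_0\|_{L^\infty}$ for all $u_0,v_0\in L^2(\Omega)$, $t\ge0$, the norm being $\infty$ for functions not in $L^\infty$). *)

theory Defs
  imports "HOL-Probability.Probability"
begin

section \<open>The integrand\<close>

text \<open>
  The measure space is \<open>M\<close>, so its underlying set is \<^term>\<open>space M\<close>; the values of \<open>\<Phi>\<close> outside
  \<^term>\<open>space M\<close> are irrelevant.
\<close>

definition lsc_real :: "(real \<Rightarrow> ennreal) \<Rightarrow> bool" where
  "lsc_real \<phi> \<longleftrightarrow> (\<forall>s. \<phi> s \<le> Liminf (at s) \<phi>)"

text \<open>\<open>convex_on\<close> is only available for real-valued functions.\<close>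

definition convex_ennreal :: "(real \<Rightarrow> ennreal) \<Rightarrow> bool" where
  "convex_ennreal \<phi> \<longleftrightarrow> (\<forall>s t. \<forall>c\<in>{0..1}.
     \<phi> ((1 - c) * s + c * t) \<le> ennreal (1 - c) * \<phi> s + ennreal c * \<phi> t)"

definition condition_C :: "'a measure \<Rightarrow> ('a \<Rightarrow> 'a \<Rightarrow> real \<Rightarrow> ennreal) \<Rightarrow> bool" where
  "condition_C M \<Phi> \<longleftrightarrow>
     (\<forall>s. (\<lambda>(x, y). \<Phi> x y s) \<in> borel_measurable (M \<Otimes>\<^sub>M M)) \<and>
     (\<forall>x\<in>space M. \<forall>y\<in>space M.
        \<Phi> x y 0 = 0 \<and> lsc_real (\<Phi> x y) \<and> convex_ennreal (\<Phi> x y) \<and>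
        (\<forall>s. \<Phi> x y (- s) = \<Phi> x y s) \<and> (\<forall>s. \<Phi> x y s = \<Phi> y x s))"

text \<open>
  The supremum is taken in the extended reals. Under condition (C) it is nonnegative, because
  \<open>\<Phi> x y 0 = 0\<close>, so the conversion to \<^typ>\<open>ennreal\<close> does not lose anything.
\<close>

definition fenchel_conjugate ::
  "('a \<Rightarrow> 'a \<Rightarrow> real \<Rightarrow> ennreal) \<Rightarrow> 'a \<Rightarrow> 'a \<Rightarrow> real \<Rightarrow> ennreal" where
  "fenchel_conjugate \<Phi> x y t = e2ennreal (SUP s. ereal (s * t) - enn2ereal (\<Phi> x y s))"

definition delta2_condition :: "'a measure \<Rightarrow> ('a \<Rightarrow> 'a \<Rightarrow> real \<Rightarrow> ennreal) \<Rightarrow> bool" where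
  "delta2_condition M \<Phi> \<longleftrightarrow> (\<exists>K h. 0 < K \<and> integrable (M \<Otimes>\<^sub>M M) h \<and>
     (\<forall>x\<in>space M. \<forall>y\<in>space M. 0 \<le> h (x, y) \<and>
        (\<forall>s. \<Phi> x y (2 * s) \<le> ennreal K * \<Phi> x y s + ennreal (h (x, y)))))"

definition S_set :: "'a measure \<Rightarrow> ('a \<Rightarrow> 'a \<Rightarrow> real \<Rightarrow> ennreal) \<Rightarrow> ('a \<times> 'a) set" where
  "S_set M \<Phi> = space M \<times> space M - {(x, y). \<forall>s. \<Phi> x y s = 0}"

text \<open>
  \<open>A j n\<close> stands for \<open>A\<close> with upper index \<open>j\<close> and lower index \<open>n\<close>, and likewise for \<open>B\<close>, of which
  only the indices \<open>j \<ge> 1\<close> are used.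
\<close>

definition thickness_condition :: "'a measure \<Rightarrow> 'a set \<Rightarrow> ('a \<times> 'a) set \<Rightarrow> bool" where
  "thickness_condition M \<Omega> S \<longleftrightarrow>
     (\<exists>(A :: nat \<Rightarrow> nat \<Rightarrow> 'a set) (B :: nat \<Rightarrow> nat \<Rightarrow> 'a set) (I :: nat \<Rightarrow> nat set) N.
        (\<forall>n. A 0 n \<subseteq> \<Omega>) \<and> (\<forall>j n. A j n \<in> sets M) \<and> (\<forall>j n. B (Suc j) n \<in> sets M) \<and>
        N \<in> null_sets M \<and>
        (\<forall>j. I j = {n. 0 < emeasure M (A j n)}) \<and>
        (\<forall>j n. A j n \<times> B (Suc j) n \<subseteq> S) \<and>
        (\<forall>j. (\<Union>n. A (Suc j) n) = (\<Union>n\<in>I j. B (Suc j) n)) \<and>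
        space M - N = (\<Union>j. \<Union>n\<in>I j. A j n))"

definition standard_conditions ::
  "'a measure \<Rightarrow> 'a set \<Rightarrow> ('a \<Rightarrow> 'a \<Rightarrow> real \<Rightarrow> ennreal) \<Rightarrow> bool" where
  "standard_conditions M \<Omega> \<Phi> \<longleftrightarrow>
     condition_C M \<Phi> \<and> delta2_condition M \<Phi> \<and> delta2_condition M (fenchel_conjugate \<Phi>) \<and>
     thickness_condition M \<Omega> (S_set M \<Phi>)"

section \<open>Functionals on \<open>L\<^sup>2\<close>\<close>

text \<open>
  Elements of \<open>L\<^sup>2\<close> of a measure \<open>N\<close> are represented by square integrable functions. Two functions
  represent the same element iff they are equal almost everywhere, i.e. iff their difference has
  norm 0. All notions below are invariant under this identification: in particular a functional
  that is lower semicontinuous for the seminorm takes equal values on functions that are equal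
  almost everywhere. For \<open>L\<^sup>2(\<Omega>)\<close> take \<^term>\<open>N = restrict_space M \<Omega>\<close>.
\<close>

definition Ltwo :: "'a measure \<Rightarrow> ('a \<Rightarrow> real) set" where
  "Ltwo N = {u \<in> borel_measurable N. integrable N (\<lambda>x. (u x)\<^sup>2)}"

definition Ltwo_inner :: "'a measure \<Rightarrow> ('a \<Rightarrow> real) \<Rightarrow> ('a \<Rightarrow> real) \<Rightarrow> real" where
  "Ltwo_inner N u v = (LINT x|N. u x * v x)"

definition Ltwo_norm :: "'a measure \<Rightarrow> ('a \<Rightarrow> real) \<Rightarrow> real" where
  "Ltwo_norm N u = sqrt (LINT x|N. (u x)\<^sup>2)"

definition dense_in_Ltwo :: "'a measure \<Rightarrow> ('a \<Rightarrow> real) set \<Rightarrow> bool" where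
  "dense_in_Ltwo N D \<longleftrightarrow>
     (\<forall>u\<in>Ltwo N. \<forall>e>0. \<exists>v\<in>D. v \<in> Ltwo N \<and> Ltwo_norm N (\<lambda>x. u x - v x) < e)"

definition proper_Ltwo :: "'a measure \<Rightarrow> (('a \<Rightarrow> real) \<Rightarrow> ereal) \<Rightarrow> bool" where
  "proper_Ltwo N F \<longleftrightarrow> (\<forall>u\<in>Ltwo N. F u \<noteq> -\<infinity>) \<and> (\<exists>u\<in>Ltwo N. F u \<noteq> \<infinity>)"

definition lsc_Ltwo :: "'a measure \<Rightarrow> (('a \<Rightarrow> real) \<Rightarrow> ereal) \<Rightarrow> bool" where
  "lsc_Ltwo N F \<longleftrightarrow> (\<forall>u w. u \<in> Ltwo N \<longrightarrow> (\<forall>n::nat. w n \<in> Ltwo N) \<longrightarrow>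
     (\<lambda>n. Ltwo_norm N (\<lambda>x. w n x - u x)) \<longlonglongrightarrow> 0 \<longrightarrow> F u \<le> liminf (\<lambda>n. F (w n)))"

definition convex_Ltwo :: "'a measure \<Rightarrow> (('a \<Rightarrow> real) \<Rightarrow> ereal) \<Rightarrow> bool" where
  "convex_Ltwo N F \<longleftrightarrow> (\<forall>u\<in>Ltwo N. \<forall>v\<in>Ltwo N. \<forall>c\<in>{0..1}.
     F (\<lambda>x. (1 - c) * u x + c * v x) \<le> ereal (1 - c) * F u + ereal c * F v)"

definition effective_domain :: "'a measure \<Rightarrow> (('a \<Rightarrow> real) \<Rightarrow> ereal) \<Rightarrow> ('a \<Rightarrow> real) set" where
  "effective_domain N F = {u \<in> Ltwo N. F u < \<infinity>}"

definition subgradient ::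
  "'a measure \<Rightarrow> (('a \<Rightarrow> real) \<Rightarrow> ereal) \<Rightarrow> (('a \<Rightarrow> real) \<times> ('a \<Rightarrow> real)) set" where
  "subgradient N F = {(u, f). u \<in> Ltwo N \<and> f \<in> Ltwo N \<and> F u < \<infinity> \<and>
     (\<forall>v\<in>Ltwo N. F v - F u \<ge> ereal (Ltwo_inner N f (\<lambda>x. v x - u x)))}"

section \<open>Semigroups and Dirichlet forms\<close>

text \<open>
  \<open>u\<close> is the (strong) solution of \<open>u' + \<partial>F(u) \<ni> 0\<close> on \<open>(0,\<infinity>)\<close>, \<open>u(0) = u\<^sub>0\<close>: it is continuous on
  \<open>[0,\<infinity>)\<close> with values in \<open>L\<^sup>2\<close>, locally Lipschitz on \<open>(0,\<infinity>)\<close> (that is, locally in \<open>W\<close> with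
  exponents \<open>1,\<infinity>\<close>), and at almost every \<open>t > 0\<close> it has an \<open>L\<^sup>2\<close>-derivative \<open>-f\<close> with
  \<open>f \<in> \<partial>F(u(t))\<close>.
\<close>

definition gradient_flow ::
  "'a measure \<Rightarrow> (('a \<Rightarrow> real) \<Rightarrow> ereal) \<Rightarrow> ('a \<Rightarrow> real) \<Rightarrow> (real \<Rightarrow> 'a \<Rightarrow> real) \<Rightarrow> bool" where
  "gradient_flow N F u0 u \<longleftrightarrow>
     (\<forall>t\<ge>0. u t \<in> Ltwo N) \<and>
     (AE x in N. u 0 x = u0 x) \<and>
     (\<forall>t\<ge>0. ((\<lambda>s. Ltwo_norm N (\<lambda>x. u s x - u t x)) \<longlongrightarrow> 0) (at t within {0..})) \<and>
     (\<forall>a b. 0 < a \<longrightarrow> a \<le> b \<longrightarrow>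
        (\<exists>L. \<forall>s\<in>{a..b}. \<forall>t\<in>{a..b}. Ltwo_norm N (\<lambda>x. u s x - u t x) \<le> L * \<bar>s - t\<bar>)) \<and>
     (AE t in lborel. 0 < t \<longrightarrow>
        (\<exists>f. (u t, f) \<in> subgradient N F \<and>
           ((\<lambda>h. Ltwo_norm N (\<lambda>x. (u (t + h) x - u t x) / h - (- f x))) \<longlongrightarrow> 0) (at 0)))"

text \<open>
  For densely defined \<open>F\<close>, the semigroup generated by the negative subgradient is defined on all of
  \<open>L\<^sup>2\<close>; solutions are unique up to equality almost everywhere, which makes \<open>S\<close> unique in the same
  sense and yields the semigroup law.
\<close>

definition generated_semigroup ::
  "'a measure \<Rightarrow> (('a \<Rightarrow> real) \<Rightarrow> ereal) \<Rightarrow> (real \<Rightarrow> ('a \<Rightarrow> real) \<Rightarrow> ('a \<Rightarrow> real)) \<Rightarrow> bool" where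
  "generated_semigroup N F S \<longleftrightarrow> (\<forall>u0\<in>Ltwo N. gradient_flow N F u0 (\<lambda>t. S t u0))"

definition order_preserving ::
  "'a measure \<Rightarrow> (real \<Rightarrow> ('a \<Rightarrow> real) \<Rightarrow> ('a \<Rightarrow> real)) \<Rightarrow> bool" where
  "order_preserving N S \<longleftrightarrow> (\<forall>u0\<in>Ltwo N. \<forall>v0\<in>Ltwo N. \<forall>t\<ge>0.
     (AE x in N. u0 x \<le> v0 x) \<longrightarrow> (AE x in N. S t u0 x \<le> S t v0 x))"

definition Linf_norm :: "'a measure \<Rightarrow> ('a \<Rightarrow> real) \<Rightarrow> ennreal" where
  "Linf_norm N u = esssup N (\<lambda>x. ennreal \<bar>u x\<bar>)"

definition Linf_contractive ::
  "'a measure \<Rightarrow> (real \<Rightarrow> ('a \<Rightarrow> real) \<Rightarrow> ('a \<Rightarrow> real)) \<Rightarrow> bool" where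
  "Linf_contractive N S \<longleftrightarrow> (\<forall>u0\<in>Ltwo N. \<forall>v0\<in>Ltwo N. \<forall>t\<ge>0.
     Linf_norm N (\<lambda>x. S t u0 x - S t v0 x) \<le> Linf_norm N (\<lambda>x. u0 x - v0 x))"

text \<open>The existence of the generated semigroup is part of the definition.\<close>

definition dirichlet_form :: "'a measure \<Rightarrow> (('a \<Rightarrow> real) \<Rightarrow> ereal) \<Rightarrow> bool" where
  "dirichlet_form N F \<longleftrightarrow>
     proper_Ltwo N F \<and> lsc_Ltwo N F \<and> convex_Ltwo N F \<and> dense_in_Ltwo N (effective_domain N F) \<and>
     (\<exists>S. generated_semigroup N F S \<and> order_preserving N S \<and> Linf_contractive N S)"

section \<open>The energy and its \<open>j\<close>-subgradient\<close>

definition W_Phi_0 :: "'a measure \<Rightarrow> ('a \<Rightarrow> 'a \<Rightarrow> real \<Rightarrow> ennreal) \<Rightarrow> ('a \<Rightarrow> real) set" where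
  "W_Phi_0 M \<Phi> = {u \<in> borel_measurable M.
     \<exists>l>0. (\<integral>\<^sup>+x. \<integral>\<^sup>+y. \<Phi> x y ((u x - u y) / l) \<partial>M \<partial>M) < \<infinity>}"

definition j_map :: "'a set \<Rightarrow> ('a \<Rightarrow> real) \<Rightarrow> ('a \<Rightarrow> real)" where
  "j_map \<Omega> u = restrict u \<Omega>"

definition W_Phi_2 ::
  "'a measure \<Rightarrow> 'a set \<Rightarrow> ('a \<Rightarrow> 'a \<Rightarrow> real \<Rightarrow> ennreal) \<Rightarrow> ('a \<Rightarrow> real) set" where
  "W_Phi_2 M \<Omega> \<Phi> = {u \<in> W_Phi_0 M \<Phi>. j_map \<Omega> u \<in> Ltwo (restrict_space M \<Omega>)}"

definition energy :: "'a measure \<Rightarrow> ('a \<Rightarrow> 'a \<Rightarrow> real \<Rightarrow> ennreal) \<Rightarrow> ('a \<Rightarrow> real) \<Rightarrow> ereal" where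
  "energy M \<Phi> u = enn2ereal (1 / 2 * (\<integral>\<^sup>+x. \<integral>\<^sup>+y. \<Phi> x y (u x - u y) \<partial>M \<partial>M))"

definition j_subgradient ::
  "'a measure \<Rightarrow> 'a set \<Rightarrow> ('a \<Rightarrow> 'a \<Rightarrow> real \<Rightarrow> ennreal) \<Rightarrow> (('a \<Rightarrow> real) \<times> ('a \<Rightarrow> real)) set" where
  "j_subgradient M \<Omega> \<Phi> = {(u, f).
     u \<in> Ltwo (restrict_space M \<Omega>) \<and> f \<in> Ltwo (restrict_space M \<Omega>) \<and>
     (\<exists>w\<in>W_Phi_2 M \<Omega> \<Phi>. energy M \<Phi> w < \<infinity> \<and>
        (AE x in restrict_space M \<Omega>. j_map \<Omega> w x = u x) \<and>
        (\<forall>v\<in>W_Phi_2 M \<Omega> \<Phi>.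
           energy M \<Phi> (\<lambda>x. w x + v x) - energy M \<Phi> w
             \<ge> ereal (Ltwo_inner (restrict_space M \<Omega>) f (j_map \<Omega> v))))}"

end

theory Submission
  imports Defs "HOL-Library.Function_Algebras"
begin

text \<open>
  The truncations \<open>u - \<phi>\<close> and \<open>v + \<phi>\<close> with \<open>\<phi> = max 0 (u - v - k)\<close> do not increase the sum of the two
  energies, because \<open>\<Phi>\<close> is convex. Tested in the \<open>j\<close>-subgradient, this is a T-monotonicity of
  \<open>\<partial>F\<close>, by which \<open>\<parallel>max 0 (u(t) - v(t) - k)\<parallel>\<^sup>2\<close> is nonincreasing along two gradient flows; \<open>k = 0\<close> is
  order preservation and general \<open>k \<ge> 0\<close> is \<open>L\<^sup>\<infinity>\<close>-contractivity. No explicit formula for \<open>F\<close> is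
  needed: \<open>(0, 0)\<close> lies in the \<open>j\<close>-subgradient, so \<open>F\<close> is minimal at \<open>0\<close>, and \<open>F\<close> is densely
  defined because the resolvents of \<open>\<partial>F\<close> at \<open>j(w)\<close> tend to \<open>j(w)\<close>; this uses that the energy of \<open>w\<close> is
  finite by the \<open>\<Delta>\<^sub>2\<close>-condition.

  The semigroup is the limit of implicit Euler schemes with steps \<open>4\<^sup>-\<^sup>k\<close>. The limit curves satisfy the
  evolution variational inequality
  \<open>\<parallel>u(t) - v\<parallel>\<^sup>2 - \<parallel>u(s) - v\<parallel>\<^sup>2 \<le> 2(t - s)(F v - F(u(t)))\<close>, which gives contractivity, the
  smoothing effect and a nonincreasing speed. At each of the all but countably many times where the speed
  is continuous, the curve is differentiable and its derivative is minus the minimal subgradient.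
\<close>

section \<open>Semi-Hilbert spaces and implicit Euler schemes\<close>

text \<open>The variational inequality is preferred to the differential inclusion because it
  contains no derivative: it passes to limits by continuity of the norm and lower semicontinuity of
  the energy. The steps are divided by 4 since a scheme with step \<open>h\<close> and its
  refinement differ in squared norm by at most \<open>2 * h * f x\<close>; the distances then decay
  like \<open>2^(-k)\<close> and are summable. Almost everywhere differentiability of a Lipschitz
  curve in a Hilbert space is in this way reduced to a fact about one real monotone function.

  In the comparison, flows are only known to be locally Lipschitz away from time 0 and
  differentiable almost everywhere, so a monotonicity criterion for Lipschitz functions is needed. A
  constant \<open>k\<close> need not belong to \<open>L^2\<close>, and hence never occurs alone:
  only the positive part of \<open>u - v - k\<close> is used, which is square integrable for
  \<open>k \<ge> 0\<close>. Its increments are still between 0 and those of \<open>u - v\<close>,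
  because the energy and the truncation see \<open>k\<close> only inside a nondecreasing
  contraction.\<close>

locale semi_inner =
  fixes ip :: "'v::real_vector \<Rightarrow> 'v \<Rightarrow> real"
  assumes ip_commute: "ip x y = ip y x"
    and ip_add_left: "ip (x + y) z = ip x z + ip y z"
    and ip_scaleR_left: "ip (r *\<^sub>R x) y = r * ip x y"
    and ip_nonneg: "0 \<le> ip x x"
begin

lemma ip_add_right: "ip x (y + z) = ip x y + ip x z"
  by (metis ip_add_left ip_commute)

lemma ip_scaleR_right: "ip x (r *\<^sub>R y) = r * ip x y"
  by (metis ip_scaleR_left ip_commute)

lemma ip_zero_left: "ip 0 x = 0"
  using ip_scaleR_left[of 0 0 x] by simp

lemma ip_zero_right: "ip x 0 = 0"
  by (metis ip_zero_left ip_commute)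

lemma ip_minus_left: "ip (- x) y = - ip x y"
  using ip_scaleR_left[of "-1" x y] by simp

lemma ip_minus_right: "ip x (- y) = - ip x y"
  by (metis ip_minus_left ip_commute)

lemma ip_diff_left: "ip (x - y) z = ip x z - ip y z"
  using ip_add_left[of x "- y" z] by (simp add: ip_minus_left)

lemma ip_diff_right: "ip x (y - z) = ip x y - ip x z"
  by (metis ip_diff_left ip_commute)

lemmas ip_simps = ip_add_left ip_add_right ip_diff_left ip_diff_right ip_scaleR_left ip_scaleR_right
  ip_minus_left ip_minus_right ip_zero_left ip_zero_right

definition nrm :: "'v \<Rightarrow> real" where
  "nrm x = sqrt (ip x x)"

lemma nrm_nonneg [simp]: "0 \<le> nrm x"
  by (simp add: nrm_def ip_nonneg)

lemma nrm_power2: "(nrm x)\<^sup>2 = ip x x"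
  by (simp add: nrm_def ip_nonneg)

lemma nrm_zero [simp]: "nrm 0 = 0"
  by (simp add: nrm_def ip_zero_left)

lemma nrm_scaleR: "nrm (r *\<^sub>R x) = \<bar>r\<bar> * nrm x"
  by (simp add: nrm_def ip_scaleR_left ip_scaleR_right real_sqrt_mult flip: mult.assoc)

lemma nrm_minus: "nrm (- x) = nrm x"
  by (simp add: nrm_def ip_minus_left ip_minus_right)

lemma nrm_minus_commute: "nrm (x - y) = nrm (y - x)"
  using nrm_minus[of "x - y"] by simp

text \<open>Cauchy-Schwarz for a possibly degenerate form. If \<open>ip y y = 0\<close>, the
  nonnegative quadratic in \<open>t\<close> is affine and must be constant; the value of
  \<open>t\<close> inserted would otherwise make it equal to \<open>-1\<close>.\<close>

lemma abs_ip_le: "\<bar>ip x y\<bar> \<le> nrm x * nrm y"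
proof -
  have q: "0 \<le> ip x x + 2 * t * ip x y + t\<^sup>2 * ip y y" for t
    using ip_nonneg[of "x + t *\<^sub>R y"]
    by (simp add: ip_simps ip_commute[of y x] power2_eq_square algebra_simps)
  have "(ip x y)\<^sup>2 \<le> ip x x * ip y y"
  proof (cases "ip y y = 0")
    case True
    have "ip x y = 0"
    proof (rule ccontr)
      assume "ip x y \<noteq> 0"
      then show False
        using q[of "- (ip x x + 1) / (2 * ip x y)"] True by (simp add: field_simps)
    qed
    then show ?thesis by (simp add: True)
  next
    case False
    then have pos: "0 < ip y y"
      using ip_nonneg[of y] by simp
    have "0 \<le> ip x x - (ip x y)\<^sup>2 / ip y y"
      using q[of "- ip x y / ip y y"] pos by (simp add: field_simps power2_eq_square)
    then show ?thesis
      using pos by (simp add: field_simps)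
  qed
  then have "\<bar>ip x y\<bar>\<^sup>2 \<le> (nrm x * nrm y)\<^sup>2"
    by (simp add: power_mult_distrib nrm_power2)
  then show ?thesis
    by (rule power2_le_imp_le) simp
qed

lemma ip_le: "ip x y \<le> nrm x * nrm y"
  using abs_ip_le[of x y] by simp

lemma nrm_triangle: "nrm (x + y) \<le> nrm x + nrm y"
proof (rule power2_le_imp_le)
  have "(nrm (x + y))\<^sup>2 = (nrm x)\<^sup>2 + 2 * ip x y + (nrm y)\<^sup>2"
    by (simp add: nrm_power2 ip_simps ip_commute)
  also have "\<dots> \<le> (nrm x + nrm y)\<^sup>2"
    using ip_le[of x y] by (simp add: power2_sum)
  finally show "(nrm (x + y))\<^sup>2 \<le> (nrm x + nrm y)\<^sup>2" .
qed simp

lemma nrm_triangle_diff: "nrm (x - z) \<le> nrm (x - y) + nrm (y - z)"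
  using nrm_triangle[of "x - y" "y - z"] by simp

lemma abs_nrm_diff_le: "\<bar>nrm x - nrm y\<bar> \<le> nrm (x - y)"
  using nrm_triangle[of "x - y" y] nrm_triangle[of "y - x" x] nrm_minus_commute[of x y] by simp

lemma parallelogram: "(nrm (x + y))\<^sup>2 + (nrm (x - y))\<^sup>2 = 2 * (nrm x)\<^sup>2 + 2 * (nrm y)\<^sup>2"
  by (simp add: nrm_power2 ip_simps)

lemma tendsto_nrm:
  assumes "((\<lambda>n. nrm (X n - x)) \<longlongrightarrow> 0) G"
  shows "((\<lambda>n. nrm (X n)) \<longlongrightarrow> nrm x) G"
  by (rule LIM_zero_cancel, rule Lim_null_comparison[OF _ assms]) (simp add: abs_nrm_diff_le)

lemma tendsto_nrm_diff:
  assumes "((\<lambda>n. nrm (X n - x)) \<longlongrightarrow> 0) G"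
  shows "((\<lambda>n. nrm (X n - y)) \<longlongrightarrow> nrm (x - y)) G"
  using tendsto_nrm[of "\<lambda>n. X n - y" "x - y" G] assms by simp

lemma tendsto_ip:
  assumes "((\<lambda>n. nrm (X n - x)) \<longlongrightarrow> 0) G"
  shows "((\<lambda>n. ip (X n) y) \<longlongrightarrow> ip x y) G"
proof -
  have "((\<lambda>n. nrm (X n - x) * nrm y) \<longlongrightarrow> 0) G"
    using tendsto_mult_left_zero[OF assms] .
  then have "((\<lambda>n. ip (X n - x) y) \<longlongrightarrow> 0) G"
    by (rule Lim_null_comparison[rotated]) (simp add: abs_ip_le)
  then show ?thesis
    by (simp add: ip_diff_left LIM_zero_iff)
qed

end

section \<open>Completeness without definiteness\<close>

text \<open>Distinct functions that agree almost everywhere have distance 0, so limits are not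
  unique. Convergence is therefore always expressed by \<open>nrm (X n - x)\<close> tending to
  0.\<close>

locale semi_hilbert = semi_inner ip for ip :: "'v::real_vector \<Rightarrow> 'v \<Rightarrow> real" +
  assumes complete: "\<And>X :: nat \<Rightarrow> 'v. (\<And>e. 0 < e \<Longrightarrow> \<exists>N. \<forall>m\<ge>N. \<forall>n\<ge>N. nrm (X m - X n) < e)
    \<Longrightarrow> \<exists>x. (\<lambda>n. nrm (X n - x)) \<longlonglongrightarrow> 0"
begin

lemma complete_summable:
  assumes "summable c" and step: "\<And>n. nrm (X (Suc n) - X n) \<le> c n"
  shows "\<exists>x. (\<lambda>n. nrm (X n - x)) \<longlonglongrightarrow> 0"
proof (rule complete)
  fix e :: real assume "0 < e"
  have dist: "nrm (X n - X m) \<le> sum c {m..<n}" if "m \<le> n" for m n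
    using that
  proof (induction n rule: dec_induct)
    case (step n)
    then show ?case
      using nrm_triangle_diff[of "X (Suc n)" "X m" "X n"] assms(2)[of n] by simp
  qed simp
  obtain N where N: "\<And>m n. m \<ge> N \<Longrightarrow> \<bar>sum c {m..<n}\<bar> < e"
    using \<open>summable c\<close> \<open>0 < e\<close> unfolding summable_Cauchy real_norm_def by blast
  have "nrm (X m - X n) < e" if "m \<ge> N" "n \<ge> N" for m n
  proof (cases "m \<le> n")
    case True
    then show ?thesis
      using dist[of m n] N[of m n] that nrm_minus_commute[of "X m" "X n"] by simp
  next
    case False
    then show ?thesis
      using dist[of n m] N[of n m] that by simp
  qed
  then show "\<exists>N. \<forall>m\<ge>N. \<forall>n\<ge>N. nrm (X m - X n) < e"
    by blast
qed

text \<open>The form suited to minimizing sequences: the parallelogram law bounds squared distances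
  by a quantity that depends on the smaller index only.\<close>

lemma complete_power2_bound:
  assumes le: "\<And>m n. m \<le> n \<Longrightarrow> (nrm (X m - X n))\<^sup>2 \<le> c m" and c: "c \<longlonglongrightarrow> 0"
  shows "\<exists>x. (\<lambda>n. nrm (X n - x)) \<longlonglongrightarrow> 0"
proof (rule complete)
  fix e :: real assume "0 < e"
  then have "\<forall>\<^sub>F n in sequentially. c n < e\<^sup>2"
    using order_tendstoD(2)[OF c, of "e\<^sup>2"] by simp
  then obtain N where N: "\<And>n. n \<ge> N \<Longrightarrow> c n < e\<^sup>2"
    by (auto simp: eventually_sequentially)
  have aux: "nrm (X m - X n) < e" if "m \<ge> N" "m \<le> n" for m n
    using le[OF that(2)] N[OF that(1)] \<open>0 < e\<close>
    by (intro power2_less_imp_less[of _ e]) auto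
  have "nrm (X m - X n) < e" if "m \<ge> N" "n \<ge> N" for m n
    using aux[of m n] aux[of n m] that nrm_minus_commute[of "X m" "X n"] by (cases "m \<le> n") auto
  then show "\<exists>N. \<forall>m\<ge>N. \<forall>n\<ge>N. nrm (X m - X n) < e"
    by blast
qed

end

section \<open>Convex functionals and their subgradients\<close>

text \<open>An extended-valued functional is encoded by its effective domain \<open>D\<close> and a
  real function on it. \<open>f_closed\<close> says that sublevel sets are sequentially closed,
  which is lower semicontinuity of the extension by infinity; membership of the limit in
  \<open>D\<close> is part of its conclusion.\<close>

locale convex_functional = semi_hilbert ip for ip :: "'v::real_vector \<Rightarrow> 'v \<Rightarrow> real" +
  fixes D :: "'v set" and f :: "'v \<Rightarrow> real"
  assumes D_nonempty: "D \<noteq> {}"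
    and f_nonneg: "x \<in> D \<Longrightarrow> 0 \<le> f x"
    and D_convex: "\<lbrakk>x \<in> D; y \<in> D; 0 \<le> c; c \<le> 1\<rbrakk> \<Longrightarrow> (1 - c) *\<^sub>R x + c *\<^sub>R y \<in> D"
    and f_convex: "\<lbrakk>x \<in> D; y \<in> D; 0 \<le> c; c \<le> 1\<rbrakk>
      \<Longrightarrow> f ((1 - c) *\<^sub>R x + c *\<^sub>R y) \<le> (1 - c) * f x + c * f y"
    and f_closed: "\<And>X :: nat \<Rightarrow> 'v. \<lbrakk>\<And>n. X n \<in> D; \<And>n. f (X n) \<le> C; (\<lambda>n. nrm (X n - x)) \<longlonglongrightarrow> 0\<rbrakk>
      \<Longrightarrow> x \<in> D \<and> f x \<le> C"
begin

text \<open>Lower semicontinuity with bounds that vary along the sequence, as they arise when a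
  variational inequality is solved for the energy.\<close>

lemma f_closed_tendsto:
  assumes X: "\<And>n. X n \<in> D" "(\<lambda>n. nrm (X n - x)) \<longlonglongrightarrow> 0"
    and c: "\<forall>\<^sub>F n in sequentially. f (X n) \<le> c n" "c \<longlonglongrightarrow> C"
  shows "x \<in> D" "f x \<le> C"
proof -
  have "x \<in> D \<and> f x \<le> C + e" if "0 < e" for e
  proof -
    have "\<forall>\<^sub>F n in sequentially. c n < C + e"
      using order_tendstoD(2)[OF c(2)] that by simp
    with c(1) have "\<forall>\<^sub>F n in sequentially. f (X n) \<le> C + e"
      by eventually_elim simp
    then obtain N where N: "\<And>n. n \<ge> N \<Longrightarrow> f (X n) \<le> C + e"
      by (auto simp: eventually_sequentially)
    show ?thesis
      by (rule f_closed[of "\<lambda>n. X (n + N)"]) (use X N LIMSEQ_ignore_initial_segment[OF X(2)] in auto)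
  qed
  then show "x \<in> D" "f x \<le> C"
    using zero_less_one by (blast intro: field_le_epsilon)+
qed

definition subd :: "'v \<Rightarrow> 'v \<Rightarrow> bool" where
  "subd x g \<longleftrightarrow> x \<in> D \<and> (\<forall>v\<in>D. f x + ip g (v - x) \<le> f v)"

lemma prox_exists:
  assumes "0 < h"
  shows "\<exists>z. subd z ((1 / h) *\<^sub>R (x - z))"
proof -
  define Q where "Q z = f z + (nrm (z - x))\<^sup>2 / (2 * h)" for z
  define q where "q = (INF z\<in>D. Q z)"
  have Q_nonneg: "0 \<le> Q z" if "z \<in> D" for z
    using f_nonneg[OF that] assms by (simp add: Q_def)
  have bdd: "bdd_below (Q ` D)"
    using Q_nonneg unfolding bdd_below_def by auto
  have q_le: "q \<le> Q z" if "z \<in> D" for z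
    unfolding q_def by (rule cINF_lower[OF bdd that])
  have "\<exists>z\<in>D. Q z < q + 1 / real (Suc n)" for n
    using cInf_lessD[of "Q ` D" "q + 1 / real (Suc n)"] D_nonempty by (auto simp: q_def)
  then obtain Z where Z: "\<And>n. Z n \<in> D" "\<And>n. Q (Z n) < q + 1 / real (Suc n)"
    by metis
  \<comment> \<open>At the midpoint the quadratic term of \<open>Q\<close> lies below the mean of
    its end values by \<open>(nrm (a - b))^2 / (8 * h)\<close>, while \<open>Q\<close> stays above
    \<open>q\<close>.\<close>
  have mid: "(nrm (a - b))\<^sup>2 \<le> 4 * h * (Q a + Q b - 2 * q)" if "a \<in> D" "b \<in> D" for a b
  proof -
    let ?m = "(1 - 1/2) *\<^sub>R a + (1/2) *\<^sub>R b"
    have "(nrm (?m - x))\<^sup>2 = (nrm (a - x))\<^sup>2 / 2 + (nrm (b - x))\<^sup>2 / 2 - (nrm (a - b))\<^sup>2 / 4"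
      by (simp add: nrm_power2 ip_simps ip_commute field_simps)
    moreover have "f ?m \<le> f a / 2 + f b / 2"
      using f_convex[OF that, of "1/2"] by simp
    moreover have "q \<le> Q ?m"
      using q_le[OF D_convex[OF that, of "1/2"]] by simp
    ultimately have "q \<le> f a / 2 + f b / 2
        + ((nrm (a - x))\<^sup>2 / 2 + (nrm (b - x))\<^sup>2 / 2 - (nrm (a - b))\<^sup>2 / 4) / (2 * h)"
      by (simp add: Q_def)
    then have "2 * h * q \<le> h * f a + h * f b
        + ((nrm (a - x))\<^sup>2 / 2 + (nrm (b - x))\<^sup>2 / 2 - (nrm (a - b))\<^sup>2 / 4)"
      using assms by (simp add: field_simps)
    moreover have "4 * h * (Q a + Q b - 2 * q)
        = 4 * h * f a + 4 * h * f b - 8 * h * q + 2 * (nrm (a - x))\<^sup>2 + 2 * (nrm (b - x))\<^sup>2"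
      using assms by (simp add: Q_def field_simps)
    ultimately show ?thesis
      by linarith
  qed
  have "\<exists>z. (\<lambda>n. nrm (Z n - z)) \<longlonglongrightarrow> 0"
  proof (rule complete_power2_bound)
    fix m n :: nat assume "m \<le> n"
    then have "1 / real (Suc n) \<le> 1 / real (Suc m)"
      by (simp add: frac_le)
    then have "Q (Z m) + Q (Z n) - 2 * q \<le> 2 * (1 / real (Suc m))"
      using Z(2)[of m] Z(2)[of n] by linarith
    then show "(nrm (Z m - Z n))\<^sup>2 \<le> 4 * h * (2 * (1 / real (Suc m)))"
      using mid[OF Z(1) Z(1), of m n] assms
      by (meson mult_left_mono order_trans mult_nonneg_nonneg zero_le_numeral less_imp_le)
  next
    show "(\<lambda>m. 4 * h * (2 * (1 / real (Suc m)))) \<longlonglongrightarrow> 0"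
      by (intro tendsto_mult_right_zero) (rule LIMSEQ_Suc[OF lim_1_over_n])
  qed
  then obtain z where z: "(\<lambda>n. nrm (Z n - z)) \<longlonglongrightarrow> 0" ..
  have c: "(\<lambda>n. q + 1 / real (Suc n) - (nrm (Z n - x))\<^sup>2 / (2 * h)) \<longlonglongrightarrow> q + 0 - (nrm (z - x))\<^sup>2 / (2 * h)"
    using assms
    by (intro tendsto_intros tendsto_nrm_diff[OF z] LIMSEQ_Suc[OF lim_1_over_n]) auto
  have fZ: "\<forall>\<^sub>F n in sequentially. f (Z n) \<le> q + 1 / real (Suc n) - (nrm (Z n - x))\<^sup>2 / (2 * h)"
    using Z(2) by (intro always_eventually allI) (simp add: Q_def less_imp_le algebra_simps)
  have "z \<in> D" and "f z \<le> q + 0 - (nrm (z - x))\<^sup>2 / (2 * h)"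
    by (rule f_closed_tendsto[OF Z(1) z fZ c])+
  then have Qz: "Q z \<le> q"
    by (simp add: Q_def)
  have clear: "2 * h * a + d \<le> 2 * h * b + e" if "a + d / (2 * h) \<le> b + e / (2 * h)" for a b d e
    using mult_left_mono[OF that, of "2 * h"] assms by (simp add: distrib_left)
  have "f z + ip ((1 / h) *\<^sub>R (x - z)) (v - z) \<le> f v" if "v \<in> D" for v
  proof -
    define C where "C = (nrm (v - z))\<^sup>2 / (2 * h)"
    \<comment> \<open>\<open>z\<close> is compared with the point at parameter \<open>t\<close> on
      the segment to \<open>v\<close>. After division by \<open>t\<close> the quadratic term leaves
      the error \<open>t * C\<close>, which disappears as \<open>t\<close> decreases to 0.\<close>
    have le: "f z + ip ((1 / h) *\<^sub>R (x - z)) (v - z) \<le> f v + t * C" if t: "0 < t" "t \<le> 1" for t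
    proof -
      let ?w = "(1 - t) *\<^sub>R z + t *\<^sub>R v"
      have "Q z \<le> Q ?w"
        using Qz q_le[OF D_convex[OF \<open>z \<in> D\<close> \<open>v \<in> D\<close>, of t]] t by simp
      moreover have "f ?w \<le> (1 - t) * f z + t * f v"
        using f_convex[OF \<open>z \<in> D\<close> \<open>v \<in> D\<close>, of t] t by simp
      moreover have "(nrm (?w - x))\<^sup>2 = (nrm (z - x))\<^sup>2 - 2 * t * ip (x - z) (v - z) + t\<^sup>2 * (nrm (v - z))\<^sup>2"
        unfolding nrm_power2 power2_eq_square[of t]
        by (simp add: ip_simps ip_commute) (simp add: algebra_simps)
      ultimately have "f z + (nrm (z - x))\<^sup>2 / (2 * h) \<le> (1 - t) * f z + t * f v
          + ((nrm (z - x))\<^sup>2 - 2 * t * ip (x - z) (v - z) + t\<^sup>2 * (nrm (v - z))\<^sup>2) / (2 * h)"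
        by (simp add: Q_def)
      then have "2 * h * f z + (nrm (z - x))\<^sup>2 \<le> 2 * h * ((1 - t) * f z + t * f v)
          + ((nrm (z - x))\<^sup>2 - 2 * t * ip (x - z) (v - z) + t\<^sup>2 * (nrm (v - z))\<^sup>2)"
        by (rule clear)
      then have "t * (2 * h * f z) \<le> t * (2 * h * f v - 2 * ip (x - z) (v - z) + t * (nrm (v - z))\<^sup>2)"
        by (simp add: algebra_simps power2_eq_square)
      then have "2 * h * f z \<le> 2 * h * f v - 2 * ip (x - z) (v - z) + t * (nrm (v - z))\<^sup>2"
        using t by simp
      then have "2 * h * (f z + ip (x - z) (v - z) / h) \<le> 2 * h * (f v + t * C)"
        using \<open>0 < h\<close> by (simp add: C_def distrib_left)
      then have "f z + ip (x - z) (v - z) / h \<le> f v + t * C"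
        using \<open>0 < h\<close> by simp
      then show ?thesis
        by (simp add: ip_scaleR_left)
    qed
    show ?thesis
    proof (rule tendsto_lowerbound)
      show "((\<lambda>t. f v + t * C) \<longlongrightarrow> f v) (at_right 0)"
        by (auto intro!: tendsto_eq_intros)
      show "\<forall>\<^sub>F t in at_right 0. f z + ip ((1 / h) *\<^sub>R (x - z)) (v - z) \<le> f v + t * C"
        using le by (auto simp: eventually_at_right_field intro!: exI[of _ 1])
    qed simp
  qed
  then show ?thesis
    using \<open>z \<in> D\<close> by (auto simp: subd_def)
qed


section \<open>Resolvents and implicit Euler iterates\<close>

text \<open>The resolvent with step \<open>h\<close>. Monotonicity of subgradients determines it
  only up to distance 0, hence the choice.\<close>

definition J :: "real \<Rightarrow> 'v \<Rightarrow> 'v" where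
  "J h x = (SOME z. subd z ((1 / h) *\<^sub>R (x - z)))"

definition euler :: "real \<Rightarrow> nat \<Rightarrow> 'v \<Rightarrow> 'v" where
  "euler h n x = (J h ^^ n) x"

lemma euler_0 [simp]: "euler h 0 x = x"
  by (simp add: euler_def)

lemma euler_Suc: "euler h (Suc n) x = J h (euler h n x)"
  by (simp add: euler_def)

lemma euler_add: "euler h (m + n) x = euler h m (euler h n x)"
  by (simp add: euler_def funpow_add)

lemma subd_J: "0 < h \<Longrightarrow> subd (J h x) ((1 / h) *\<^sub>R (x - J h x))"
  unfolding J_def by (rule someI_ex) (rule prox_exists)

lemma J_in_D: "0 < h \<Longrightarrow> J h x \<in> D"
  using subd_J by (auto simp: subd_def)

text \<open>The subgradient inequality at the resolvent, with the inner product rewritten by the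
  three-point identity. It is the variational inequality for a single step.\<close>

lemma J_evi:
  assumes "0 < h" "v \<in> D"
  shows "(nrm (J h x - v))\<^sup>2 - (nrm (x - v))\<^sup>2 + (nrm (J h x - x))\<^sup>2 \<le> 2 * h * (f v - f (J h x))"
proof -
  let ?z = "J h x"
  have "f ?z + ip (x - ?z) (v - ?z) / h \<le> f v"
    using subd_J[OF assms(1), of x] assms(2) by (auto simp: subd_def ip_scaleR_left)
  then have "2 * ip (x - ?z) (v - ?z) \<le> 2 * h * (f v - f ?z)"
    using assms(1) by (simp add: field_simps)
  moreover have "(nrm (?z - v))\<^sup>2 - (nrm (x - v))\<^sup>2 + (nrm (?z - x))\<^sup>2 = 2 * ip (x - ?z) (v - ?z)"
    by (simp add: nrm_power2 ip_simps ip_commute)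
  ultimately show ?thesis
    by simp
qed

lemma f_J_le:
  assumes "0 < h" "x \<in> D"
  shows "f (J h x) \<le> f x"
proof -
  have "0 \<le> 2 * h * (f x - f (J h x))"
    using J_evi[OF assms, of x] by (smt (verit) nrm_zero diff_self zero_le_power2 nrm_nonneg power_zero_numeral)
  then show ?thesis
    using assms by (simp add: zero_le_mult_iff)
qed

lemma euler_in_D: "0 < h \<Longrightarrow> x \<in> D \<Longrightarrow> euler h n x \<in> D"
  by (cases n) (auto simp: euler_Suc J_in_D)

text \<open>The one-step inequalities are summed; since the energy decreases along the iteration,
  the intermediate energies may be replaced by the last one.\<close>

lemma euler_evi:
  assumes h: "0 < h" and x: "x \<in> D" and v: "v \<in> D"
  shows "(nrm (euler h n x - v))\<^sup>2 - (nrm (x - v))\<^sup>2 \<le> 2 * (real n * h) * (f v - f (euler h n x))"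
proof (induction n)
  case (Suc n)
  let ?a = "euler h n x"
  have "2 * (real n * h) * (f v - f ?a) \<le> 2 * (real n * h) * (f v - f (J h ?a))"
    using f_J_le[OF h euler_in_D[OF h x], of n] h by (intro mult_left_mono) auto
  moreover have "0 \<le> (nrm (J h ?a - ?a))\<^sup>2"
    by simp
  moreover have "2 * (real (Suc n) * h) * (f v - f (J h ?a))
        = 2 * (real n * h) * (f v - f (J h ?a)) + 2 * h * (f v - f (J h ?a))"
      by (simp add: algebra_simps)
  ultimately show ?case
    using Suc J_evi[OF h v, of ?a] unfolding euler_Suc by linarith
qed simp

lemma euler_evi':
  assumes "0 < h" "x \<in> D" "v \<in> D" "m \<le> n"
  shows "(nrm (euler h n x - v))\<^sup>2 - (nrm (euler h m x - v))\<^sup>2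
    \<le> 2 * (real (n - m) * h) * (f v - f (euler h n x))"
  using euler_evi[OF assms(1) euler_in_D[OF assms(1,2), of m] assms(3), of "n - m"] assms(4)
  by (simp flip: euler_add)

text \<open>Testing with the starting point itself gives a Hoelder bound of exponent 1/2 in time,
  uniform in the step because the energy is nonnegative and decreasing.\<close>

lemma euler_hoelder:
  assumes "0 < h" "x \<in> D"
  shows "(nrm (euler h (n + k) x - euler h n x))\<^sup>2 \<le> 2 * (real k * h) * f x"
proof -
  let ?a = "euler h n x"
  have a: "?a \<in> D"
    using assms by (rule euler_in_D)
  have dec: "f (euler h n x) \<le> f x"
  proof (induction n)
    case (Suc n)
    then show ?case
      using f_J_le[OF assms(1) euler_in_D[OF assms], of n] by (simp add: euler_Suc)
  qed simp
  have "(nrm (euler h k ?a - ?a))\<^sup>2 \<le> 2 * (real k * h) * (f ?a - f (euler h k ?a))"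
    using euler_evi[OF assms(1) a a, of k] by simp
  also have "\<dots> \<le> 2 * (real k * h) * f x"
    using f_nonneg[OF euler_in_D[OF assms(1) a], of k] dec assms(1) by (intro mult_left_mono) auto
  finally have "(nrm (euler h k ?a - ?a))\<^sup>2 \<le> 2 * (real k * h) * f x" .
  moreover have "euler h (n + k) x = euler h k ?a"
    by (metis add.commute euler_add)
  ultimately show ?thesis
    by simp
qed

text \<open>
  Inserting the two iterates into each other's variational inequality makes the error of one step
  bounded by a difference of energies, which telescopes.
\<close>

lemma euler_refine:
  assumes h: "0 < h" and m: "0 < m" and x: "x \<in> D"
  shows "(nrm (euler h n x - euler (h / real m) (n * m) x))\<^sup>2 \<le> 2 * h * f x"
proof -
  have hm: "0 < h / real m"
    using h m by simp
  have "(nrm (euler h n x - euler (h / real m) (n * m) x))\<^sup>2 \<le> 2 * h * (f x - f (euler (h / real m) (n * m) x))"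
  proof (induction n)
    case (Suc n)
    let ?a = "euler h n x" and ?b = "euler (h / real m) (n * m) x"
    let ?A = "J h ?a" and ?B = "euler (h / real m) m ?b"
    have b: "?b \<in> D"
      using hm x by (rule euler_in_D)
    have "(nrm (?A - ?b))\<^sup>2 - (nrm (?a - ?b))\<^sup>2 + (nrm (?A - ?a))\<^sup>2 \<le> 2 * h * (f ?b - f ?A)"
      by (rule J_evi[OF h b])
    moreover have "(nrm (?B - ?A))\<^sup>2 - (nrm (?b - ?A))\<^sup>2 \<le> 2 * h * (f ?A - f ?B)"
      using euler_evi[OF hm b J_in_D[OF h], of m ?a] m by simp
    moreover have "0 \<le> (nrm (?A - ?a))\<^sup>2"
      by simp
    ultimately have "(nrm (?A - ?B))\<^sup>2 \<le> 2 * h * (f x - f ?B)"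
      using Suc unfolding nrm_minus_commute[of ?A ?b] nrm_minus_commute[of ?A ?B] right_diff_distrib
      by linarith
    then show ?case
      by (simp add: euler_Suc euler_add)
  qed simp
  also have "\<dots> \<le> 2 * h * f x"
    using f_nonneg[OF euler_in_D[OF hm x], of "n * m"] h by (intro mult_left_mono) auto
  finally show ?thesis .
qed

lemma subd_monotone: "subd x g \<Longrightarrow> subd y k \<Longrightarrow> 0 \<le> ip (g - k) (x - y)"
  unfolding subd_def by (smt (verit, best) ip_diff_left ip_diff_right)

text \<open>The slope of each step is a subgradient at its end point. By monotonicity a slope is no
  longer than any subgradient at its starting point, so the slopes decrease in norm from
  \<open>nrm g\<close> on.\<close>

lemma euler_speed:
  assumes h: "0 < h" and g: "subd x g"
  shows "nrm (euler h n x - x) \<le> real n * h * nrm g"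
proof -
  have one: "nrm (J h x - x) \<le> h * nrm k" if "subd x k" for x k
  proof -
    define l where "l = (1 / h) *\<^sub>R (x - J h x)"
    have "0 \<le> ip (l - k) (J h x - x)"
      using subd_monotone[OF subd_J[OF h, of x] that] by (simp add: l_def)
    moreover have *: "J h x - x = (- h) *\<^sub>R l"
      using h by (simp add: l_def)
    ultimately have "0 \<le> (- h) * ip (l - k) l"
      by (simp add: ip_scaleR_right ip_minus_right)
    then have "ip l l \<le> ip k l"
      using h by (simp add: ip_diff_left mult_le_0_iff)
    then have "(nrm l)\<^sup>2 \<le> nrm k * nrm l"
      using ip_le[of k l] by (simp add: nrm_power2)
    then have "nrm l \<le> nrm k"
      by (metis mult_le_cancel_right nrm_nonneg order_le_less power2_eq_square)
    then show ?thesis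
      using h unfolding * nrm_scaleR by simp
  qed
  have "nrm (J h (euler h n x) - euler h n x) \<le> h * nrm g" for n
  proof (induction n)
    case 0
    then show ?case using one[OF g] by simp
  next
    case (Suc n)
    have "nrm (J h (euler h (Suc n) x) - euler h (Suc n) x)
        \<le> h * nrm ((1 / h) *\<^sub>R (euler h n x - euler h (Suc n) x))"
      unfolding euler_Suc[of h n] by (rule one) (rule subd_J[OF h])
    also have "\<dots> = nrm (J h (euler h n x) - euler h n x)"
      unfolding nrm_scaleR using h by (simp add: euler_Suc nrm_minus_commute)
    finally show ?case
      using Suc by simp
  qed
  note step = this
  show ?thesis
  proof (induction n)
    case (Suc n)
    then show ?case
      using nrm_triangle_diff[of "euler h (Suc n) x" x "euler h n x"] step[of n]
      by (simp add: euler_Suc algebra_simps)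
  qed simp
qed

section \<open>Curves satisfying the evolution variational inequality\<close>

definition evi :: "(real \<Rightarrow> 'v) \<Rightarrow> bool" where
  "evi u \<longleftrightarrow> (\<forall>s t v. 0 \<le> s \<longrightarrow> s < t \<longrightarrow> v \<in> D \<longrightarrow> u t \<in> D \<and>
     2 * (t - s) * f (u t) \<le> 2 * (t - s) * f v + (nrm (u s - v))\<^sup>2 - (nrm (u t - v))\<^sup>2)"

lemma evi_in_D: "evi u \<Longrightarrow> 0 < t \<Longrightarrow> u t \<in> D"
  unfolding evi_def using D_nonempty by (meson all_not_in_conv order_refl)

lemma eviD:
  "\<lbrakk>evi u; 0 \<le> s; s \<le> t; v \<in> D\<rbrakk>
    \<Longrightarrow> (nrm (u t - v))\<^sup>2 - (nrm (u s - v))\<^sup>2 \<le> 2 * (t - s) * (f v - f (u t))"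
  by (cases "s = t") (auto simp: evi_def algebra_simps)

text \<open>\<open>d n s t\<close> is the time elapsed for the approximating curve between
  \<open>s\<close> and \<open>t\<close>. For an Euler scheme it is a multiple of the step and agrees
  with \<open>t - s\<close> only in the limit.\<close>

lemma evi_limit:
  assumes conv: "\<And>t. 0 \<le> t \<Longrightarrow> (\<lambda>n. nrm (U n t - u t)) \<longlonglongrightarrow> 0"
    and D: "\<And>n t. 0 < t \<Longrightarrow> U n t \<in> D"
    and d: "\<And>s t. 0 \<le> s \<Longrightarrow> s < t \<Longrightarrow> (\<lambda>n. d n s t) \<longlonglongrightarrow> t - s"
    and ineq: "\<And>n s t v. \<lbrakk>0 \<le> s; s < t; v \<in> D\<rbrakk>
      \<Longrightarrow> (nrm (U n t - v))\<^sup>2 - (nrm (U n s - v))\<^sup>2 \<le> 2 * d n s t * (f v - f (U n t))"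
  shows "evi u"
  unfolding evi_def
proof (intro allI impI)
  fix s t :: real and v assume st: "0 \<le> s" "s < t" and v: "v \<in> D"
  \<comment> \<open>The inequality solved for \<open>f (U n t)\<close>, so that lower semicontinuity
    applies to it.\<close>
  define c where "c n = f v + ((nrm (U n s - v))\<^sup>2 - (nrm (U n t - v))\<^sup>2) / (2 * d n s t)" for n
  define C where "C = f v + ((nrm (u s - v))\<^sup>2 - (nrm (u t - v))\<^sup>2) / (2 * (t - s))"
  have "c \<longlonglongrightarrow> C"
    unfolding c_def C_def using st
    by (intro tendsto_intros tendsto_nrm_diff conv d) auto
  moreover have "\<forall>\<^sub>F n in sequentially. f (U n t) \<le> c n"
  proof -
    have "\<forall>\<^sub>F n in sequentially. 0 < d n s t"
      using order_tendstoD(1)[OF d[OF st], of 0] st by simp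
    then show ?thesis
    proof eventually_elim
      case (elim n)
      then show ?case
        using ineq[OF st v, of n] by (simp add: c_def field_simps)
    qed
  qed
  ultimately have "u t \<in> D" "f (u t) \<le> C"
    using f_closed_tendsto[OF D conv] st by auto
  then show "u t \<in> D \<and> 2 * (t - s) * f (u t) \<le> 2 * (t - s) * f v + (nrm (u s - v))\<^sup>2 - (nrm (u t - v))\<^sup>2"
    using st by (simp add: C_def field_simps)
qed

text \<open>The Hoelder bound will give continuity at time 0 for general initial values; the speed
  bound will be transported to later times by restarting the curve.\<close>

lemma evi_exists_D:
  assumes x: "x \<in> D"
  shows "\<exists>u. u 0 = x \<and> evi u \<and> (\<forall>t\<ge>0. (nrm (u t - x))\<^sup>2 \<le> 2 * t * f x) \<and>
    (\<forall>g t. subd x g \<longrightarrow> 0 \<le> t \<longrightarrow> nrm (u t - x) \<le> t * nrm g)"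
proof -
  define h :: "nat \<Rightarrow> real" where "h k = 1 / 4 ^ k" for k
  define N :: "nat \<Rightarrow> real \<Rightarrow> nat" where "N k t = nat \<lfloor>t * 4 ^ k\<rfloor>" for k t
  define U where "U k t = euler (h k) (N k t) x" for k t
  have h: "0 < h k" for k
    by (simp add: h_def)
  have N_le: "real (N k t) * h k \<le> t" and N_ge: "t - h k \<le> real (N k t) * h k" if "0 \<le> t" for k t
  proof -
    have "real (N k t) \<le> t * 4 ^ k" "t * 4 ^ k - 1 \<le> real (N k t)"
      using that by (auto simp: N_def)
    then show "real (N k t) * h k \<le> t" "t - h k \<le> real (N k t) * h k"
      by (simp_all add: h_def pos_divide_le_eq pos_le_divide_eq left_diff_distrib)
  qed
  have h_lim: "h \<longlonglongrightarrow> 0"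
    unfolding h_def using LIMSEQ_realpow_zero[of "1/4 :: real"] by (simp add: power_divide)
  have N_lim: "(\<lambda>k. real (N k t) * h k) \<longlonglongrightarrow> t" if "0 \<le> t" for t
  proof (rule tendsto_sandwich)
    show "(\<lambda>k. t - h k) \<longlonglongrightarrow> t"
      using tendsto_diff[OF tendsto_const h_lim, of t] by simp
  qed (use N_le N_ge that in auto)
  have N_mono: "N k s \<le> N k t" if "s \<le> t" for k s t
    unfolding N_def using that by (intro nat_mono floor_mono mult_right_mono) auto
  \<comment> \<open>Both schemes are compared with the finer one at the coarse grid time. The
    refinement error and the at most three fine steps left over each contribute at most
    \<open>sqrt (2 * h k * f x)\<close>, and \<open>sqrt (h k)\<close> equals
    \<open>(1 / 2) ^ k\<close>.\<close>
  have refine: "nrm (U (Suc k) t - U k t) \<le> 2 * sqrt (2 * f x) * (1 / 2) ^ k" if "0 \<le> t" for k t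
  proof -
    have fl: "\<lfloor>y\<rfloor> * 4 \<le> \<lfloor>4 * y\<rfloor>" "\<lfloor>4 * y\<rfloor> \<le> \<lfloor>y\<rfloor> * 4 + 3" for y :: real
      by linarith+
    have "N k t * 4 \<le> N (Suc k) t" "N (Suc k) t \<le> N k t * 4 + 3"
      using that fl[of "t * 4 ^ k"] unfolding N_def power_Suc mult.left_commute[of t 4]
      by (simp_all add: nat_le_iff le_nat_iff)
    then obtain r where r: "N (Suc k) t = N k t * 4 + r" "r \<le> 3"
      using le_Suc_ex by force
    let ?M = "euler (h (Suc k)) (N k t * 4) x"
    have hS: "h (Suc k) = h k / real 4"
      by (simp add: h_def)
    have bound: "nrm y \<le> sqrt (2 * f x) * (1 / 2) ^ k" if "(nrm y)\<^sup>2 \<le> 2 * h k * f x" for y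
    proof (rule power2_le_imp_le)
      have "(sqrt (2 * f x) * (1 / 2) ^ k)\<^sup>2 = 2 * f x * (1 / 2 ^ (k * 2))"
        using f_nonneg[OF x] by (simp add: power_mult_distrib power_divide flip: power_mult)
      also have "\<dots> = 2 * h k * f x"
        by (simp add: h_def mult.commute[of k] power_mult)
      finally show "(nrm y)\<^sup>2 \<le> (sqrt (2 * f x) * (1 / 2) ^ k)\<^sup>2"
        using that by simp
    qed (use f_nonneg[OF x] in simp)
    have "nrm (U k t - ?M) \<le> sqrt (2 * f x) * (1 / 2) ^ k"
      unfolding U_def hS using euler_refine[OF h _ x, of 4 k "N k t"] by (intro bound) simp
    moreover have "nrm (U (Suc k) t - ?M) \<le> sqrt (2 * f x) * (1 / 2) ^ k"
    proof (rule bound)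
      have "(nrm (U (Suc k) t - ?M))\<^sup>2 \<le> 2 * (real r * h (Suc k)) * f x"
        unfolding U_def r(1) by (rule euler_hoelder[OF h x])
      also have "\<dots> \<le> 2 * h k * f x"
        using r(2) h[of k] f_nonneg[OF x] by (intro mult_right_mono) (auto simp: hS)
      finally show "(nrm (U (Suc k) t - ?M))\<^sup>2 \<le> 2 * h k * f x" .
    qed
    ultimately show ?thesis
      using nrm_triangle_diff[of "U (Suc k) t" "U k t" ?M] nrm_minus_commute[of ?M "U k t"] by simp
  qed
  have "\<exists>y. (\<lambda>k. nrm (U k t - y)) \<longlonglongrightarrow> 0" if "0 \<le> t" for t
    using refine[OF that] by (rule complete_summable[rotated]) (intro summable_mult, simp)
  then obtain w where w: "\<And>t. 0 \<le> t \<Longrightarrow> (\<lambda>k. nrm (U k t - w t)) \<longlonglongrightarrow> 0"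
    by metis
  \<comment> \<open>The limit at time 0 is determined only up to distance 0, so the initial value is
    prescribed to be exactly \<open>x\<close>.\<close>
  define u where "u t = (if t = 0 then x else w t)" for t
  have U0: "U k 0 = x" for k
    by (simp add: U_def N_def)
  have u: "(\<lambda>k. nrm (U k t - u t)) \<longlonglongrightarrow> 0" if "0 \<le> t" for t
    using w[OF that] by (cases "t = 0") (auto simp: u_def U0)
  have "evi u"
  proof (rule evi_limit[where U=U and d="\<lambda>k s t. real (N k t - N k s) * h k"])
    show "(\<lambda>k. real (N k t - N k s) * h k) \<longlonglongrightarrow> t - s" if "0 \<le> s" "s < t" for s t
    proof -
      have "real (N k t - N k s) * h k = real (N k t) * h k - real (N k s) * h k" for k
        using N_mono[of s t k] that by (simp add: of_nat_diff algebra_simps)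
      then show ?thesis
        using N_lim[of t] N_lim[of s] that by (auto intro!: tendsto_intros)
    qed
    show "(nrm (U k t - v))\<^sup>2 - (nrm (U k s - v))\<^sup>2
        \<le> 2 * (real (N k t - N k s) * h k) * (f v - f (U k t))" if "s < t" "v \<in> D" for k s t v
      unfolding U_def using N_mono[of s t k] that by (intro euler_evi'[OF h x]) auto
  qed (use u in \<open>auto simp: U_def intro!: euler_in_D h x\<close>)
  moreover have "(nrm (u t - x))\<^sup>2 \<le> 2 * t * f x" if "0 \<le> t" for t
  proof (rule LIMSEQ_le_const2)
    show "(\<lambda>k. (nrm (U k t - x))\<^sup>2) \<longlonglongrightarrow> (nrm (u t - x))\<^sup>2"
      by (intro tendsto_intros tendsto_nrm_diff u that)
    have "(nrm (U k t - x))\<^sup>2 \<le> 2 * (real (N k t) * h k) * f x" for k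
      using euler_hoelder[OF h x, of k 0 "N k t"] by (simp add: U_def)
    moreover have "2 * (real (N k t) * h k) * f x \<le> 2 * t * f x" for k
      using N_le[OF that, of k] f_nonneg[OF x] by (intro mult_right_mono mult_left_mono) auto
    ultimately show "\<exists>M. \<forall>k\<ge>M. (nrm (U k t - x))\<^sup>2 \<le> 2 * t * f x"
      by (meson order_trans)
  qed
  moreover have "nrm (u t - x) \<le> t * nrm g" if "subd x g" "0 \<le> t" for g t
  proof (rule LIMSEQ_le_const2)
    show "(\<lambda>k. nrm (U k t - x)) \<longlonglongrightarrow> nrm (u t - x)"
      by (intro tendsto_nrm_diff u that)
    have "nrm (U k t - x) \<le> (real (N k t) * h k) * nrm g" for k
      unfolding U_def by (rule euler_speed[OF h that(1)])
    moreover have "(real (N k t) * h k) * nrm g \<le> t * nrm g" for k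
      using N_le[OF that(2), of k] by (intro mult_right_mono) auto
    ultimately show "\<exists>M. \<forall>k\<ge>M. nrm (U k t - x) \<le> t * nrm g"
      by (meson order_trans)
  qed
  ultimately show ?thesis
    by (intro exI[of _ u]) (auto simp: u_def)
qed


text \<open>
  The curves are compared at the points of a uniform partition; as for the implicit Euler scheme
  the error on each interval is a difference of energies, so it telescopes.
\<close>

lemma evi_contraction:
  assumes u: "evi u" and w: "evi w" and st: "0 \<le> s" "s \<le> t" and ws: "w s \<in> D"
  shows "nrm (u t - w t) \<le> nrm (u s - w s)"
proof -
  have est: "(nrm (u t - w t))\<^sup>2 \<le> (nrm (u s - w s))\<^sup>2 + 2 * (t - s) * f (w s) * (1 / real (Suc m))" for m
  proof -
    define n where "n = Suc m"
    define h where "h = (t - s) / real n"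
    define p where "p i = s + real i * h" for i :: nat
    have h: "0 \<le> h"
      using st by (simp add: h_def)
    have p: "0 \<le> p i" "p i \<le> p (Suc i)" "p (Suc i) - p i = h" for i
      using st h by (auto simp: p_def algebra_simps)
    \<comment> \<open>A partition point may be time 0, where membership in \<open>D\<close> does not
      follow from \<open>evi\<close> and comes from \<open>ws\<close>.\<close>
    have wD: "w (p i) \<in> D" for i
    proof (cases "real i * h = 0")
      case False
      then have "0 < real i * h"
        using h by (metis mult_nonneg_nonneg of_nat_0_le_iff order_le_less)
      then show ?thesis
        using st by (intro evi_in_D[OF w]) (simp add: p_def)
    qed (use ws in \<open>auto simp: p_def\<close>)
    have tele: "(nrm (u (p i) - w (p i)))\<^sup>2 - (nrm (u s - w s))\<^sup>2 \<le> 2 * h * (f (w s) - f (w (p i)))" for i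
    proof (induction i)
      case 0
      then show ?case by (simp add: p_def)
    next
      case (Suc i)
      let ?a = "p i" and ?b = "p (Suc i)"
      show ?case
      proof (cases "h = 0")
        case True
        then have "p (Suc i) = p i" by (simp add: p_def)
        then show ?thesis using Suc by simp
      next
        case False
        then have uD: "u ?b \<in> D"
          using h st by (intro evi_in_D[OF u]) (simp add: p_def add_nonneg_pos)
        \<comment> \<open>The inequality of \<open>u\<close> is tested with \<open>w ?a\<close>,
          then that of \<open>w\<close> with \<open>u ?b\<close>. In the sum the mixed distance and
          the energy of \<open>u\<close> cancel.\<close>
        have "(nrm (u ?b - w ?a))\<^sup>2 - (nrm (u ?a - w ?a))\<^sup>2 \<le> 2 * h * (f (w ?a) - f (u ?b))"
          using eviD[OF u p(1,2) wD, of i i] p(3)[of i] by simp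
        moreover have "(nrm (w ?b - u ?b))\<^sup>2 - (nrm (w ?a - u ?b))\<^sup>2 \<le> 2 * h * (f (u ?b) - f (w ?b))"
          using eviD[OF w p(1,2) uD, of i] p(3)[of i] by simp
        ultimately show ?thesis
          using Suc unfolding nrm_minus_commute[of "u ?b" "w ?a"] nrm_minus_commute[of "u ?b" "w ?b"] right_diff_distrib
          by linarith
      qed
    qed
    have pn: "p n = t"
      by (simp add: p_def h_def n_def del: of_nat_Suc)
    have "(nrm (u t - w t))\<^sup>2 - (nrm (u s - w s))\<^sup>2 \<le> 2 * h * (f (w s) - f (w t))"
      using tele[of n] unfolding pn .
    also have "\<dots> \<le> 2 * h * f (w s)"
      using f_nonneg[OF wD[of n]] h by (intro mult_left_mono) (auto simp: pn)
    finally show ?thesis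
      by (simp add: h_def n_def)
  qed
  have "(nrm (u t - w t))\<^sup>2 \<le> (nrm (u s - w s))\<^sup>2 + 2 * (t - s) * f (w s) * 0"
  proof (rule LIMSEQ_le_const)
    show "(\<lambda>m. (nrm (u s - w s))\<^sup>2 + 2 * (t - s) * f (w s) * (1 / real (Suc m)))
        \<longlonglongrightarrow> (nrm (u s - w s))\<^sup>2 + 2 * (t - s) * f (w s) * 0"
      by (intro tendsto_intros LIMSEQ_Suc[OF lim_1_over_n])
  qed (use est in blast)
  then show ?thesis
    using power2_le_imp_le[OF _ nrm_nonneg] by simp
qed

text \<open>Initial values in the closure of \<open>D\<close> are approximated from
  \<open>D\<close>. Contraction makes the curves converge uniformly in time, so both the inequality
  and continuity at 0 survive.\<close>

lemma evi_exists:
  assumes dense: "\<And>e. 0 < e \<Longrightarrow> \<exists>y\<in>D. nrm (y - x) < e"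
  shows "\<exists>u. u 0 = x \<and> evi u \<and> ((\<lambda>t. nrm (u t - x)) \<longlongrightarrow> 0) (at 0 within {0..})"
proof -
  have "\<exists>y\<in>D. nrm (y - x) < 1 / real (Suc n)" for n
    by (rule dense) simp
  then obtain X where X: "\<And>n. X n \<in> D" "\<And>n. nrm (X n - x) < 1 / real (Suc n)"
    by metis
  have "\<exists>u. u 0 = X n \<and> evi u \<and> (\<forall>t\<ge>0. (nrm (u t - X n))\<^sup>2 \<le> 2 * t * f (X n))" for n
    using evi_exists_D[OF X(1), of n] by blast
  then obtain U where U: "\<And>n. U n 0 = X n" "\<And>n. evi (U n)"
      "\<And>n t. 0 \<le> t \<Longrightarrow> (nrm (U n t - X n))\<^sup>2 \<le> 2 * t * f (X n)"
    by metis
  have X_lim: "(\<lambda>n. nrm (X n - x)) \<longlonglongrightarrow> 0"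
    by (rule tendsto_sandwich[OF _ _ tendsto_const LIMSEQ_Suc[OF lim_1_over_n]])
      (use X(2) in \<open>auto intro!: always_eventually less_imp_le\<close>)
  have U_dist: "nrm (U m t - U n t) \<le> nrm (X m - x) + nrm (X n - x)" if "0 \<le> t" for m n t
    using evi_contraction[OF U(2) U(2) order_refl that, of n m] X(1)[of n]
      nrm_triangle_diff[of "X m" "X n" x] nrm_minus_commute[of x "X n"] by (simp add: U(1))
  have "\<exists>y. (\<lambda>n. nrm (U n t - y)) \<longlonglongrightarrow> 0" if "0 \<le> t" for t
  proof (rule complete)
    fix e :: real assume "0 < e"
    then have "\<forall>\<^sub>F n in sequentially. nrm (X n - x) < e / 2"
      using order_tendstoD(2)[OF X_lim, of "e / 2"] by simp
    then obtain N where "\<And>n. n \<ge> N \<Longrightarrow> nrm (X n - x) < e / 2"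
      by (auto simp: eventually_sequentially)
    then have "nrm (U m t - U n t) < e" if "m \<ge> N" "n \<ge> N" for m n
      using U_dist[OF \<open>0 \<le> t\<close>, of m n] that by (smt (verit, best) field_sum_of_halves)
    then show "\<exists>N. \<forall>m\<ge>N. \<forall>n\<ge>N. nrm (U m t - U n t) < e"
      by blast
  qed
  then obtain w where w: "\<And>t. 0 \<le> t \<Longrightarrow> (\<lambda>n. nrm (U n t - w t)) \<longlonglongrightarrow> 0"
    by metis
  define u where "u t = (if t = 0 then x else w t)" for t
  have u: "(\<lambda>n. nrm (U n t - u t)) \<longlonglongrightarrow> 0" if "0 \<le> t" for t
    using w[OF that] X_lim by (cases "t = 0") (auto simp: u_def U)
  have U_u: "nrm (U n t - u t) \<le> nrm (X n - x)" if "0 \<le> t" for n t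
  proof (rule tendsto_le[OF sequentially_bot])
    show "(\<lambda>m. nrm (X m - x) + nrm (X n - x)) \<longlonglongrightarrow> nrm (X n - x)"
      using tendsto_add[OF X_lim tendsto_const] by simp
    show "(\<lambda>m. nrm (U m t - U n t)) \<longlonglongrightarrow> nrm (U n t - u t)"
      using tendsto_nrm_diff[OF u[OF that], of "U n t"] by (simp add: nrm_minus_commute)
  qed (use U_dist[OF that] in auto)
  have "evi u"
  proof (rule evi_limit[where U=U and d="\<lambda>n s t. t - s"])
    show "U n t \<in> D" if "0 < t" for n t
      using evi_in_D[OF U(2) that] .
    show "(nrm (U n t - v))\<^sup>2 - (nrm (U n s - v))\<^sup>2 \<le> 2 * (t - s) * (f v - f (U n t))"
      if "0 \<le> s" "s < t" "v \<in> D" for n s t v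
      using eviD[OF U(2), of s t v n] that by simp
  qed (use u in auto)
  moreover have "((\<lambda>t. nrm (u t - x)) \<longlongrightarrow> 0) (at 0 within {0..})"
  proof (rule tendstoI)
    fix e :: real assume "0 < e"
    then obtain n where n: "nrm (X n - x) < e / 4"
      using order_tendstoD(2)[OF X_lim, of "e / 4"] by (auto simp: eventually_sequentially)
    have "((\<lambda>t. 2 * t * f (X n)) \<longlongrightarrow> 0) (at 0 within {0..})"
      by (auto intro!: tendsto_eq_intros)
    then have "\<forall>\<^sub>F t in at 0 within {0..}. 2 * t * f (X n) < (e / 2)\<^sup>2"
      using \<open>0 < e\<close> by (intro order_tendstoD(2)) auto
    moreover have "\<forall>\<^sub>F t in at 0 within {0..}. 0 \<le> (t :: real)"
      by (auto simp: eventually_at_filter)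
    ultimately show "\<forall>\<^sub>F t in at 0 within {0..}. dist (nrm (u t - x)) 0 < e"
    proof eventually_elim
      case (elim t)
      then have "(nrm (U n t - X n))\<^sup>2 < (e / 2)\<^sup>2"
        using U(3)[of t n] by simp
      then have "nrm (U n t - X n) < e / 2"
        using \<open>0 < e\<close> by (intro power2_less_imp_less[of _ "e / 2"]) auto
      moreover have "nrm (u t - x) \<le> nrm (U n t - u t) + nrm (U n t - X n) + nrm (X n - x)"
        using nrm_triangle_diff[of "u t" x "U n t"] nrm_triangle_diff[of "U n t" x "X n"]
          nrm_minus_commute[of "u t" "U n t"] by simp
      ultimately show ?case
        using U_u[OF elim(2), of n] n by simp
    qed
  qed
  ultimately show ?thesis
    by (intro exI[of _ u]) (simp add: u_def)
qed

section \<open>Smoothing and speed\<close>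

lemma evi_shift: "evi u \<Longrightarrow> 0 \<le> r \<Longrightarrow> evi (\<lambda>t. u (t + r))"
  unfolding evi_def by (metis add_diff_cancel_right add_less_cancel_right add_nonneg_nonneg)

text \<open>The inequality is invariant under time shifts, so contraction can compare a curve with
  its own shift.\<close>

lemma evi_increment_mono:
  assumes "evi u" "0 < s" "s \<le> t" "0 \<le> h"
  shows "nrm (u (t + h) - u t) \<le> nrm (u (s + h) - u s)"
  using evi_contraction[OF evi_shift[OF assms(1,4)] assms(1), of s t] evi_in_D[OF assms(1,2)] assms by simp

text \<open>Restarting at \<open>u t\<close> produces a curve with the desired speed bound, and by
  contraction it is at distance 0 from the original one.\<close>

lemma evi_speed:
  assumes u: "evi u" and t: "0 < t" and g: "subd (u t) g" and h: "0 \<le> h"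
  shows "nrm (u (t + h) - u t) \<le> h * nrm g"
proof -
  have D: "u t \<in> D"
    using g by (simp add: subd_def)
  from evi_exists_D[OF D] g h obtain w
    where w: "w 0 = u t" "evi w" "nrm (w h - u t) \<le> h * nrm g"
    by blast
  have "nrm (u (h + t) - w h) \<le> nrm (u (0 + t) - w 0)"
    using evi_contraction[OF evi_shift[OF u] w(2) order_refl h, of t] t w(1) D by simp
  then show ?thesis
    using w nrm_triangle_diff[of "u (t + h)" "u t" "w h"] nrm_nonneg[of "u (h + t) - w h"]
    by (simp add: add.commute)
qed

text \<open>
  The smoothing effect: the squared increments are bounded by energy differences and decrease in
  time, so the last one is at most the mean of all.
\<close>

lemma evi_lipschitz_small:
  assumes u: "evi u" and r: "0 < r" and t: "2 * r \<le> t" and h: "0 < h" "h \<le> r"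
  shows "nrm (u (t + h) - u t) \<le> h * sqrt (4 * f (u r) / r)"
proof -
  \<comment> \<open>The number of steps of length \<open>h\<close> that fit between \<open>r\<close>
    and \<open>2 * r\<close>. As \<open>h \<le> r\<close> there is at least one, so rounding down
    loses at most half of \<open>r\<close>; this doubles the constant from 2 to 4.\<close>
  define n where "n = nat \<lfloor>r / h\<rfloor>"
  have n: "real n * h \<le> r" "r / 2 \<le> real n * h"
  proof -
    have 1: "1 \<le> r / h"
      using h by simp
    then have "real n \<le> r / h" "r / h - 1 < real n"
      by (auto simp: n_def)
    moreover have "1 \<le> real n"
      using 1 by (simp add: n_def)
    ultimately have "real n \<le> r / h" "r / h \<le> 2 * real n"
      by linarith+
    then show "real n * h \<le> r" "r / 2 \<le> real n * h"
      using h by (auto simp: field_simps)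
  qed
  define p where "p i = r + real i * h" for i :: nat
  have D: "u (p i) \<in> D" for i
    using r h by (intro evi_in_D[OF u]) (auto simp: p_def intro: add_pos_nonneg)
  have inc: "(nrm (u (p i + h) - u (p i)))\<^sup>2 \<le> 2 * h * (f (u (p i)) - f (u (p (Suc i))))" for i
    using eviD[OF u _ _ D, of "p i" "p (Suc i)" i] r h by (simp add: p_def algebra_simps)
  have "real n * (nrm (u (t + h) - u t))\<^sup>2 = (\<Sum>i<n. (nrm (u (t + h) - u t))\<^sup>2)"
    by simp
  also have "\<dots> \<le> (\<Sum>i<n. (nrm (u (p i + h) - u (p i)))\<^sup>2)"
  proof (intro sum_mono power_mono evi_increment_mono[OF u])
    fix i assume "i \<in> {..<n}"
    then have "real i * h \<le> real n * h"
      using h by (intro mult_right_mono) auto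
    then show "p i \<le> t"
      using n t by (simp add: p_def)
  qed (use r h in \<open>auto simp: p_def intro: add_pos_nonneg\<close>)
  also have "\<dots> \<le> (\<Sum>i<n. 2 * h * (f (u (p i)) - f (u (p (Suc i)))))"
    by (intro sum_mono inc)
  also have "\<dots> = 2 * h * (f (u r) - f (u (p n)))"
    unfolding sum_distrib_left[symmetric] sum_lessThan_telescope'[of "\<lambda>i. f (u (p i))"]
    by (simp add: p_def)
  also have "\<dots> \<le> 2 * h * f (u r)"
    using f_nonneg[OF D[of n]] h by (intro mult_left_mono) auto
  finally have "h * (real n * (nrm (u (t + h) - u t))\<^sup>2) \<le> h * (2 * h * f (u r))"
    using h by (intro mult_left_mono) auto
  moreover have "r / 2 * (nrm (u (t + h) - u t))\<^sup>2 \<le> real n * h * (nrm (u (t + h) - u t))\<^sup>2"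
    using n by (intro mult_right_mono) auto
  ultimately have "(nrm (u (t + h) - u t))\<^sup>2 \<le> h\<^sup>2 * (4 * f (u r) / r)"
    using r by (simp add: field_simps power2_eq_square)
  also have "\<dots> = (h * sqrt (4 * f (u r) / r))\<^sup>2"
    using f_nonneg[OF evi_in_D[OF u r]] r by (simp add: power_mult_distrib)
  finally show ?thesis
    by (rule power2_le_imp_le) (use f_nonneg[OF evi_in_D[OF u r]] r h in auto)
qed

lemma evi_lipschitz:
  assumes u: "evi u" and r: "0 < r" and t: "2 * r \<le> t" and h: "0 \<le> h"
  shows "nrm (u (t + h) - u t) \<le> h * sqrt (4 * f (u r) / r)"
proof (cases "h = 0")
  case False
  obtain n :: nat where n: "h / r < real n"
    using reals_Archimedean2 by blast
  then have n0: "0 < real n"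
    using h r False by (smt (verit) divide_nonneg_nonneg)
  define d where "d = h / real n"
  have d: "0 < d" "d \<le> r" "real n * d = h"
    using n n0 r h False by (auto simp: d_def field_simps)
  have "nrm (u (t + real i * d) - u t) \<le> real i * (d * sqrt (4 * f (u r) / r))" for i
  proof (induction i)
    case (Suc i)
    have eq: "t + real (Suc i) * d = t + real i * d + d"
      by (simp add: algebra_simps)
    have "nrm (u (t + real (Suc i) * d) - u (t + real i * d)) \<le> d * sqrt (4 * f (u r) / r)"
      unfolding eq using t d r by (intro evi_lipschitz_small[OF u r _ d(1,2)]) (simp add: add_increasing2)
    then show ?case
      using Suc nrm_triangle_diff[of "u (t + real (Suc i) * d)" "u t" "u (t + real i * d)"]
      by (simp add: algebra_simps)
  qed simp
  from this[of n] show ?thesis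
    using d(3) by (simp flip: mult.assoc)
qed simp


section \<open>Approximate subgradients\<close>

text \<open>The \<open>e\<close>-subdifferential of convex analysis. Difference quotients of the
  flow belong to it with an \<open>e\<close> proportional to the time step.\<close>

definition esubd :: "real \<Rightarrow> 'v \<Rightarrow> 'v \<Rightarrow> bool" where
  "esubd e x g \<longleftrightarrow> x \<in> D \<and> (\<forall>v\<in>D. f x + ip g (v - x) \<le> f v + e)"

lemma esubd_mono: "esubd e x g \<Longrightarrow> e \<le> e' \<Longrightarrow> esubd e' x g"
  unfolding esubd_def by force

lemma esubd_midpoint:
  assumes "esubd e x g" "esubd e x k"
  shows "esubd e x ((1 / 2) *\<^sub>R (g + k))"
  unfolding esubd_def
proof (intro conjI ballI)
  fix v assume "v \<in> D"
  then have "f x + ip g (v - x) \<le> f v + e" "f x + ip k (v - x) \<le> f v + e"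
    using assms by (auto simp: esubd_def)
  then show "f x + ip ((1 / 2) *\<^sub>R (g + k)) (v - x) \<le> f v + e"
    unfolding ip_scaleR_left ip_add_left by (simp add: field_simps)
qed (use assms in \<open>simp add: esubd_def\<close>)

lemma esubd_closed:
  assumes "\<And>n. n \<ge> N \<Longrightarrow> esubd e x (G n)" "(\<lambda>n. nrm (G n - p)) \<longlonglongrightarrow> 0"
  shows "esubd e x p"
  unfolding esubd_def
proof (intro conjI ballI)
  fix v assume v: "v \<in> D"
  show "f x + ip p (v - x) \<le> f v + e"
  proof (rule LIMSEQ_le_const2)
    show "(\<lambda>n. f x + ip (G n) (v - x)) \<longlonglongrightarrow> f x + ip p (v - x)"
      by (intro tendsto_intros tendsto_ip assms)
    show "\<exists>N. \<forall>n\<ge>N. f x + ip (G n) (v - x) \<le> f v + e"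
      using assms(1) v by (auto simp: esubd_def)
  qed
qed (use assms(1)[of N] in \<open>simp add: esubd_def\<close>)

text \<open>
  Weak compactness in elementary form: nearly minimal elements of the decreasing closed convex sets
  of \<open>e\<close>-subgradients converge, by the parallelogram law.
\<close>

lemma subd_exists_of_esubd:
  assumes R: "0 \<le> R" and ex: "\<And>e. 0 < e \<Longrightarrow> \<exists>g. esubd e x g \<and> nrm g \<le> R + e"
  shows "\<exists>p. subd x p \<and> nrm p \<le> R"
proof -
  define d :: "nat \<Rightarrow> real" where "d n = 1 / real (Suc n)" for n
  have d: "0 < d n" "d n \<le> 1" for n
    by (auto simp: d_def)
  have d_mono: "d n \<le> d m" if "m \<le> n" for m n
    using that by (simp add: d_def frac_le)
  have d_lim: "d \<longlonglongrightarrow> 0"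
    unfolding d_def by (rule LIMSEQ_Suc[OF lim_1_over_n])
  define r where "r n = (INF g\<in>{g. esubd (d n) x g}. (nrm g)\<^sup>2)" for n
  have bdd: "bdd_below ((\<lambda>g. (nrm g)\<^sup>2) ` {g. esubd (d n) x g})" for n
    by (rule bdd_belowI2[of _ 0]) simp
  have r_le: "r n \<le> (nrm g)\<^sup>2" if "esubd (d n) x g" for n g
    unfolding r_def using that by (intro cINF_lower bdd) simp
  have ne: "{g. esubd (d n) x g} \<noteq> {}" for n
    using ex[OF d(1)] by auto
  have "\<exists>g. esubd (d n) x g \<and> (nrm g)\<^sup>2 < r n + d n" for n
    using cInf_lessD[of "(\<lambda>g. (nrm g)\<^sup>2) ` {g. esubd (d n) x g}" "r n + d n"] ne[of n] d(1)[of n]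
    by (auto simp: r_def)
  then obtain G where G: "\<And>n. esubd (d n) x (G n)" "\<And>n. (nrm (G n))\<^sup>2 < r n + d n"
    by metis
  have r_mono: "r m \<le> r n" if "m \<le> n" for m n
    unfolding r_def[of n] using ne
    by (intro cINF_greatest r_le) (auto intro: esubd_mono d_mono[OF that])
  have r_bound: "r n \<le> (R + d n)\<^sup>2" for n
  proof -
    obtain g where "esubd (d n) x g" "nrm g \<le> R + d n"
      using ex[OF d(1)] by blast
    then show ?thesis
      using r_le[of n g] by (meson nrm_nonneg order_trans power_mono)
  qed
  have "(R + d n)\<^sup>2 \<le> (R + 1)\<^sup>2" for n
    using d[of n] R by (intro power_mono) auto
  then have "r n \<le> (R + 1)\<^sup>2" for n
    using r_bound order_trans by blast
  then obtain l where l: "r \<longlonglongrightarrow> l" and r_l: "\<And>n. r n \<le> l"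
    using incseq_convergent[of r "(R + 1)\<^sup>2"] r_mono unfolding incseq_def by blast
  have "\<exists>p. (\<lambda>n. nrm (G n - p)) \<longlonglongrightarrow> 0"
  proof (rule complete_power2_bound)
    fix m n :: nat assume mn: "m \<le> n"
    \<comment> \<open>Because the sets decrease, the midpoint of \<open>G m\<close> and
      \<open>G n\<close> still competes in the infimum \<open>r m\<close>; this lower bound feeds
      the parallelogram law.\<close>
    have "esubd (d m) x (G n)"
      using esubd_mono[OF G(1) d_mono[OF mn]] .
    then have "r m \<le> (nrm ((1 / 2) *\<^sub>R (G m + G n)))\<^sup>2"
      by (intro r_le esubd_midpoint G(1))
    also have "\<dots> = (nrm (G m + G n))\<^sup>2 / 4"
      unfolding nrm_scaleR by (simp add: power_mult_distrib power_divide)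
    finally show "(nrm (G m - G n))\<^sup>2 \<le> 2 * (l - r m) + 4 * d m"
      using parallelogram[of "G m" "G n"] G(2)[of m] G(2)[of n] r_l[of n] d_mono[OF mn]
      unfolding right_diff_distrib by linarith
  next
    show "(\<lambda>m. 2 * (l - r m) + 4 * d m) \<longlonglongrightarrow> 0"
      by (auto intro!: tendsto_eq_intros l d_lim)
  qed
  then obtain p where p: "(\<lambda>n. nrm (G n - p)) \<longlonglongrightarrow> 0" ..
  have esub_p: "esubd (d m) x p" for m
    by (rule esubd_closed[OF _ p, of m]) (rule esubd_mono[OF G(1) d_mono])
  have "subd x p"
    unfolding subd_def
  proof (intro conjI ballI)
    show "x \<in> D"
      using esub_p[of 0] by (simp add: esubd_def)
    fix v assume "v \<in> D"
    then have "f x + ip p (v - x) \<le> f v + d m" for m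
      using esub_p[of m] by (simp add: esubd_def)
    then show "f x + ip p (v - x) \<le> f v"
      by (intro LIMSEQ_le_const[OF tendsto_add[OF tendsto_const d_lim, of "f v", simplified]]) auto
  qed
  moreover have "(nrm p)\<^sup>2 \<le> R\<^sup>2"
  proof (rule LIMSEQ_le)
    show "(\<lambda>n. (nrm (G n))\<^sup>2) \<longlonglongrightarrow> (nrm p)\<^sup>2"
      by (intro tendsto_intros tendsto_nrm p)
    show "(\<lambda>n. (R + d n)\<^sup>2 + d n) \<longlonglongrightarrow> R\<^sup>2"
      by (auto intro!: tendsto_eq_intros d_lim)
    show "\<exists>N. \<forall>n\<ge>N. (nrm (G n))\<^sup>2 \<le> (R + d n)\<^sup>2 + d n"
      using G(2) r_bound by (meson add_mono less_imp_le order_refl order_trans)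
  qed
  then have "nrm p \<le> R"
    by (rule power2_le_imp_le) (rule R)
  ultimately show ?thesis
    by blast
qed

text \<open>Otherwise, for every \<open>e\<close>, the midpoint of \<open>p\<close> and a distant
  \<open>e\<close>-subgradient would have squared norm below that of \<open>p\<close> by a fixed
  amount, and \<open>subd_exists_of_esubd\<close> would produce a subgradient shorter than the
  minimal one.\<close>

lemma esubd_near_minimal:
  assumes p: "subd x p" and min: "\<And>g. subd x g \<Longrightarrow> nrm p \<le> nrm g" and "0 < \<eta>"
  shows "\<exists>e>0. \<forall>g. esubd e x g \<longrightarrow> nrm g \<le> nrm p + e \<longrightarrow> nrm (g - p) < \<eta>"
proof (rule ccontr)
  assume "\<not> ?thesis"
  then have far: "\<exists>g. esubd e x g \<and> nrm g \<le> nrm p + e \<and> \<eta> \<le> nrm (g - p)" if "0 < e" for e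
    using that by (meson not_less)
  \<comment> \<open>The distance lowers the squared norm of the midpoint by
    \<open>\<eta>^2 / 4 = 2 * \<delta>\<close>. The excess of \<open>nrm g\<close> over
    \<open>nrm p\<close> is kept so small that it costs only \<open>\<delta>\<close> of this
    gain.\<close>
  define \<delta> where "\<delta> = \<eta>\<^sup>2 / 8"
  have \<delta>: "0 < \<delta>"
    using \<open>0 < \<eta>\<close> by (simp add: \<delta>_def)
  have mid: "\<exists>g. esubd e x g \<and> (nrm g)\<^sup>2 \<le> (nrm p)\<^sup>2 - \<delta>" if "0 < e" for e
  proof -
    define e' where "e' = min e (min 1 (\<delta> / (nrm p + 1)))"
    have e': "0 < e'" "e' \<le> e" "e' \<le> 1" "e' \<le> \<delta> / (nrm p + 1)"
      using that \<delta> by (auto simp: e'_def intro!: divide_pos_pos add_nonneg_pos)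
    obtain g where g: "esubd e' x g" "nrm g \<le> nrm p + e'" "\<eta> \<le> nrm (g - p)"
      using far[OF e'(1)] by blast
    have "esubd e x g" "esubd e x p"
      using g(1) e'(2) p that by (auto intro: esubd_mono) (force simp: esubd_def subd_def)
    then have "esubd e x ((1 / 2) *\<^sub>R (g + p))"
      by (rule esubd_midpoint)
    moreover have "(nrm ((1 / 2) *\<^sub>R (g + p)))\<^sup>2 \<le> (nrm p)\<^sup>2 - \<delta>"
    proof -
      have "(nrm ((1 / 2) *\<^sub>R (g + p)))\<^sup>2 = (nrm (g + p))\<^sup>2 / 4"
        unfolding nrm_scaleR by (simp add: power_mult_distrib power_divide)
      moreover have "\<eta>\<^sup>2 \<le> (nrm (g - p))\<^sup>2"
        using g(3) \<open>0 < \<eta>\<close> by (intro power_mono) auto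
      moreover have "(nrm g)\<^sup>2 \<le> (nrm p + e')\<^sup>2"
        using g(2) by (intro power_mono) auto
      moreover have "(nrm p + e')\<^sup>2 \<le> (nrm p)\<^sup>2 + 2 * \<delta>"
      proof -
        have "e' * (nrm p + 1) \<le> \<delta>"
          using e'(4) by (simp add: pos_le_divide_eq add_nonneg_pos)
        moreover have "e' * e' \<le> e'"
          using e' mult_left_mono[of e' 1 e'] by simp
        ultimately show ?thesis
          using e'(1) unfolding power2_eq_square distrib_left distrib_right mult.commute[of "nrm p" e']
          by linarith
      qed
      ultimately show ?thesis
        using parallelogram[of g p] unfolding \<delta>_def by linarith
    qed
    ultimately show ?thesis
      by blast
  qed
  obtain g0 where "(nrm g0)\<^sup>2 \<le> (nrm p)\<^sup>2 - \<delta>"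
    using mid[OF zero_less_one] by blast
  then have nn: "0 \<le> (nrm p)\<^sup>2 - \<delta>"
    using zero_le_power2[of "nrm g0"] by linarith
  have "\<exists>q. subd x q \<and> nrm q \<le> sqrt ((nrm p)\<^sup>2 - \<delta>)"
  proof (rule subd_exists_of_esubd)
    fix e :: real assume "0 < e"
    then obtain g where "esubd e x g" "(nrm g)\<^sup>2 \<le> (nrm p)\<^sup>2 - \<delta>"
      using mid by blast
    moreover from this have "nrm g \<le> sqrt ((nrm p)\<^sup>2 - \<delta>)"
      by (simp add: real_le_rsqrt)
    ultimately show "\<exists>g. esubd e x g \<and> nrm g \<le> sqrt ((nrm p)\<^sup>2 - \<delta>) + e"
      using \<open>0 < e\<close> by (intro exI[of _ g]) auto
  qed (use nn in simp)
  then obtain q where q: "subd x q" "nrm q \<le> sqrt ((nrm p)\<^sup>2 - \<delta>)"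
    by blast
  have "(nrm p)\<^sup>2 \<le> (nrm q)\<^sup>2"
    using min[OF q(1)] by (intro power_mono) auto
  also have "\<dots> \<le> (nrm p)\<^sup>2 - \<delta>"
    using power_mono[OF q(2), of 2] nn by simp
  finally show False
    using \<delta> by simp
qed


section \<open>Differentiability of the flow\<close>

text \<open>The speed is a supremum of forward quotients, so it exists before any derivative does
  and inherits monotonicity in time from each increment.\<close>

lemma evi_speed_function:
  assumes u: "evi u"
  obtains \<phi> :: "real \<Rightarrow> real" where
    "\<And>s t. 0 < s \<Longrightarrow> s \<le> t \<Longrightarrow> \<phi> t \<le> \<phi> s"
    "\<And>t h. 0 < t \<Longrightarrow> 0 \<le> h \<Longrightarrow> nrm (u (t + h) - u t) \<le> h * \<phi> t"
    "\<And>t g. 0 < t \<Longrightarrow> subd (u t) g \<Longrightarrow> \<phi> t \<le> nrm g"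
    "\<And>t. 0 < t \<Longrightarrow> 0 \<le> \<phi> t"
proof
  define \<phi> where "\<phi> t = (SUP h\<in>{0<..}. nrm (u (t + h) - u t) / h)" for t
  have bdd: "bdd_above ((\<lambda>h. nrm (u (t + h) - u t) / h) ` {0<..})" if "0 < t" for t
  proof (rule bdd_aboveI2)
    fix h :: real assume "h \<in> {0<..}"
    then show "nrm (u (t + h) - u t) / h \<le> sqrt (4 * f (u (t / 2)) / (t / 2))"
      using evi_lipschitz[OF u, of "t / 2" t h] that by (simp add: divide_le_eq mult.commute)
  qed
  have upper: "nrm (u (t + h) - u t) / h \<le> \<phi> t" if "0 < t" "0 < h" for t h
    unfolding \<phi>_def using that by (intro cSUP_upper bdd) auto
  show "\<phi> t \<le> \<phi> s" if "0 < s" "s \<le> t" for s t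
    unfolding \<phi>_def[of t]
  proof (rule cSUP_least)
    fix h :: real assume h: "h \<in> {0<..}"
    then have "nrm (u (t + h) - u t) / h \<le> nrm (u (s + h) - u s) / h"
      using evi_increment_mono[OF u that, of h] by (simp add: divide_right_mono)
    also have "\<dots> \<le> \<phi> s"
      using that h by (intro upper) auto
    finally show "nrm (u (t + h) - u t) / h \<le> \<phi> s" .
  qed simp
  show "nrm (u (t + h) - u t) \<le> h * \<phi> t" if "0 < t" "0 \<le> h" for t h
    using upper[of t h] that by (cases "h = 0") (auto simp: divide_le_eq mult.commute)
  show "\<phi> t \<le> nrm g" if "0 < t" "subd (u t) g" for t g
    unfolding \<phi>_def
  proof (rule cSUP_least)
    fix h :: real assume h: "h \<in> {0<..}"
    then show "nrm (u (t + h) - u t) / h \<le> nrm g"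
      using evi_speed[OF u that, of h] by (simp add: divide_le_eq mult.commute)
  qed simp
  show "0 \<le> \<phi> t" if "0 < t" for t
    using upper[OF that, of 1] order_trans[OF nrm_nonneg] by simp
qed

lemma nrm_add_scaleR_power2:
  "(nrm (x + h *\<^sub>R g - v))\<^sup>2 = (nrm (x - v))\<^sup>2 - 2 * h * ip g (v - x) + h\<^sup>2 * (nrm g)\<^sup>2"
  unfolding nrm_power2 power2_eq_square[of h]
  by (simp add: ip_simps ip_commute distrib_left right_diff_distrib)

text \<open>
  Where the nonincreasing speed is continuous, the difference quotients from both sides are
  approximate subgradients of nearly minimal norm, hence converge to the minimal subgradient.
\<close>

lemma evi_derivative:
  assumes u: "evi u" and t: "0 < t" and cont: "isCont \<phi> t"
    and \<phi>_mono: "\<And>s t. 0 < s \<Longrightarrow> s \<le> t \<Longrightarrow> \<phi> t \<le> \<phi> s"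
    and \<phi>_ge: "\<And>t h. 0 < t \<Longrightarrow> 0 \<le> h \<Longrightarrow> nrm (u (t + h) - u t) \<le> h * \<phi> t"
    and \<phi>_le: "\<And>t g. 0 < t \<Longrightarrow> subd (u t) g \<Longrightarrow> \<phi> t \<le> nrm g"
    and \<phi>_nonneg: "\<And>t. 0 < t \<Longrightarrow> 0 \<le> \<phi> t"
  shows "\<exists>p. subd (u t) p \<and> ((\<lambda>h. nrm ((1 / h) *\<^sub>R (u (t + h) - u t) + p)) \<longlongrightarrow> 0) (at 0)"
proof -
  have D: "u t \<in> D"
    using evi_in_D[OF u t] .
  define M where "M = \<phi> (t / 2)"
  \<comment> \<open>\<open>\<xi>\<close> and \<open>\<zeta>\<close> are the backward and forward
    quotients with the sign of \<open>- u'\<close>, so both are candidates for the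
    subgradient.\<close>
  define \<xi> where "\<xi> h = (1 / h) *\<^sub>R (u (t - h) - u t)" for h
  define \<zeta> where "\<zeta> h = (1 / h) *\<^sub>R (u t - u (t + h))" for h
  have \<xi>_nrm: "nrm (\<xi> h) \<le> \<phi> (t - h)" if "0 < h" "h < t" for h
    using \<phi>_ge[of "t - h" h] that
    unfolding \<xi>_def nrm_scaleR nrm_minus_commute[of "u (t - h)"] by (simp add: divide_le_eq mult.commute)
  have \<xi>_esubd: "esubd (h * M\<^sup>2 / 2) (u t) (\<xi> h)" if h: "0 < h" "h \<le> t / 2" for h
    unfolding esubd_def
  proof (intro conjI ballI D)
    fix v assume v: "v \<in> D"
    have "u (t - h) - v = u t + h *\<^sub>R \<xi> h - v"
      using h by (simp add: \<xi>_def)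
    then have "(nrm (u (t - h) - v))\<^sup>2 = (nrm (u t - v))\<^sup>2 - 2 * h * ip (\<xi> h) (v - u t) + h\<^sup>2 * (nrm (\<xi> h))\<^sup>2"
      by (simp only: nrm_add_scaleR_power2)
    then have "2 * h * ip (\<xi> h) (v - u t) - h\<^sup>2 * (nrm (\<xi> h))\<^sup>2 \<le> 2 * h * (f v - f (u t))"
      using eviD[OF u _ _ v, of "t - h" t] h t by simp
    then have "h * (2 * ip (\<xi> h) (v - u t)) \<le> h * (2 * (f v - f (u t)) + h * (nrm (\<xi> h))\<^sup>2)"
      by (simp add: algebra_simps power2_eq_square)
    then have "2 * ip (\<xi> h) (v - u t) \<le> 2 * (f v - f (u t)) + h * (nrm (\<xi> h))\<^sup>2"
      using h by simp
    moreover have "nrm (\<xi> h) \<le> M"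
      using \<xi>_nrm[of h] \<phi>_mono[of "t / 2" "t - h"] h t by (simp add: M_def)
    then have "h * (nrm (\<xi> h))\<^sup>2 \<le> h * M\<^sup>2"
      using h by (intro mult_left_mono power_mono) auto
    ultimately show "f (u t) + ip (\<xi> h) (v - u t) \<le> f v + h * M\<^sup>2 / 2"
      by simp
  qed
  \<comment> \<open>Continuity of the speed enters here: a backward quotient is bounded by the speed
    at \<open>t - h\<close>, which has to come close to the speed at \<open>t\<close>.\<close>
  have \<xi>_near: "\<exists>\<delta>>0. \<forall>h. 0 < h \<longrightarrow> h < \<delta> \<longrightarrow> esubd e (u t) (\<xi> h) \<and> nrm (\<xi> h) \<le> \<phi> t + e"
    if "0 < e" for e
  proof -
    obtain r where r: "0 < r" "\<And>s. dist s t < r \<Longrightarrow> dist (\<phi> s) (\<phi> t) < e"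
      using cont \<open>0 < e\<close> unfolding continuous_at_eps_delta by blast
    define \<delta> where "\<delta> = min r (min (t / 2) (e / (M\<^sup>2 + 1)))"
    have "0 < \<delta>"
      using r t \<open>0 < e\<close> by (auto simp: \<delta>_def intro!: divide_pos_pos add_nonneg_pos)
    moreover have "esubd e (u t) (\<xi> h) \<and> nrm (\<xi> h) \<le> \<phi> t + e" if "0 < h" "h < \<delta>" for h
    proof
      have "h * (M\<^sup>2 + 1) \<le> e"
        using that by (simp add: \<delta>_def pos_less_divide_eq add_nonneg_pos less_imp_le)
      moreover have "0 \<le> h * M\<^sup>2"
        using that by simp
      ultimately have "h * M\<^sup>2 / 2 \<le> e"
        using that unfolding distrib_left by linarith
      then show "esubd e (u t) (\<xi> h)"
        using \<xi>_esubd[of h] that by (auto simp: \<delta>_def intro: esubd_mono)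
      have "dist (\<phi> (t - h)) (\<phi> t) < e"
        using that by (intro r) (simp add: \<delta>_def dist_real_def)
      then show "nrm (\<xi> h) \<le> \<phi> t + e"
        using \<xi>_nrm[of h] that t by (simp add: \<delta>_def dist_real_def)
    qed
    ultimately show ?thesis
      by blast
  qed
  have "\<exists>p. subd (u t) p \<and> nrm p \<le> \<phi> t"
  proof (rule subd_exists_of_esubd[OF \<phi>_nonneg[OF t]])
    fix e :: real assume "0 < e"
    then obtain \<delta> where "0 < \<delta>" "\<And>h. 0 < h \<Longrightarrow> h < \<delta> \<Longrightarrow> esubd e (u t) (\<xi> h) \<and> nrm (\<xi> h) \<le> \<phi> t + e"
      using \<xi>_near by blast
    then show "\<exists>g. esubd e (u t) g \<and> nrm g \<le> \<phi> t + e"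
      using dense by blast
  qed
  then obtain p where p: "subd (u t) p" "nrm p = \<phi> t"
    using \<phi>_le[OF t] by (metis antisym)
  have \<zeta>_nrm: "nrm (\<zeta> h) \<le> \<phi> t" if "0 < h" for h
    using \<phi>_ge[OF t, of h] that
    unfolding \<zeta>_def nrm_scaleR nrm_minus_commute[of "u t"] by (simp add: divide_le_eq mult.commute)
  \<comment> \<open>The inequality supplies the energy at \<open>t + h\<close> where the energy at
    \<open>t\<close> is wanted. The subgradient \<open>p\<close> already obtained from the backward
    quotients bounds the drop by \<open>h * ip p (\<zeta> h)\<close>.\<close>
  have \<zeta>_esubd: "esubd (h * (\<phi> t)\<^sup>2) (u t) (\<zeta> h)" if h: "0 < h" for h
    unfolding esubd_def
  proof (intro conjI ballI D)
    fix v assume v: "v \<in> D"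
    have eq: "u (t + h) = u t + (- h) *\<^sub>R \<zeta> h"
      using h by (simp add: \<zeta>_def)
    have "(nrm (u (t + h) - v))\<^sup>2 = (nrm (u t - v))\<^sup>2 - 2 * (- h) * ip (\<zeta> h) (v - u t) + (- h)\<^sup>2 * (nrm (\<zeta> h))\<^sup>2"
      unfolding eq by (rule nrm_add_scaleR_power2)
    moreover have "(nrm (u (t + h) - v))\<^sup>2 - (nrm (u t - v))\<^sup>2 \<le> 2 * h * (f v - f (u (t + h)))"
      using eviD[OF u _ _ v, of t "t + h"] h t by simp
    moreover have "0 \<le> (- h)\<^sup>2 * (nrm (\<zeta> h))\<^sup>2"
      by simp
    ultimately have "2 * h * ip (\<zeta> h) (v - u t) \<le> 2 * h * (f v - f (u (t + h)))"
      by linarith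
    then have "ip (\<zeta> h) (v - u t) \<le> f v - f (u (t + h))"
      using h by simp
    moreover have "f (u t) + ip p (u (t + h) - u t) \<le> f (u (t + h))"
      using p(1) evi_in_D[OF u, of "t + h"] h t by (simp add: subd_def)
    moreover have "ip p (u (t + h) - u t) = - (h * ip p (\<zeta> h))"
      unfolding eq by (simp add: ip_simps)
    moreover have "ip p (\<zeta> h) \<le> (\<phi> t)\<^sup>2"
      using ip_le[of p "\<zeta> h"] mult_left_mono[OF \<zeta>_nrm[OF h] \<phi>_nonneg[OF t]] p(2)
      by (simp add: power2_eq_square)
    then have "h * ip p (\<zeta> h) \<le> h * (\<phi> t)\<^sup>2"
      using h by (intro mult_left_mono) auto
    ultimately show "f (u t) + ip (\<zeta> h) (v - u t) \<le> f v + h * (\<phi> t)\<^sup>2"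
      by linarith
  qed
  have "((\<lambda>h. nrm ((1 / h) *\<^sub>R (u (t + h) - u t) + p)) \<longlongrightarrow> 0) (at 0)"
  proof (rule LIM_I)
    fix \<eta> :: real assume "0 < \<eta>"
    then obtain e where e: "0 < e" "\<And>g. esubd e (u t) g \<Longrightarrow> nrm g \<le> nrm p + e \<Longrightarrow> nrm (g - p) < \<eta>"
      using esubd_near_minimal[OF p(1), of \<eta>] \<phi>_le[OF t] p(2) by auto
    obtain \<delta> where \<delta>: "0 < \<delta>" "\<And>h. 0 < h \<Longrightarrow> h < \<delta> \<Longrightarrow> esubd e (u t) (\<xi> h) \<and> nrm (\<xi> h) \<le> \<phi> t + e"
      using \<xi>_near[OF e(1)] by blast
    define r where "r = min \<delta> (e / ((\<phi> t)\<^sup>2 + 1))"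
    have r: "0 < r"
      using \<delta>(1) e(1) by (auto simp: r_def intro!: divide_pos_pos add_nonneg_pos)
    have "nrm ((1 / h) *\<^sub>R (u (t + h) - u t) + p) < \<eta>" if h: "h \<noteq> 0" "\<bar>h\<bar> < r" for h
    proof (cases "0 < h")
      case True
      have "h * ((\<phi> t)\<^sup>2 + 1) \<le> e"
        using h True by (simp add: r_def pos_less_divide_eq add_nonneg_pos less_imp_le)
      then have "h * (\<phi> t)\<^sup>2 \<le> e"
        using True unfolding distrib_left by linarith
      then have "nrm (\<zeta> h - p) < \<eta>"
        using \<zeta>_esubd[OF True] \<zeta>_nrm[OF True] e(1) p(2) by (intro e(2)) (auto intro: esubd_mono)
      moreover have "(1 / h) *\<^sub>R (u (t + h) - u t) + p = p - \<zeta> h"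
        by (simp add: \<zeta>_def scaleR_diff_right)
      ultimately show ?thesis
        using nrm_minus_commute[of "\<zeta> h" p] by simp
    next
      case False
      then have k: "0 < - h" "- h < \<delta>"
        using h by (auto simp: r_def)
      have "nrm (\<xi> (- h) - p) < \<eta>"
        using \<delta>(2)[OF k] p(2) by (intro e(2)) auto
      moreover have "(1 / h) *\<^sub>R (u (t + h) - u t) + p = p - \<xi> (- h)"
        by (simp add: \<xi>_def)
      ultimately show ?thesis
        using nrm_minus_commute[of "\<xi> (- h)" p] by simp
    qed
    then show "\<exists>r>0. \<forall>h. h \<noteq> 0 \<and> norm (h - 0) < r \<longrightarrow>
        norm (nrm ((1 / h) *\<^sub>R (u (t + h) - u t) + p) - 0) < \<eta>"
      using r by (intro exI[of _ r]) auto
  qed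
  then show ?thesis
    using p(1) by blast
qed

theorem gradient_flow_exists:
  assumes dense: "\<And>e. 0 < e \<Longrightarrow> \<exists>y\<in>D. nrm (y - x) < e"
  obtains u where "u 0 = x"
    and "\<And>t. 0 \<le> t \<Longrightarrow> ((\<lambda>s. nrm (u s - u t)) \<longlongrightarrow> 0) (at t within {0..})"
    and "\<And>a b. 0 < a \<Longrightarrow> a \<le> b
      \<Longrightarrow> \<exists>L. \<forall>s\<in>{a..b}. \<forall>t\<in>{a..b}. nrm (u s - u t) \<le> L * \<bar>s - t\<bar>"
    and "AE t in lborel. 0 < t \<longrightarrow>
      (\<exists>p. subd (u t) p \<and> ((\<lambda>h. nrm ((1 / h) *\<^sub>R (u (t + h) - u t) + p)) \<longlongrightarrow> 0) (at 0))"
proof -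
  obtain u where u0: "u 0 = x" and u: "evi u"
      and lim0: "((\<lambda>t. nrm (u t - x)) \<longlongrightarrow> 0) (at 0 within {0..})"
    using evi_exists[OF dense] by blast
  have lip: "nrm (u s - u t) \<le> sqrt (4 * f (u (a / 2)) / (a / 2)) * \<bar>s - t\<bar>"
    if "0 < a" "a \<le> s" "a \<le> t" for a s t
  proof -
    have *: "nrm (u s - u t) \<le> (s - t) * sqrt (4 * f (u (a / 2)) / (a / 2))"
      if "a \<le> t" "t \<le> s" for s t
      using evi_lipschitz[OF u, of "a / 2" t "s - t"] that \<open>0 < a\<close> by simp
    show ?thesis
      using *[of t s] *[of s t] that nrm_minus_commute[of "u s" "u t"]
      by (cases "t \<le> s") (auto simp: mult.commute)
  qed
  have cont: "((\<lambda>s. nrm (u s - u t)) \<longlongrightarrow> 0) (at t within {0..})" if "0 \<le> t" for t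
  proof (cases "t = 0")
    case True
    then show ?thesis using lim0 u0 by simp
  next
    case False
    then have t: "0 < t" using that by simp
    let ?L = "sqrt (4 * f (u (t / 2 / 2)) / (t / 2 / 2))"
    show ?thesis
    proof (rule Lim_null_comparison)
      have "\<forall>\<^sub>F s in at t within {0..}. t / 2 < s"
        using t by (intro order_tendstoD(1)[OF tendsto_ident_at]) simp
      then show "\<forall>\<^sub>F s in at t within {0..}. norm (nrm (u s - u t)) \<le> ?L * \<bar>s - t\<bar>"
        by eventually_elim (use lip[of "t / 2" _ t] t in auto)
      show "((\<lambda>s. ?L * \<bar>s - t\<bar>) \<longlongrightarrow> 0) (at t within {0..})"
        by (auto intro!: tendsto_eq_intros)
    qed
  qed
  obtain \<phi> :: "real \<Rightarrow> real" where \<phi>: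
    "\<And>s t. 0 < s \<Longrightarrow> s \<le> t \<Longrightarrow> \<phi> t \<le> \<phi> s"
    "\<And>t h. 0 < t \<Longrightarrow> 0 \<le> h \<Longrightarrow> nrm (u (t + h) - u t) \<le> h * \<phi> t"
    "\<And>t g. 0 < t \<Longrightarrow> subd (u t) g \<Longrightarrow> \<phi> t \<le> nrm g"
    "\<And>t. 0 < t \<Longrightarrow> 0 \<le> \<phi> t"
    using evi_speed_function[OF u] by metis
  have "countable {t \<in> {0<..}. \<not> isCont (\<lambda>t. - \<phi> t) t}"
    using \<phi>(1) by (intro mono_on_ctble_discont_open) (auto simp: mono_on_def)
  then have "{t \<in> {0<..}. \<not> isCont (\<lambda>t. - \<phi> t) t} \<in> null_sets lborel"
    by (rule countable_imp_null_set_lborel)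
  then have "AE t in lborel. 0 < t \<longrightarrow> isCont \<phi> t"
    by (rule AE_I') (use isCont_minus in force)
  then have "AE t in lborel. 0 < t \<longrightarrow>
      (\<exists>p. subd (u t) p \<and> ((\<lambda>h. nrm ((1 / h) *\<^sub>R (u (t + h) - u t) + p)) \<longlongrightarrow> 0) (at 0))"
    by eventually_elim (use evi_derivative[OF u _ _ \<phi>] in blast)
  moreover have "\<exists>L. \<forall>s\<in>{a..b}. \<forall>t\<in>{a..b}. nrm (u s - u t) \<le> L * \<bar>s - t\<bar>" if "0 < a" for a b
    by (rule exI) (intro ballI, rule lip[OF that], auto)
  ultimately show thesis
    by (intro that[of u] u0 cont)
qed

end

section \<open>The space \<open>L\<^sup>2\<close>\<close>

instantiation "fun" :: (type, real_vector) real_vector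
begin

definition "r *\<^sub>R f = (\<lambda>x. r *\<^sub>R f x)"

instance
  by standard (simp_all add: fun_eq_iff scaleR_fun_def algebra_simps)

end

lemma scaleR_fun_apply [simp]: "(r *\<^sub>R f) x = r *\<^sub>R f x"
  by (simp add: scaleR_fun_def)

lemma Ltwo_measurable: "u \<in> Ltwo N \<Longrightarrow> u \<in> borel_measurable N"
  by (simp add: Ltwo_def)

lemma Ltwo_integrable_mult:
  assumes "u \<in> Ltwo N" "v \<in> Ltwo N"
  shows "integrable N (\<lambda>x. u x * v x)"
proof (rule Bochner_Integration.integrable_bound)
  show "integrable N (\<lambda>x. (u x)\<^sup>2 + (v x)\<^sup>2)"
    using assms by (simp add: Ltwo_def)
  have "\<bar>a * b\<bar> \<le> a\<^sup>2 + b\<^sup>2" for a b :: real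
    using sum_squares_bound[of "\<bar>a\<bar>" "\<bar>b\<bar>"] zero_le_power2[of a] zero_le_power2[of b]
    by (simp add: abs_mult) (use mult_nonneg_nonneg[of "\<bar>a\<bar>" "\<bar>b\<bar>"] in linarith)
  then show "AE x in N. norm (u x * v x) \<le> norm ((u x)\<^sup>2 + (v x)\<^sup>2)"
    by simp
qed (use assms in \<open>auto simp: Ltwo_def\<close>)

lemma Ltwo_bound:
  assumes "u \<in> Ltwo N" "w \<in> borel_measurable N" "\<And>x. x \<in> space N \<Longrightarrow> \<bar>w x\<bar> \<le> \<bar>u x\<bar>"
  shows "w \<in> Ltwo N"
proof -
  have "integrable N (\<lambda>x. (w x)\<^sup>2)"
  proof (rule Bochner_Integration.integrable_bound)
    show "integrable N (\<lambda>x. (u x)\<^sup>2)"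
      using assms(1) by (simp add: Ltwo_def)
    show "AE x in N. norm ((w x)\<^sup>2) \<le> norm ((u x)\<^sup>2)"
      using assms(3) by (intro AE_I2) (simp add: abs_le_square_iff)
  qed (use assms(2) in measurable)
  then show ?thesis
    using assms(2) by (simp add: Ltwo_def)
qed

lemma Ltwo_scale: "u \<in> Ltwo N \<Longrightarrow> (\<lambda>x. c * u x) \<in> Ltwo N"
  by (auto simp: Ltwo_def power_mult_distrib)

lemma Ltwo_add:
  assumes "u \<in> Ltwo N" "v \<in> Ltwo N"
  shows "(\<lambda>x. u x + v x) \<in> Ltwo N"
  using Ltwo_integrable_mult[OF assms] assms
  by (auto simp: Ltwo_def power2_sum mult.assoc)

lemma Ltwo_diff:
  assumes "u \<in> Ltwo N" "v \<in> Ltwo N"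
  shows "(\<lambda>x. u x - v x) \<in> Ltwo N"
proof -
  have "(\<lambda>x. u x - v x) = (\<lambda>x. u x + (- 1) * v x)"
    by auto
  then show ?thesis
    using Ltwo_add[OF assms(1) Ltwo_scale[OF assms(2), of "- 1"]] by (simp only:)
qed

lemma Ltwo_zero: "(\<lambda>x. 0) \<in> Ltwo N"
  by (simp add: Ltwo_def)

lemma Ltwo_subspace: "subspace (Ltwo N)"
  unfolding subspace_def zero_fun_def plus_fun_def scaleR_fun_def real_scaleR_def
  by (intro conjI ballI allI Ltwo_zero Ltwo_add Ltwo_scale)

lemma Ltwo_norm_power2: "(Ltwo_norm N u)\<^sup>2 = (LINT x|N. (u x)\<^sup>2)"
  by (simp add: Ltwo_norm_def)

lemma nn_integral_Ltwo:
  assumes "u \<in> Ltwo N"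
  shows "(\<integral>\<^sup>+x. ennreal ((u x)\<^sup>2) \<partial>N) = ennreal ((Ltwo_norm N u)\<^sup>2)"
proof -
  have "integrable N (\<lambda>x. (u x)\<^sup>2)"
    using assms by (simp add: Ltwo_def)
  then have "(\<integral>\<^sup>+x. ennreal ((u x)\<^sup>2) \<partial>N) = ennreal (LINT x|N. (u x)\<^sup>2)"
    by (rule nn_integral_eq_integral) simp
  then show ?thesis
    by (simp only: Ltwo_norm_power2)
qed

text \<open>Square integrability and the norm bound in one step, from a nonnegative integral as
  Fatou's lemma provides it.\<close>

lemma Ltwo_normI:
  assumes "u \<in> borel_measurable N" "(\<integral>\<^sup>+x. ennreal ((u x)\<^sup>2) \<partial>N) \<le> ennreal (e\<^sup>2)" "0 \<le> e"
  shows "u \<in> Ltwo N" "Ltwo_norm N u \<le> e"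
proof -
  have "integrable N (\<lambda>x. (u x)\<^sup>2)"
    using assms(1,2) by (intro integrableI_bounded) (auto simp: less_top[symmetric] top_unique)
  then show u: "u \<in> Ltwo N"
    using assms(1) by (simp add: Ltwo_def)
  have "(Ltwo_norm N u)\<^sup>2 \<le> e\<^sup>2"
    using assms(2) nn_integral_Ltwo[OF u] by (simp add: ennreal_le_iff)
  then show "Ltwo_norm N u \<le> e"
    using assms(3) by (rule power2_le_imp_le)
qed

text \<open>
  A linear projection of all functions onto \<open>L\<^sup>2\<close>, obtained from a Hamel basis, turns the inner
  product of \<open>L\<^sup>2\<close> into a total semi-inner product, so that no carrier set is needed in the Hilbert
  space theory.
\<close>

locale Ltwo_projection =
  fixes N :: "'a measure" and P :: "('a \<Rightarrow> real) \<Rightarrow> ('a \<Rightarrow> real)"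
  assumes P_linear: "linear P" and P_Ltwo: "P u \<in> Ltwo N" and P_id: "u \<in> Ltwo N \<Longrightarrow> P u = u"
begin

definition pip :: "('a \<Rightarrow> real) \<Rightarrow> ('a \<Rightarrow> real) \<Rightarrow> real" where
  "pip u v = Ltwo_inner N (P u) (P v)"

lemma P_diff: "P (u - v) = (\<lambda>x. P u x - P v x)"
  by (simp add: linear_diff[OF P_linear] fun_eq_iff)

lemma P_add: "P (u + v) = (\<lambda>x. P u x + P v x)"
  by (simp add: linear_add[OF P_linear] fun_eq_iff)

lemma P_scale: "P (r *\<^sub>R u) = (\<lambda>x. r * P u x)"
  by (simp add: linear_scale[OF P_linear] fun_eq_iff)

sublocale semi_inner pip
proof
  fix u v w :: "'a \<Rightarrow> real" and r :: real
  show "pip u v = pip v u"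
    by (simp add: pip_def Ltwo_inner_def mult.commute)
  show "pip (u + v) w = pip u w + pip v w"
    using Ltwo_integrable_mult[OF P_Ltwo P_Ltwo]
    by (simp add: pip_def Ltwo_inner_def P_add distrib_right)
  show "pip (r *\<^sub>R u) v = r * pip u v"
    by (simp add: pip_def Ltwo_inner_def P_scale mult.assoc)
  show "0 \<le> pip u u"
    by (simp add: pip_def Ltwo_inner_def)
qed

lemma nrm_eq: "nrm u = Ltwo_norm N (P u)"
  by (simp add: nrm_def pip_def Ltwo_inner_def Ltwo_norm_def power2_eq_square)

lemma nrm_diff_eq: "nrm (u - v) = Ltwo_norm N (\<lambda>x. P u x - P v x)"
  by (simp add: nrm_eq P_diff)

end

lemma Ltwo_projection_exists: "\<exists>P. Ltwo_projection N P"
proof -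
  have "\<exists>P. range P \<subseteq> Ltwo N \<and> linear P \<and> (\<forall>v\<in>Ltwo N. P (id v) = v)"
    by (rule linear_exists_left_inverse_on[OF linear_id Ltwo_subspace]) simp
  then show ?thesis
    by (auto simp: Ltwo_projection_def)
qed

section \<open>Completeness of \<open>L^2\<close>\<close>

text \<open>Riesz-Fischer: a rapidly converging subsequence converges almost everywhere, and Fatou's
  lemma identifies its pointwise limit as the limit in norm.\<close>

lemma Ltwo_complete:
  fixes X :: "nat \<Rightarrow> 'a \<Rightarrow> real"
  assumes X: "\<And>n. X n \<in> Ltwo N"
    and Cauchy: "\<And>e. 0 < e \<Longrightarrow> \<exists>M. \<forall>m\<ge>M. \<forall>n\<ge>M. Ltwo_norm N (\<lambda>x. X m x - X n x) < e"
  shows "\<exists>y\<in>Ltwo N. (\<lambda>n. Ltwo_norm N (\<lambda>x. X n x - y x)) \<longlonglongrightarrow> 0"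
proof -
  have "\<exists>M. \<forall>m\<ge>M. \<forall>n\<ge>M. Ltwo_norm N (\<lambda>x. X m x - X n x) < 1 / 4 ^ k" for k :: nat
    by (rule Cauchy) simp
  then obtain M where M: "\<And>k m n. m \<ge> M k \<Longrightarrow> n \<ge> M k \<Longrightarrow> Ltwo_norm N (\<lambda>x. X m x - X n x) < 1 / 4 ^ k"
    by metis
  \<comment> \<open>The sum dominates \<open>M k\<close> at \<open>r k\<close> and at
    \<open>r (Suc k)\<close> although \<open>M\<close> may fail to be monotone; the summand
    \<open>k\<close> makes the indices unbounded.\<close>
  define r :: "nat \<Rightarrow> nat" where "r k = k + (\<Sum>i\<le>k. M i)" for k
  have r_ge: "M k \<le> r k" "M k \<le> r (Suc k)" "k \<le> r k" for k
    using member_le_sum[of k "{..k}" M] by (auto simp: r_def)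
  define Y where "Y k = X (r k)" for k
  have Y_meas [measurable]: "Y k \<in> borel_measurable N" and X_meas [measurable]: "X k \<in> borel_measurable N" for k
    using Ltwo_measurable[OF X] by (simp_all add: Y_def)
  define d where "d k x = Y (Suc k) x - Y k x" for k x
  have d_meas [measurable]: "d k \<in> borel_measurable N" for k
    unfolding d_def by measurable
  \<comment> \<open>On an infinite measure space the differences need not be integrable, so weighted
    squares are summed. Twice the product of \<open>2 ^ k * \<bar>d k x\<bar>\<close> and
    \<open>(1 / 2) ^ k\<close> bounds the difference itself by
    \<open>c k x + (1 / 4) ^ k\<close>.\<close>
  define c where "c k x = 4 ^ k * (d k x)\<^sup>2" for k x
  have c_int: "(\<integral>\<^sup>+x. ennreal (c k x) \<partial>N) \<le> ennreal ((1 / 4) ^ k)" for k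
  proof -
    have dk: "d k \<in> Ltwo N"
      unfolding d_def Y_def by (intro Ltwo_diff X)
    have "(\<integral>\<^sup>+x. ennreal (c k x) \<partial>N) = ennreal (4 ^ k) * (\<integral>\<^sup>+x. ennreal ((d k x)\<^sup>2) \<partial>N)"
      by (simp add: c_def ennreal_mult nn_integral_cmult)
    also have "\<dots> = ennreal (4 ^ k * (Ltwo_norm N (d k))\<^sup>2)"
      by (simp add: nn_integral_Ltwo[OF dk] ennreal_mult)
    also have "\<dots> \<le> ennreal (4 ^ k * (1 / 4 ^ k)\<^sup>2)"
    proof (intro ennreal_leI mult_left_mono power_mono)
      show "Ltwo_norm N (d k) \<le> 1 / 4 ^ k"
        unfolding d_def Y_def using M[of k "r (Suc k)" "r k"] r_ge[of k] by simp
    qed (auto simp: Ltwo_norm_def)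
    also have "4 ^ k * (1 / 4 ^ k)\<^sup>2 = (1 / 4 :: real) ^ k"
      by (simp add: power2_eq_square power_divide)
    finally show ?thesis .
  qed
  have "(\<integral>\<^sup>+x. (\<Sum>k. ennreal (c k x)) \<partial>N) = (\<Sum>k. \<integral>\<^sup>+x. ennreal (c k x) \<partial>N)"
    unfolding c_def by (intro nn_integral_suminf) measurable
  also have "\<dots> \<le> (\<Sum>k. ennreal ((1 / 4) ^ k))"
    by (intro suminf_le c_int) auto
  also have "\<dots> < top"
    by (subst suminf_ennreal2) (auto simp: ennreal_less_top)
  finally have "(\<integral>\<^sup>+x. (\<Sum>k. ennreal (c k x)) \<partial>N) \<noteq> \<infinity>"
    by simp
  then have "AE x in N. (\<Sum>k. ennreal (c k x)) \<noteq> \<infinity>"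
    unfolding c_def by (intro nn_integral_noteq_infinite) measurable
  then have conv: "AE x in N. convergent (\<lambda>k. Y k x)"
  proof eventually_elim
    case (elim x)
    have "summable (\<lambda>k. c k x)"
      using elim by (intro summable_suminf_not_top) (auto simp: c_def)
    then have "summable (\<lambda>k. c k x + (1 / 4) ^ k)"
      by (intro summable_add summable_geometric) auto
    moreover have "norm (d k x) \<le> c k x + (1 / 4) ^ k" for k
    proof -
      have "2 * ((2 ^ k * \<bar>d k x\<bar>) * (1 / 2) ^ k) \<le> (2 ^ k * \<bar>d k x\<bar>)\<^sup>2 + ((1 / 2) ^ k)\<^sup>2"
        using sum_squares_bound[of "2 ^ k * \<bar>d k x\<bar>" "(1 / 2) ^ k"] by (simp add: mult.assoc)
      also have "\<dots> = c k x + (1 / 4) ^ k"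
        using power_mult_distrib[of 2 "2 :: real" k]
        by (simp add: c_def power_mult_distrib power_divide power2_eq_square)
      finally show ?thesis
        by (simp add: power_divide)
    qed
    ultimately have "summable (\<lambda>k. d k x)"
      by (rule summable_comparison_test'[where N=0])
    then have "convergent (\<lambda>n. \<Sum>k<n. d k x)"
      by (simp add: summable_iff_convergent)
    then have "convergent (\<lambda>n. (\<Sum>k<n. d k x) + Y 0 x)"
      by (intro convergent_add convergent_const)
    then show ?case
      unfolding d_def sum_lessThan_telescope[of "\<lambda>k. Y k x"] by simp
  qed
  define y where "y x = lim (\<lambda>k. Y k x)" for x
  have y_meas [measurable]: "y \<in> borel_measurable N"
    unfolding y_def by measurable
  have est: "(\<integral>\<^sup>+x. ennreal ((X n x - y x)\<^sup>2) \<partial>N) \<le> ennreal (e\<^sup>2)"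
    if e: "0 < e" and K: "\<And>m n. m \<ge> K \<Longrightarrow> n \<ge> K \<Longrightarrow> Ltwo_norm N (\<lambda>x. X m x - X n x) < e" and n: "n \<ge> K"
    for e K n
  proof -
    have "(\<integral>\<^sup>+x. ennreal ((X n x - y x)\<^sup>2) \<partial>N) = (\<integral>\<^sup>+x. liminf (\<lambda>k. ennreal ((X n x - Y k x)\<^sup>2)) \<partial>N)"
    proof (rule nn_integral_cong_AE)
      show "AE x in N. ennreal ((X n x - y x)\<^sup>2) = liminf (\<lambda>k. ennreal ((X n x - Y k x)\<^sup>2))"
        using conv
      proof eventually_elim
        case (elim x)
        then have "(\<lambda>k. Y k x) \<longlonglongrightarrow> y x"
          by (simp add: y_def convergent_LIMSEQ_iff)
        then have "(\<lambda>k. ennreal ((X n x - Y k x)\<^sup>2)) \<longlonglongrightarrow> ennreal ((X n x - y x)\<^sup>2)"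
          by (intro tendsto_ennrealI tendsto_intros)
        then show ?case
          by (rule lim_imp_Liminf[OF sequentially_bot, symmetric])
      qed
    qed
    also have "\<dots> \<le> liminf (\<lambda>k. \<integral>\<^sup>+x. ennreal ((X n x - Y k x)\<^sup>2) \<partial>N)"
      by (intro nn_integral_liminf) measurable
    also have "\<dots> \<le> liminf (\<lambda>k. ennreal (e\<^sup>2))"
    proof (rule Liminf_mono)
      show "\<forall>\<^sub>F k in sequentially. (\<integral>\<^sup>+x. ennreal ((X n x - Y k x)\<^sup>2) \<partial>N) \<le> ennreal (e\<^sup>2)"
        using eventually_ge_at_top[of K]
      proof eventually_elim
        case (elim k)
        have "Ltwo_norm N (\<lambda>x. X n x - Y k x) < e"
          unfolding Y_def using K[OF n, of "r k"] r_ge(3)[of k] elim by simp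
        then have "(Ltwo_norm N (\<lambda>x. X n x - Y k x))\<^sup>2 \<le> e\<^sup>2"
          by (intro power_mono) (auto simp: Ltwo_norm_def)
        moreover have "(\<lambda>x. X n x - Y k x) \<in> Ltwo N"
          unfolding Y_def by (intro Ltwo_diff X)
        ultimately show ?case
          by (simp add: nn_integral_Ltwo ennreal_leI)
      qed
    qed
    also have "\<dots> = ennreal (e\<^sup>2)"
      by (simp add: Liminf_const)
    finally show ?thesis .
  qed
  obtain K1 where K1: "\<And>m n. m \<ge> K1 \<Longrightarrow> n \<ge> K1 \<Longrightarrow> Ltwo_norm N (\<lambda>x. X m x - X n x) < 1"
    using Cauchy[OF zero_less_one] by blast
  have "(\<lambda>x. X K1 x - y x) \<in> Ltwo N"
    by (rule Ltwo_normI(1)[OF _ est[OF zero_less_one K1 order_refl]]) auto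
  from Ltwo_diff[OF X[of K1] this] have y: "y \<in> Ltwo N"
    by simp
  have "(\<lambda>n. Ltwo_norm N (\<lambda>x. X n x - y x)) \<longlonglongrightarrow> 0"
  proof (rule LIMSEQ_I)
    fix e :: real assume "0 < e"
    then obtain K where K: "\<And>m n. m \<ge> K \<Longrightarrow> n \<ge> K \<Longrightarrow> Ltwo_norm N (\<lambda>x. X m x - X n x) < e / 2"
      using Cauchy[of "e / 2"] by auto
    have "Ltwo_norm N (\<lambda>x. X n x - y x) \<le> e / 2" if "n \<ge> K" for n
      using \<open>0 < e\<close> by (intro Ltwo_normI(2)[OF _ est[OF _ K that]]) auto
    then show "\<exists>no. \<forall>n\<ge>no. norm (Ltwo_norm N (\<lambda>x. X n x - y x) - 0) < e"
      using \<open>0 < e\<close> by (intro exI[of _ K]) (force simp: Ltwo_norm_def)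
  qed
  then show ?thesis
    using y by blast
qed

context Ltwo_projection
begin

sublocale semi_hilbert pip
proof
  fix X :: "nat \<Rightarrow> 'a \<Rightarrow> real"
  assume "\<And>e. 0 < e \<Longrightarrow> \<exists>M. \<forall>m\<ge>M. \<forall>n\<ge>M. nrm (X m - X n) < e"
  then have "\<exists>y\<in>Ltwo N. (\<lambda>n. Ltwo_norm N (\<lambda>x. P (X n) x - y x)) \<longlonglongrightarrow> 0"
    unfolding nrm_diff_eq by (rule Ltwo_complete[OF P_Ltwo])
  then obtain y where "y \<in> Ltwo N" "(\<lambda>n. Ltwo_norm N (\<lambda>x. P (X n) x - y x)) \<longlonglongrightarrow> 0"
    by blast
  then show "\<exists>y. (\<lambda>n. nrm (X n - y)) \<longlonglongrightarrow> 0"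
    by (intro exI[of _ y]) (simp add: nrm_diff_eq P_id)
qed

end

text \<open>
  Subtracting the minimum, which is attained at \<open>0\<close>, makes the functional nonnegative and real-valued
  on its effective domain.
\<close>

locale Ltwo_functional = Ltwo_projection N P for N :: "'a measure" and P +
  fixes F :: "('a \<Rightarrow> real) \<Rightarrow> ereal"
  assumes F_lsc: "lsc_Ltwo N F" and F_convex: "convex_Ltwo N F"
    and F_0: "\<bar>F (\<lambda>x. 0)\<bar> \<noteq> \<infinity>" and F_min: "u \<in> Ltwo N \<Longrightarrow> F (\<lambda>x. 0) \<le> F u"
begin

text \<open>Like the inner product, the functional is extended to all functions along
  \<open>P\<close>; statements are carried back to \<open>L^2\<close> by applying
  \<open>P\<close>.\<close>

definition dom :: "('a \<Rightarrow> real) set" where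
  "dom = {u. F (P u) < \<infinity>}"

definition val :: "('a \<Rightarrow> real) \<Rightarrow> real" where
  "val u = real_of_ereal (F (P u)) - real_of_ereal (F (\<lambda>x. 0))"

lemma P_0: "P (\<lambda>x. 0) = (\<lambda>x. 0)"
  by (rule P_id) (rule Ltwo_zero)

lemma F_eq_val:
  assumes "u \<in> dom"
  shows "F (P u) = ereal (val u + real_of_ereal (F (\<lambda>x. 0)))"
proof -
  have "F (P u) \<noteq> \<infinity>" "F (\<lambda>x. 0) \<le> F (P u)"
    using assms F_min[OF P_Ltwo] by (auto simp: dom_def)
  then have "\<bar>F (P u)\<bar> \<noteq> \<infinity>"
    using F_0 by (metis abs_ereal.simps(2) abs_ereal.simps(3) ereal_infinity_cases ereal_infty_less_eq(2))
  then show ?thesis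
    by (simp add: val_def ereal_real)
qed

text \<open>One extended-real inequality encodes membership and bound together, so both pass to
  convex combinations and limits at once.\<close>

lemma dom_le_iff: "u \<in> dom \<and> val u \<le> C \<longleftrightarrow> F (P u) \<le> ereal (C + real_of_ereal (F (\<lambda>x. 0)))"
proof (cases "u \<in> dom")
  case True
  then show ?thesis by (simp add: F_eq_val)
next
  case False
  then show ?thesis by (auto simp: dom_def)
qed

sublocale convex_functional pip dom val
proof
  show "dom \<noteq> {}"
  proof -
    have "(\<lambda>x. 0) \<in> dom"
      using F_0 by (auto simp: dom_def P_0)
    then show ?thesis
      by blast
  qed
  show "0 \<le> val u" if "u \<in> dom" for u
    using F_min[OF P_Ltwo, of u] F_0 unfolding F_eq_val[OF that]
    by (cases "F (\<lambda>x. 0)") auto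
  have conv: "(1 - c) *\<^sub>R u + c *\<^sub>R v \<in> dom \<and> val ((1 - c) *\<^sub>R u + c *\<^sub>R v) \<le> (1 - c) * val u + c * val v"
    if "u \<in> dom" "v \<in> dom" "0 \<le> c" "c \<le> 1" for u v c
  proof -
    have "F (P ((1 - c) *\<^sub>R u + c *\<^sub>R v)) \<le> ereal (1 - c) * F (P u) + ereal c * F (P v)"
      using F_convex that(3,4) P_Ltwo unfolding convex_Ltwo_def P_add P_scale by simp
    also have "\<dots> = ereal ((1 - c) * val u + c * val v + real_of_ereal (F (\<lambda>x. 0)))"
      by (simp add: F_eq_val that algebra_simps)
    finally show ?thesis
      by (simp add: dom_le_iff)
  qed
  show "(1 - c) *\<^sub>R u + c *\<^sub>R v \<in> dom" if "u \<in> dom" "v \<in> dom" "0 \<le> c" "c \<le> 1" for u v c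
    using conv[OF that] by simp
  show "val ((1 - c) *\<^sub>R u + c *\<^sub>R v) \<le> (1 - c) * val u + c * val v"
    if "u \<in> dom" "v \<in> dom" "0 \<le> c" "c \<le> 1" for u v c
    using conv[OF that] by simp
  show "u \<in> dom \<and> val u \<le> C"
    if X: "\<And>n. X n \<in> dom" "\<And>n. val (X n) \<le> C" and lim: "(\<lambda>n. nrm (X n - u)) \<longlonglongrightarrow> 0"
    for X :: "nat \<Rightarrow> 'a \<Rightarrow> real" and u C
  proof -
    have "F (P u) \<le> liminf (\<lambda>n. F (P (X n)))"
      using F_lsc lim P_Ltwo unfolding lsc_Ltwo_def nrm_diff_eq by simp
    also have "\<dots> \<le> liminf (\<lambda>n::nat. ereal (C + real_of_ereal (F (\<lambda>x. 0))))"
    proof (rule Liminf_mono, rule always_eventually, rule allI)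
      show "F (P (X n)) \<le> ereal (C + real_of_ereal (F (\<lambda>x. 0)))" for n
        using X[of n] dom_le_iff[of "X n" C] by blast
    qed
    finally show ?thesis
      by (simp add: dom_le_iff Liminf_const)
  qed
qed

lemma subd_subgradient:
  assumes "subd u g"
  shows "(P u, P g) \<in> subgradient N F"
proof -
  have u: "u \<in> dom"
    using assms by (simp add: subd_def)
  have "ereal (Ltwo_inner N (P g) (\<lambda>x. v x - P u x)) \<le> F v - F (P u)" if v: "v \<in> Ltwo N" for v
  proof (cases "F v = \<infinity>")
    case True
    then show ?thesis
      by (simp add: F_eq_val[OF u])
  next
    case False
    then have "v \<in> dom"
      by (simp add: dom_def P_id[OF v])
    then have "val u + pip g (v - u) \<le> val v"
      using assms by (simp add: subd_def)
    moreover have "pip g (v - u) = Ltwo_inner N (P g) (\<lambda>x. v x - P u x)"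
      by (simp add: pip_def P_diff P_id[OF v])
    moreover have "F v = ereal (val v + real_of_ereal (F (\<lambda>x. 0)))"
      using F_eq_val[OF \<open>v \<in> dom\<close>] by (simp add: P_id[OF v])
    ultimately show ?thesis
      by (simp add: F_eq_val[OF u])
  qed
  then show ?thesis
    using u by (simp add: subgradient_def P_Ltwo dom_def)
qed

lemma resolvent:
  assumes u: "u \<in> Ltwo N" and h: "0 < h"
  shows "\<exists>z. (z, \<lambda>x. (u x - z x) / h) \<in> subgradient N F"
proof -
  obtain z where z: "subd z ((1 / h) *\<^sub>R (u - z))"
    using prox_exists[OF h] by blast
  have "P ((1 / h) *\<^sub>R (u - z)) = (\<lambda>x. (u x - P z x) / h)"
    by (simp add: P_scale P_diff P_id[OF u] fun_eq_iff)
  then show ?thesis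
    using subd_subgradient[OF z] by auto
qed

lemma semigroup_exists:
  assumes dense: "dense_in_Ltwo N (effective_domain N F)"
  shows "\<exists>S. generated_semigroup N F S"
proof -
  have "\<exists>u. gradient_flow N F u0 u" if u0: "u0 \<in> Ltwo N" for u0
  proof -
    have d: "\<exists>y\<in>dom. nrm (y - u0) < e" if "0 < e" for e
    proof -
      obtain v where "v \<in> effective_domain N F" and v: "v \<in> Ltwo N" "Ltwo_norm N (\<lambda>x. u0 x - v x) < e"
        using dense u0 \<open>0 < e\<close> unfolding dense_in_Ltwo_def by blast
      then have "v \<in> dom"
        by (simp add: effective_domain_def dom_def P_id)
      moreover have "nrm (u0 - v) < e"
        using v u0 by (simp add: nrm_diff_eq P_id)
      ultimately show ?thesis
        using nrm_minus_commute[of u0 v] by (intro bexI[of _ v]) auto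
    qed
    obtain u where u: "u 0 = u0"
      "\<And>t. 0 \<le> t \<Longrightarrow> ((\<lambda>s. nrm (u s - u t)) \<longlongrightarrow> 0) (at t within {0..})"
      "\<And>a b. 0 < a \<Longrightarrow> a \<le> b
        \<Longrightarrow> \<exists>L. \<forall>s\<in>{a..b}. \<forall>t\<in>{a..b}. nrm (u s - u t) \<le> L * \<bar>s - t\<bar>"
      "AE t in lborel. 0 < t \<longrightarrow>
        (\<exists>p. subd (u t) p \<and> ((\<lambda>h. nrm ((1 / h) *\<^sub>R (u (t + h) - u t) + p)) \<longlongrightarrow> 0) (at 0))"
      by (rule gradient_flow_exists[OF d], assumption) (rule that)
    \<comment> \<open>The curve moves in the space of all functions; its projection lies in
      \<open>L^2\<close> and has the same mutual distances.\<close>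
    have "gradient_flow N F u0 (\<lambda>t. P (u t))"
      unfolding gradient_flow_def
    proof (intro conjI)
      show "\<forall>t\<ge>0. P (u t) \<in> Ltwo N"
        by (simp add: P_Ltwo)
      show "AE x in N. P (u 0) x = u0 x"
        by (simp add: u(1) P_id[OF u0])
      show "\<forall>t\<ge>0. ((\<lambda>s. Ltwo_norm N (\<lambda>x. P (u s) x - P (u t) x)) \<longlongrightarrow> 0) (at t within {0..})"
        using u(2) unfolding nrm_diff_eq by blast
      show "\<forall>a b. 0 < a \<longrightarrow> a \<le> b \<longrightarrow> (\<exists>L. \<forall>s\<in>{a..b}. \<forall>t\<in>{a..b}.
          Ltwo_norm N (\<lambda>x. P (u s) x - P (u t) x) \<le> L * \<bar>s - t\<bar>)"
        using u(3) unfolding nrm_diff_eq by blast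
      show "AE t in lborel. 0 < t \<longrightarrow> (\<exists>g. (P (u t), g) \<in> subgradient N F \<and>
          ((\<lambda>h. Ltwo_norm N (\<lambda>x. (P (u (t + h)) x - P (u t) x) / h - (- g x))) \<longlongrightarrow> 0) (at 0))"
        using u(4)
      proof eventually_elim
        case (elim t)
        show ?case
        proof
          assume "0 < t"
          with elim obtain p where p: "subd (u t) p"
              "((\<lambda>h. nrm ((1 / h) *\<^sub>R (u (t + h) - u t) + p)) \<longlongrightarrow> 0) (at 0)"
            by blast
          have "nrm ((1 / h) *\<^sub>R (u (t + h) - u t) + p)
              = Ltwo_norm N (\<lambda>x. (P (u (t + h)) x - P (u t) x) / h - (- P p x))" for h
            by (simp add: nrm_eq P_add P_scale P_diff)
          then show "\<exists>g. (P (u t), g) \<in> subgradient N F \<and>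
              ((\<lambda>h. Ltwo_norm N (\<lambda>x. (P (u (t + h)) x - P (u t) x) / h - (- g x))) \<longlongrightarrow> 0) (at 0)"
            using p subd_subgradient by auto
        qed
      qed
    qed
    then show ?thesis
      by blast
  qed
  then obtain U where U: "\<And>u0. u0 \<in> Ltwo N \<Longrightarrow> gradient_flow N F u0 (U u0)"
    by metis
  then show ?thesis
    unfolding generated_semigroup_def by (intro exI[of _ "\<lambda>t u0. U u0 t"]) auto
qed

end

section \<open>Comparison of gradient flows\<close>

text \<open>The point is the maximum of a compact sublevel set. It must be the last such time:
  exceeding \<open>c\<close> ever after is incompatible with a negative derivative there.\<close>

lemma last_time_of_value:
  fixes k :: "real \<Rightarrow> real"
  assumes cont: "continuous_on {a..b} k" and c: "k a < c" "c < k b" and ab: "a \<le> b"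
  obtains x where "a < x" "x < b" "k x = c" "\<And>t. x < t \<Longrightarrow> t \<le> b \<Longrightarrow> c < k t"
proof -
  define S where "S = {t\<in>{a..b}. k t \<le> c}"
  have "closed S"
    unfolding S_def using cont by (intro continuous_on_closed_Collect_le) auto
  then have "compact ({a..b} \<inter> S)"
    by (intro compact_Int_closed compact_Icc)
  moreover have "{a..b} \<inter> S = S"
    by (auto simp: S_def)
  moreover have "a \<in> S"
    using c ab by (simp add: S_def)
  ultimately obtain x where x: "x \<in> S" "\<And>t. t \<in> S \<Longrightarrow> t \<le> x"
    using compact_attains_sup[of S] by auto
  have gt: "c < k t" if "x < t" "t \<le> b" for t
  proof (rule ccontr)
    assume "\<not> c < k t"
    then have "t \<in> S"
      using x(1) that by (simp add: S_def)
    then show False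
      using x(2) that by force
  qed
  have "x \<noteq> b"
    using x(1) c by (auto simp: S_def)
  then have xb: "a \<le> x" "x < b"
    using x(1) by (auto simp: S_def)
  have "c \<le> k x"
  proof (rule tendsto_lowerbound)
    have "(k \<longlongrightarrow> k x) (at x within {a..b})"
      using cont xb by (simp add: continuous_on)
    then show "(k \<longlongrightarrow> k x) (at x within {x..b})"
      by (rule tendsto_within_subset) (use xb in auto)
    show "\<forall>\<^sub>F t in at x within {x..b}. c \<le> k t"
      by (auto simp: eventually_at_filter intro!: always_eventually less_imp_le gt)
    show "at x within {x..b} \<noteq> bot"
      using xb by (simp add: trivial_limit_within islimpt_Icc)
  qed
  then have "k x = c"
    using x(1) by (simp add: S_def)
  then show thesis
    using that[of x] gt xb c by force
qed

text \<open>
  If \<open>g b > g a\<close>, then after subtracting a small linear function every value in some interval is attained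
  for the last time at a point of the exceptional null set, whose Lipschitz image is negligible.
\<close>

lemma lipschitz_nonincreasing:
  fixes g :: "real \<Rightarrow> real"
  assumes ab: "a \<le> b"
    and lip: "\<And>s t. s \<in> {a..b} \<Longrightarrow> t \<in> {a..b} \<Longrightarrow> \<bar>g s - g t\<bar> \<le> L * \<bar>s - t\<bar>"
    and deriv: "AE t in lborel. a < t \<longrightarrow> t < b \<longrightarrow> (\<exists>d\<le>0. (g has_real_derivative d) (at t))"
  shows "g b \<le> g a"
proof (rule ccontr)
  assume "\<not> g b \<le> g a"
  then have gab: "g a < g b" and ab': "a < b"
    using ab by (auto simp: order_le_less)
  \<comment> \<open>Half the mean slope: small enough that \<open>k a < k b\<close> persists, while
    its subtraction turns a derivative \<open>d \<le> 0\<close> of \<open>g\<close> into a negative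
    one of \<open>k\<close>.\<close>
  define e where "e = (g b - g a) / 2 / (b - a)"
  have eb: "(g b - g a) / 2 = e * (b - a)"
    using ab' by (intro nonzero_divide_eq_eq[THEN iffD1]) (simp_all add: e_def)
  have e: "0 < e" "e * (b - a) < g b - g a"
    unfolding eb[symmetric] using gab ab' by (simp_all add: e_def)
  define k where "k t = g t - e * (t - a)" for t
  have klip: "\<bar>k s - k t\<bar> \<le> (L + e) * \<bar>s - t\<bar>" if "s \<in> {a..b}" "t \<in> {a..b}" for s t
  proof -
    have "k s - k t = (g s - g t) - e * (s - t)"
      by (simp add: k_def algebra_simps)
    then have "\<bar>k s - k t\<bar> \<le> \<bar>g s - g t\<bar> + e * \<bar>s - t\<bar>"
      using abs_triangle_ineq4[of "g s - g t" "e * (s - t)"] e(1) by (simp add: abs_mult)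
    then show ?thesis
      using lip[OF that] by (simp add: distrib_right)
  qed
  have kab: "k a < k b"
    using e(2) by (simp add: k_def)
  have kcont: "continuous_on {a..b} k"
  proof (rule continuous_onI)
    fix x \<epsilon> :: real assume "x \<in> {a..b}" "0 < \<epsilon>"
    moreover have "0 < \<bar>L + e\<bar> + 1"
      by simp
    moreover have "\<bar>k s - k x\<bar> \<le> \<epsilon>" if "s \<in> {a..b}" "\<bar>s - x\<bar> < \<epsilon> / (\<bar>L + e\<bar> + 1)" for s
    proof -
      have "\<bar>k s - k x\<bar> \<le> (\<bar>L + e\<bar> + 1) * \<bar>s - x\<bar>"
        using klip[OF that(1) \<open>x \<in> {a..b}\<close>] mult_right_mono[of "L + e" "\<bar>L + e\<bar> + 1" "\<bar>s - x\<bar>"] by linarith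
      also have "\<dots> \<le> \<epsilon>"
        using that(2) by (simp add: pos_less_divide_eq mult.commute)
      finally show ?thesis .
    qed
    ultimately show "\<exists>d>0. \<forall>s\<in>{a..b}. dist s x < d \<longrightarrow> dist (k s) (k x) \<le> \<epsilon>"
      by (intro exI[of _ "\<epsilon> / (\<bar>L + e\<bar> + 1)"]) (auto simp: dist_real_def)
  qed
  define Z where "Z = {t\<in>{a<..<b}. \<not> (\<exists>d\<le>0. (g has_real_derivative d) (at t))}"
  obtain Z' where Z': "Z' \<in> null_sets lborel" "Z \<subseteq> Z'"
    using deriv by (auto simp: eventually_ae_filter Z_def subset_iff)
  have "negligible Z'"
    using Z'(1) by (simp add: negligible_iff_null_sets null_sets_completionI)
  then have "negligible Z"
    using Z'(2) by (rule negligible_subset)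
  then have "negligible (k ` Z)"
  proof (rule negligible_locally_Lipschitz_image[rotated])
    fix x assume x: "x \<in> Z"
    have "norm (k y - k x) \<le> (L + e) * norm (y - x)" if "y \<in> Z" for y
      using klip[of y x] x that by (simp add: Z_def)
    then show "\<exists>T B. open T \<and> x \<in> T \<and> (\<forall>y\<in>Z \<inter> T. norm (k y - k x) \<le> B * norm (y - x))"
      by (intro exI[of _ UNIV] exI[of _ "L + e"]) auto
  qed simp
  moreover have "{k a<..<k b} \<subseteq> k ` Z"
  proof
    fix c assume "c \<in> {k a<..<k b}"
    then obtain x where x: "a < x" "x < b" "k x = c" "\<And>t. x < t \<Longrightarrow> t \<le> b \<Longrightarrow> c < k t"
      using last_time_of_value[OF kcont, of c] ab by auto
    have "x \<in> Z"
    proof (rule ccontr)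
      assume "x \<notin> Z"
      then obtain d where d: "d \<le> 0" "(g has_real_derivative d) (at x)"
        using x by (auto simp: Z_def)
      have "(k has_real_derivative (d - e)) (at x)"
        unfolding k_def by (auto intro!: derivative_eq_intros d(2))
      then obtain r where r: "0 < r" "\<And>h. 0 < h \<Longrightarrow> h < r \<Longrightarrow> k (x + h) < k x"
        using DERIV_neg_dec_right[of k "d - e" x] d(1) e(1) by auto
      define h where "h = min (r / 2) (b - x)"
      have "0 < h" "h < r" "x + h \<le> b"
        using r x by (auto simp: h_def)
      then show False
        using r(2)[of h] x(3) x(4)[of "x + h"] by simp
    qed
    then show "c \<in> k ` Z"
      using x(3) by blast
  qed
  ultimately have "negligible {k a<..<k b}"
    by (rule negligible_subset)
  then show False
    using open_not_negligible[of "{k a<..<k b}"] kab by auto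
qed

section \<open>The truncated distance of two flows\<close>

text \<open>The function \<open>(max 0 a)^2\<close> has the derivative \<open>2 * max 0 a\<close>,
  which is Lipschitz with constant 2; hence the remainder is at most \<open>z^2\<close>. If the sign
  changes between \<open>a\<close> and \<open>a + z\<close>, then
  \<open>\<bar>a + z\<bar> \<le> \<bar>z\<bar>\<close>.\<close>

lemma pos_part_sq_expansion:
  fixes s z k :: real
  shows "\<bar>(max 0 (s + z - k))\<^sup>2 - (max 0 (s - k))\<^sup>2 - 2 * (max 0 (s - k) * z)\<bar> \<le> z\<^sup>2"
proof -
  define a where "a = s - k"
  have sq: "(a + z)\<^sup>2 = a\<^sup>2 + 2 * (a * z) + z\<^sup>2"
    by (simp add: power2_sum)
  have "\<bar>(max 0 (a + z))\<^sup>2 - (max 0 a)\<^sup>2 - 2 * (max 0 a * z)\<bar> \<le> z\<^sup>2"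
  proof (cases "0 \<le> a"; cases "0 \<le> a + z")
    assume *: "0 \<le> a" "\<not> 0 \<le> a + z"
    then have "(a + z)\<^sup>2 \<le> z\<^sup>2"
      by (simp add: abs_le_square_iff[symmetric])
    moreover have "max 0 a = a" "max 0 (a + z) = 0"
      using * by auto
    moreover have "0 \<le> (a + z)\<^sup>2" "0 \<le> z\<^sup>2"
      by simp_all
    ultimately show ?thesis
      using sq by simp
  next
    assume *: "\<not> 0 \<le> a" "0 \<le> a + z"
    then have "(a + z)\<^sup>2 \<le> z\<^sup>2"
      by (simp add: abs_le_square_iff[symmetric])
    then show ?thesis
      using * by simp
  qed (simp_all add: sq)
  then show ?thesis
    by (simp add: a_def algebra_simps)
qed

lemma Ltwo_pos_part:
  assumes "w \<in> Ltwo N" "0 \<le> k"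
  shows "(\<lambda>x. max 0 (w x - k)) \<in> Ltwo N"
  using assms(1)
proof (rule Ltwo_bound)
  show "(\<lambda>x. max 0 (w x - k)) \<in> borel_measurable N"
    using Ltwo_measurable[OF assms(1)] by measurable
qed (use assms(2) in auto)

text \<open>The quadratic remainder allows differentiation in time from convergence in norm alone,
  without pointwise convergence of quotients.\<close>

lemma Ltwo_pos_part_expansion:
  assumes "w \<in> Ltwo N" "z \<in> Ltwo N" "0 \<le> k"
  shows "\<bar>(Ltwo_norm N (\<lambda>x. max 0 (w x + z x - k)))\<^sup>2 - (Ltwo_norm N (\<lambda>x. max 0 (w x - k)))\<^sup>2
    - 2 * Ltwo_inner N (\<lambda>x. max 0 (w x - k)) z\<bar> \<le> (Ltwo_norm N z)\<^sup>2"
proof -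
  have wz: "(\<lambda>x. max 0 (w x + z x - k)) \<in> Ltwo N" and w: "(\<lambda>x. max 0 (w x - k)) \<in> Ltwo N"
    using assms by (auto intro!: Ltwo_pos_part Ltwo_add)
  have int: "integrable N (\<lambda>x. (max 0 (w x + z x - k))\<^sup>2)" "integrable N (\<lambda>x. (max 0 (w x - k))\<^sup>2)"
      "integrable N (\<lambda>x. (z x)\<^sup>2)" "integrable N (\<lambda>x. max 0 (w x - k) * z x)"
    using wz w assms Ltwo_integrable_mult[OF w assms(2)] by (auto simp: Ltwo_def)
  define g where "g x = (max 0 (w x + z x - k))\<^sup>2 - (max 0 (w x - k))\<^sup>2 - 2 * (max 0 (w x - k) * z x)" for x
  have g: "integrable N g"
    unfolding g_def using int by simp
  have "\<bar>LINT x|N. g x\<bar> \<le> (LINT x|N. \<bar>g x\<bar>)"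
    by (rule integral_abs_bound)
  also have "\<dots> \<le> (LINT x|N. (z x)\<^sup>2)"
  proof (rule integral_mono[OF integrable_abs[OF g] int(3)])
    show "\<bar>g x\<bar> \<le> (z x)\<^sup>2" for x
      unfolding g_def by (rule pos_part_sq_expansion)
  qed
  finally show ?thesis
    unfolding g_def using int by (simp add: Ltwo_norm_power2 Ltwo_inner_def)
qed

context Ltwo_projection
begin

lemma Ltwo_norm_diff: "u \<in> Ltwo N \<Longrightarrow> v \<in> Ltwo N \<Longrightarrow> Ltwo_norm N (\<lambda>x. u x - v x) = nrm (u - v)"
  by (simp add: nrm_diff_eq P_id)

lemma nrm_Ltwo: "u \<in> Ltwo N \<Longrightarrow> nrm u = Ltwo_norm N u"
  by (simp add: nrm_eq P_id)

lemma Ltwo_diff_mem: "u \<in> Ltwo N \<Longrightarrow> v \<in> Ltwo N \<Longrightarrow> u - v \<in> Ltwo N"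
  by (rule subspace_diff[OF Ltwo_subspace])

lemma Ltwo_scaleR_mem: "u \<in> Ltwo N \<Longrightarrow> r *\<^sub>R u \<in> Ltwo N"
  by (rule subspace_scale[OF Ltwo_subspace])

lemma nrm_pos_part_lipschitz:
  assumes "u \<in> Ltwo N" "v \<in> Ltwo N" "0 \<le> k"
  shows "\<bar>nrm (\<lambda>x. max 0 (u x - k)) - nrm (\<lambda>x. max 0 (v x - k))\<bar> \<le> nrm (u - v)"
proof -
  let ?a = "\<lambda>x. max 0 (u x - k)" and ?b = "\<lambda>x. max 0 (v x - k)"
  have ab: "?a \<in> Ltwo N" "?b \<in> Ltwo N"
    using assms by (auto intro: Ltwo_pos_part)
  have "(nrm (?a - ?b))\<^sup>2 \<le> (nrm (u - v))\<^sup>2"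
    unfolding Ltwo_norm_diff[OF ab, symmetric] Ltwo_norm_diff[OF assms(1,2), symmetric] Ltwo_norm_power2
  proof (rule integral_mono)
    show "integrable N (\<lambda>x. (max 0 (u x - k) - max 0 (v x - k))\<^sup>2)" "integrable N (\<lambda>x. (u x - v x)\<^sup>2)"
      using Ltwo_diff[OF ab] Ltwo_diff[OF assms(1,2)] by (simp_all add: Ltwo_def)
    show "(max 0 (u x - k) - max 0 (v x - k))\<^sup>2 \<le> (u x - v x)\<^sup>2" for x
      by (subst abs_le_square_iff[symmetric]) (simp add: max_def)
  qed
  then have "nrm (?a - ?b) \<le> nrm (u - v)"
    by (rule power2_le_imp_le) simp
  then show ?thesis
    using abs_nrm_diff_le[of ?a ?b] by simp
qed

text \<open>With \<open>z\<close> equal to \<open>h\<close> times the difference quotient, the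
  remainder of the expansion is of order \<open>h^2\<close>, since convergent quotients stay bounded
  in norm.\<close>

lemma has_derivative_nrm_pos_part:
  assumes w: "\<And>s. 0 \<le> s \<Longrightarrow> w s \<in> Ltwo N" and t: "0 < t" and g: "g \<in> Ltwo N" and k: "0 \<le> k"
    and deriv: "((\<lambda>h. nrm ((1 / h) *\<^sub>R (w (t + h) - w t) - g)) \<longlongrightarrow> 0) (at 0)"
  shows "((\<lambda>s. (nrm (\<lambda>x. max 0 (w s x - k)))\<^sup>2) has_real_derivative 2 * pip g (\<lambda>x. max 0 (w t x - k))) (at t)"
proof -
  define E where "E s = (\<lambda>x. max 0 (w s x - k))" for s
  define \<omega> where "\<omega> h = (1 / h) *\<^sub>R (w (t + h) - w t)" for h
  have E: "E s \<in> Ltwo N" if "0 \<le> s" for s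
    unfolding E_def using w[OF that] k by (rule Ltwo_pos_part)
  have main: "\<bar>((nrm (E (t + h)))\<^sup>2 - (nrm (E t))\<^sup>2) / h - 2 * pip (\<omega> h) (E t)\<bar> \<le> \<bar>h\<bar> * (nrm (\<omega> h))\<^sup>2"
    if h: "h \<noteq> 0" "- t < h" for h
  proof -
    have wm: "w t \<in> Ltwo N" "w (t + h) \<in> Ltwo N"
      using w t h by auto
    then have \<omega>: "\<omega> h \<in> Ltwo N"
      unfolding \<omega>_def by (intro Ltwo_scaleR_mem Ltwo_diff_mem)
    define z where "z = h *\<^sub>R \<omega> h"
    have z: "z \<in> Ltwo N"
      unfolding z_def by (rule Ltwo_scaleR_mem[OF \<omega>])
    have eq: "w (t + h) x = w t x + z x" for x
      using h by (simp add: z_def \<omega>_def)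
    have "E (t + h) = (\<lambda>x. max 0 (w t x + z x - k))"
      by (simp add: E_def eq)
    moreover have "Ltwo_inner N (E t) z = pip z (E t)"
      using z E t by (simp add: pip_def P_id Ltwo_inner_def mult.commute)
    moreover have "Ltwo_norm N z = nrm z" "Ltwo_norm N (E t) = nrm (E t)" "Ltwo_norm N (E (t + h)) = nrm (E (t + h))"
      using z E t h by (auto simp: nrm_Ltwo)
    ultimately have "\<bar>(nrm (E (t + h)))\<^sup>2 - (nrm (E t))\<^sup>2 - 2 * pip z (E t)\<bar> \<le> (nrm z)\<^sup>2"
      using Ltwo_pos_part_expansion[OF wm(1) z k] by (simp add: E_def)
    moreover have "(nrm z)\<^sup>2 = \<bar>h\<bar> * (\<bar>h\<bar> * (nrm (\<omega> h))\<^sup>2)"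
      unfolding z_def nrm_scaleR by (simp add: power2_eq_square)
    moreover have "(nrm (E (t + h)))\<^sup>2 - (nrm (E t))\<^sup>2 - 2 * pip z (E t)
        = h * (((nrm (E (t + h)))\<^sup>2 - (nrm (E t))\<^sup>2) / h - 2 * pip (\<omega> h) (E t))"
    proof -
      have "h * (A / h - B) = A - h * B" for A B
        using h by (simp add: field_simps)
      then show ?thesis
        by (simp add: z_def ip_scaleR_left)
    qed
    ultimately have "\<bar>h\<bar> * \<bar>((nrm (E (t + h)))\<^sup>2 - (nrm (E t))\<^sup>2) / h - 2 * pip (\<omega> h) (E t)\<bar>
        \<le> \<bar>h\<bar> * (\<bar>h\<bar> * (nrm (\<omega> h))\<^sup>2)"
      by (metis abs_mult)
    then show ?thesis
      using h by (simp add: mult_le_cancel_left_pos)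
  qed
  have "((\<lambda>h. ((nrm (E (t + h)))\<^sup>2 - (nrm (E t))\<^sup>2) / h - 2 * pip (\<omega> h) (E t)) \<longlongrightarrow> 0) (at 0)"
  proof (rule Lim_null_comparison)
    have "\<forall>\<^sub>F h in at 0. - t < h"
      using t by (intro order_tendstoD(1)[OF tendsto_ident_at]) simp
    moreover have "\<forall>\<^sub>F h in at 0. (h::real) \<noteq> 0"
      by (simp add: eventually_at_filter)
    ultimately show "\<forall>\<^sub>F h in at 0. norm (((nrm (E (t + h)))\<^sup>2 - (nrm (E t))\<^sup>2) / h - 2 * pip (\<omega> h) (E t))
        \<le> \<bar>h\<bar> * (nrm (\<omega> h))\<^sup>2"
      by eventually_elim (use main in simp)
    have "((\<lambda>h. \<bar>h\<bar> * (nrm (\<omega> h))\<^sup>2) \<longlongrightarrow> \<bar>0\<bar> * (nrm g)\<^sup>2) (at 0)"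
      using deriv by (intro tendsto_intros tendsto_nrm) (simp add: \<omega>_def)
    then show "((\<lambda>h. \<bar>h\<bar> * (nrm (\<omega> h))\<^sup>2) \<longlongrightarrow> 0) (at 0)"
      by simp
  qed
  moreover have "((\<lambda>h. 2 * pip (\<omega> h) (E t)) \<longlongrightarrow> 2 * pip g (E t)) (at 0)"
    using deriv by (intro tendsto_intros tendsto_ip) (simp add: \<omega>_def)
  ultimately have "((\<lambda>h. ((nrm (E (t + h)))\<^sup>2 - (nrm (E t))\<^sup>2) / h) \<longlongrightarrow> 2 * pip g (E t)) (at 0)"
    using tendsto_add by fastforce
  then show ?thesis
    unfolding DERIV_def E_def .
qed

lemma gradient_flow_comparison:
  assumes u: "gradient_flow N F u0 u" and v: "gradient_flow N F v0 v"
    and mono: "\<And>a f b g. (a, f) \<in> subgradient N F \<Longrightarrow> (b, g) \<in> subgradient N F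
      \<Longrightarrow> 0 \<le> Ltwo_inner N (\<lambda>x. f x - g x) (\<lambda>x. max 0 (a x - b x - k))"
    and k: "0 \<le> k" and init: "AE x in N. u0 x \<le> v0 x + k" and t: "0 \<le> t"
  shows "AE x in N. u t x \<le> v t x + k"
proof -
  have um: "u s \<in> Ltwo N" and vm: "v s \<in> Ltwo N" if "0 \<le> s" for s
    using u v that by (auto simp: gradient_flow_def)
  define w where "w s = u s - v s" for s
  have wm: "w s \<in> Ltwo N" if "0 \<le> s" for s
    unfolding w_def using um[OF that] vm[OF that] by (rule Ltwo_diff_mem)
  define E where "E s = (\<lambda>x. max 0 (w s x - k))" for s
  have E: "E s \<in> Ltwo N" if "0 \<le> s" for s
    unfolding E_def using wm[OF that] k by (rule Ltwo_pos_part)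
  have w_dist: "nrm (w r - w s) \<le> Ltwo_norm N (\<lambda>x. u r x - u s x) + Ltwo_norm N (\<lambda>x. v r x - v s x)"
    if "0 \<le> r" "0 \<le> s" for r s
  proof -
    have "w r - w s = (u r - u s) + (v s - v r)"
      by (simp add: w_def algebra_simps)
    then show ?thesis
      using nrm_triangle[of "u r - u s" "v s - v r"] nrm_minus_commute[of "v s" "v r"]
      by (simp add: Ltwo_norm_diff um vm that)
  qed
  have E_dist: "\<bar>nrm (E r) - nrm (E s)\<bar> \<le> nrm (w r - w s)" if "0 \<le> r" "0 \<le> s" for r s
    unfolding E_def by (rule nrm_pos_part_lipschitz[OF wm[OF that(1)] wm[OF that(2)] k])
  define q where "q s = (nrm (E s))\<^sup>2" for s
  have deriv: "AE s in lborel. 0 < s \<longrightarrow> (\<exists>d\<le>0. (q has_real_derivative d) (at s))"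
  proof -
    have "AE s in lborel. 0 < s \<longrightarrow> (\<exists>f. (u s, f) \<in> subgradient N F \<and>
        ((\<lambda>h. Ltwo_norm N (\<lambda>x. (u (s + h) x - u s x) / h - (- f x))) \<longlongrightarrow> 0) (at 0))"
      using u by (simp add: gradient_flow_def)
    moreover have "AE s in lborel. 0 < s \<longrightarrow> (\<exists>g. (v s, g) \<in> subgradient N F \<and>
        ((\<lambda>h. Ltwo_norm N (\<lambda>x. (v (s + h) x - v s x) / h - (- g x))) \<longlongrightarrow> 0) (at 0))"
      using v by (simp add: gradient_flow_def)
    ultimately show ?thesis
    proof eventually_elim
      case (elim s)
      show ?case
      proof
        assume s: "0 < s"
        obtain f where f: "(u s, f) \<in> subgradient N F"
            "((\<lambda>h. Ltwo_norm N (\<lambda>x. (u (s + h) x - u s x) / h - (- f x))) \<longlongrightarrow> 0) (at 0)"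
          using elim(1) s by blast
        obtain g where g: "(v s, g) \<in> subgradient N F"
            "((\<lambda>h. Ltwo_norm N (\<lambda>x. (v (s + h) x - v s x) / h - (- g x))) \<longlongrightarrow> 0) (at 0)"
          using elim(2) s by blast
        have fg: "f \<in> Ltwo N" "g \<in> Ltwo N"
          using f(1) g(1) by (auto simp: subgradient_def)
        have conv: "Ltwo_norm N (\<lambda>x. (y (s + h) x - y s x) / h - (- p x)) = nrm ((1 / h) *\<^sub>R (y (s + h) - y s) + p)"
          if "y (s + h) \<in> Ltwo N" "y s \<in> Ltwo N" "p \<in> Ltwo N" for y :: "real \<Rightarrow> 'a \<Rightarrow> real" and h p
          using that by (simp add: nrm_eq P_add P_scale P_diff P_id)
        \<comment> \<open>The derivatives of \<open>u\<close> and \<open>v\<close> are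
          \<open>- f\<close> and \<open>- g\<close>. Thus \<open>w\<close> moves with velocity
          \<open>g - f\<close>, and \<open>mono\<close> gives the derivative of \<open>q\<close> its
          sign.\<close>
        have "((\<lambda>h. nrm ((1 / h) *\<^sub>R (w (s + h) - w s) - (g - f))) \<longlongrightarrow> 0) (at 0)"
        proof (rule Lim_null_comparison)
          have "\<forall>\<^sub>F h in at 0. - s < h"
            using s by (intro order_tendstoD(1)[OF tendsto_ident_at]) simp
          then show "\<forall>\<^sub>F h in at 0. norm (nrm ((1 / h) *\<^sub>R (w (s + h) - w s) - (g - f)))
              \<le> Ltwo_norm N (\<lambda>x. (u (s + h) x - u s x) / h - (- f x))
                + Ltwo_norm N (\<lambda>x. (v (s + h) x - v s x) / h - (- g x))"
          proof eventually_elim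
            case (elim h)
            have eq: "(1 / h) *\<^sub>R (w (s + h) - w s) - (g - f)
                = ((1 / h) *\<^sub>R (u (s + h) - u s) + f) - ((1 / h) *\<^sub>R (v (s + h) - v s) + g)"
              by (simp add: w_def scaleR_diff_right)
            have tri: "nrm (a - b) \<le> nrm a + nrm b" for a b
              using nrm_triangle[of a "- b"] by (simp add: nrm_minus)
            have "nrm ((1 / h) *\<^sub>R (w (s + h) - w s) - (g - f))
                \<le> nrm ((1 / h) *\<^sub>R (u (s + h) - u s) + f) + nrm ((1 / h) *\<^sub>R (v (s + h) - v s) + g)"
              unfolding eq by (rule tri)
            moreover have "0 \<le> s + h" "0 \<le> s"
              using elim s by auto
            ultimately show ?case
              using conv[of u h f, OF um um fg(1)] conv[of v h g, OF vm vm fg(2)] by (simp del: scaleR_right_diff_distrib)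
          qed
          show "((\<lambda>h. Ltwo_norm N (\<lambda>x. (u (s + h) x - u s x) / h - (- f x))
                + Ltwo_norm N (\<lambda>x. (v (s + h) x - v s x) / h - (- g x))) \<longlongrightarrow> 0) (at 0)"
            using tendsto_add[OF f(2) g(2)] by simp
        qed
        then have "(q has_real_derivative 2 * pip (g - f) (E s)) (at s)"
          unfolding q_def E_def
          by (intro has_derivative_nrm_pos_part wm s k Ltwo_diff_mem fg)
        moreover have "pip (g - f) (E s) \<le> 0"
        proof -
          have "pip (f - g) (E s) = Ltwo_inner N (\<lambda>x. f x - g x) (\<lambda>x. max 0 (u s x - v s x - k))"
            using E[of s] s fg by (simp add: pip_def P_id P_diff E_def w_def)
          then show ?thesis
            using mono[OF f(1) g(1)] by (simp add: ip_diff_left)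
        qed
        ultimately show "\<exists>d\<le>0. (q has_real_derivative d) (at s)"
          by (intro exI[of _ "2 * pip (g - f) (E s)"]) simp
      qed
    qed
  qed
  have q_mono: "q b \<le> q a" if ab: "0 < a" "a \<le> b" for a b
  proof -
    obtain Lu where Lu: "\<And>r s. r \<in> {a..b} \<Longrightarrow> s \<in> {a..b} \<Longrightarrow> Ltwo_norm N (\<lambda>x. u r x - u s x) \<le> Lu * \<bar>r - s\<bar>"
      using u ab unfolding gradient_flow_def by meson
    obtain Lv where Lv: "\<And>r s. r \<in> {a..b} \<Longrightarrow> s \<in> {a..b} \<Longrightarrow> Ltwo_norm N (\<lambda>x. v r x - v s x) \<le> Lv * \<bar>r - s\<bar>"
      using v ab unfolding gradient_flow_def by meson
    define L where "L = \<bar>Lu\<bar> + \<bar>Lv\<bar>"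
    have L: "\<bar>nrm (E r) - nrm (E s)\<bar> \<le> L * \<bar>r - s\<bar>" if "r \<in> {a..b}" "s \<in> {a..b}" for r s
    proof -
      have "\<bar>nrm (E r) - nrm (E s)\<bar> \<le> Lu * \<bar>r - s\<bar> + Lv * \<bar>r - s\<bar>"
        using E_dist[of r s] w_dist[of r s] Lu[OF that] Lv[OF that] that ab by auto
      also have "\<dots> \<le> L * \<bar>r - s\<bar>"
        unfolding L_def distrib_right by (intro add_mono mult_right_mono) auto
      finally show ?thesis .
    qed
    define R where "R = nrm (E a) + L * (b - a)"
    have L0: "0 \<le> L"
      by (simp add: L_def)
    have R: "nrm (E r) \<le> R" if "r \<in> {a..b}" for r
    proof -
      have "L * \<bar>r - a\<bar> \<le> L * (b - a)"
        using that L0 by (intro mult_left_mono) auto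
      then show ?thesis
        using L[of r a] that ab by (simp add: R_def)
    qed
    show ?thesis
    proof (rule lipschitz_nonincreasing[OF ab(2)])
      fix r s assume rs: "r \<in> {a..b}" "s \<in> {a..b}"
      have "q r - q s = (nrm (E r) - nrm (E s)) * (nrm (E r) + nrm (E s))"
        by (simp add: q_def power2_eq_square algebra_simps)
      then have "\<bar>q r - q s\<bar> = \<bar>nrm (E r) - nrm (E s)\<bar> * (nrm (E r) + nrm (E s))"
        by (simp add: abs_mult)
      also have "\<dots> \<le> (L * \<bar>r - s\<bar>) * (R + R)"
        using L[OF rs] R[OF rs(1)] R[OF rs(2)] L0 by (intro mult_mono) auto
      finally show "\<bar>q r - q s\<bar> \<le> (L * (R + R)) * \<bar>r - s\<bar>"
        by (simp add: mult_ac)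
    next
      show "AE s in lborel. a < s \<longrightarrow> s < b \<longrightarrow> (\<exists>d\<le>0. (q has_real_derivative d) (at s))"
        using deriv by eventually_elim (use ab in auto)
    qed
  qed
  have "nrm (E 0) = 0"
  proof -
    have "AE x in N. u 0 x = u0 x" "AE x in N. v 0 x = v0 x"
      using u v by (auto simp: gradient_flow_def)
    then have "AE x in N. (E 0 x)\<^sup>2 = 0"
      using init by eventually_elim (simp add: E_def w_def)
    then have "(LINT x|N. (E 0 x)\<^sup>2) = 0"
      by (rule integral_eq_zero_AE)
    then show ?thesis
      using E[of 0] by (simp add: nrm_Ltwo Ltwo_norm_def)
  qed
  \<comment> \<open>The Lipschitz bounds may degenerate at time 0, so the initial value is reached
    through continuity.\<close>
  moreover have "nrm (E t) \<le> nrm (E 0)"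
  proof (cases "t = 0")
    case False
    then have t: "0 < t" using t by simp
    have E_le: "nrm (E t) \<le> nrm (E s)" if "0 < s" "s \<le> t" for s
      using q_mono[OF that] unfolding q_def by (rule power2_le_imp_le) simp
    have "((\<lambda>s. nrm (E s) - nrm (E 0)) \<longlongrightarrow> 0) (at 0 within {0..})"
    proof (rule Lim_null_comparison)
      have "\<forall>\<^sub>F s in at 0 within {0..}. 0 \<le> (s :: real)"
        by (auto simp: eventually_at_filter)
      then show "\<forall>\<^sub>F s in at 0 within {0..}. norm (nrm (E s) - nrm (E 0))
          \<le> Ltwo_norm N (\<lambda>x. u s x - u 0 x) + Ltwo_norm N (\<lambda>x. v s x - v 0 x)"
      proof eventually_elim
        case (elim s)
        then show ?case
          using E_dist[of s 0] w_dist[of s 0] by simp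
      qed
      have "((\<lambda>s. Ltwo_norm N (\<lambda>x. u s x - u 0 x)) \<longlongrightarrow> 0) (at 0 within {0..})"
          "((\<lambda>s. Ltwo_norm N (\<lambda>x. v s x - v 0 x)) \<longlongrightarrow> 0) (at 0 within {0..})"
        using u v by (simp_all add: gradient_flow_def)
      then show "((\<lambda>s. Ltwo_norm N (\<lambda>x. u s x - u 0 x) + Ltwo_norm N (\<lambda>x. v s x - v 0 x)) \<longlongrightarrow> 0)
          (at 0 within {0..})"
        using tendsto_add by fastforce
    qed
    then have "((\<lambda>s. nrm (E s)) \<longlongrightarrow> nrm (E 0)) (at 0 within {0..})"
      by (rule LIM_zero_cancel)
    then show ?thesis
    proof (rule tendsto_lowerbound)
      have "\<forall>\<^sub>F s in at 0 within {0..}. s < t"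
        using t by (intro order_tendstoD(2)[OF tendsto_ident_at]) simp
      moreover have "\<forall>\<^sub>F s in at 0 within {0..}. 0 < (s :: real)"
        by (auto simp: eventually_at_filter)
      ultimately show "\<forall>\<^sub>F s in at 0 within {0..}. nrm (E t) \<le> nrm (E s)"
        by eventually_elim (use E_le in auto)
      have "(0 :: real) islimpt {0..}"
        by (rule islimpt_subset[of _ "{0..1}"]) (simp_all add: islimpt_Icc)
      then show "at (0 :: real) within {0..} \<noteq> bot"
        by (simp add: trivial_limit_within)
    qed
  qed simp
  ultimately have "nrm (E t) = 0"
    using nrm_nonneg[of "E t"] by linarith
  then have "(LINT x|N. (E t x)\<^sup>2) = 0"
    using E[OF t] by (simp add: nrm_Ltwo Ltwo_norm_def)
  then have "AE x in N. (E t x)\<^sup>2 = 0"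
    using E[OF t] by (subst (asm) integral_nonneg_eq_0_iff_AE) (auto simp: Ltwo_def)
  then show ?thesis
    by eventually_elim (simp add: E_def w_def)
qed

end

section \<open>The nonlocal energy\<close>

text \<open>A number \<open>r\<close> with \<open>\<bar>r\<bar> \<le> \<bar>s\<bar>\<close> is a
  convex combination of \<open>s\<close> and \<open>- s\<close>, where an even function takes equal
  values.\<close>

lemma convex_even_mono:
  assumes conv: "convex_ennreal \<phi>" and even: "\<And>s. \<phi> (- s) = \<phi> s" and le: "\<bar>r\<bar> \<le> \<bar>s\<bar>"
  shows "\<phi> r \<le> \<phi> s"
proof (cases "s = 0")
  case False
  define t where "t = r / s"
  have "\<bar>t\<bar> \<le> 1"
    using le False by (simp add: t_def divide_le_eq_1)
  define c where "c = (1 - t) / 2"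
  have c: "0 \<le> c" "c \<le> 1"
    using \<open>\<bar>t\<bar> \<le> 1\<close> by (auto simp: c_def abs_le_iff)
  have "(1 - c) * s + c * (- s) = t * s"
    by (simp add: c_def field_simps)
  also have "\<dots> = r"
    using False by (simp add: t_def)
  finally have "(1 - c) * s + c * (- s) = r" .
  then have "\<phi> r \<le> ennreal (1 - c) * \<phi> s + ennreal c * \<phi> (- s)"
    using conv c unfolding convex_ennreal_def by (metis atLeastAtMost_iff)
  also have "\<dots> = (ennreal (1 - c) + ennreal c) * \<phi> s"
    by (simp add: even distrib_right)
  also have "ennreal (1 - c) + ennreal c = 1"
    using c by (simp flip: ennreal_plus)
  finally show ?thesis
    by simp
qed (use le in simp)

text \<open>
  By lower semicontinuity and monotonicity in \<open>\<bar>s\<bar>\<close>, \<open>\<Phi>(x, y, s)\<close> is a countable supremum over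
  rational arguments, which makes \<open>\<Phi>\<close> jointly measurable along measurable arguments.
\<close>

lemma convex_even_lsc_eq_SUP:
  assumes conv: "convex_ennreal \<phi>" and even: "\<And>s. \<phi> (- s) = \<phi> s" and zero: "\<phi> 0 = 0"
    and lsc: "lsc_real \<phi>"
  shows "\<phi> s = (SUP q::rat. if \<bar>real_of_rat q\<bar> < \<bar>s\<bar> then \<phi> (real_of_rat q) else 0)"
proof (rule antisym)
  show "(SUP q::rat. if \<bar>real_of_rat q\<bar> < \<bar>s\<bar> then \<phi> (real_of_rat q) else 0) \<le> \<phi> s"
    by (rule SUP_least) (auto intro: convex_even_mono[OF conv even])
  show "\<phi> s \<le> (SUP q::rat. if \<bar>real_of_rat q\<bar> < \<bar>s\<bar> then \<phi> (real_of_rat q) else 0)"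
  proof (cases "s = 0")
    case True
    then show ?thesis by (simp add: zero)
  next
    case False
    show ?thesis
    proof (rule dense_le)
      fix b assume "b < \<phi> s"
      also have "\<phi> s \<le> Liminf (at s) \<phi>"
        using lsc by (simp add: lsc_real_def)
      finally have "\<forall>\<^sub>F t in at s. b < \<phi> t"
        by (rule less_LiminfD)
      then obtain d where d: "0 < d" "\<And>t. t \<noteq> s \<Longrightarrow> dist t s < d \<Longrightarrow> b < \<phi> t"
        unfolding eventually_at by blast
      have "\<exists>q::rat. \<bar>real_of_rat q\<bar> < \<bar>s\<bar> \<and> dist (real_of_rat q) s < d"
      proof (cases "0 < s")
        case True
        then obtain q :: rat where "max 0 (s - d) < real_of_rat q" "real_of_rat q < s"
          using of_rat_dense[of "max 0 (s - d)" s] d(1) by auto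
        then have "\<bar>real_of_rat q\<bar> < \<bar>s\<bar>" "dist (real_of_rat q) s < d"
          unfolding dist_real_def by linarith+
        then show ?thesis
          by blast
      next
        case neg: False
        then obtain q :: rat where "s < real_of_rat q" "real_of_rat q < min 0 (s + d)"
          using of_rat_dense[of s "min 0 (s + d)"] d(1) False by auto
        then have "\<bar>real_of_rat q\<bar> < \<bar>s\<bar>" "dist (real_of_rat q) s < d"
          unfolding dist_real_def by linarith+
        then show ?thesis
          by blast
      qed
      then obtain q :: rat where q: "\<bar>real_of_rat q\<bar> < \<bar>s\<bar>" "dist (real_of_rat q) s < d"
        by blast
      then have "real_of_rat q \<noteq> s"
        by (metis less_irrefl)
      with q have "b \<le> (if \<bar>real_of_rat q\<bar> < \<bar>s\<bar> then \<phi> (real_of_rat q) else 0)"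
        using d(2)[of "real_of_rat q"] by (auto intro: less_imp_le)
      also have "\<dots> \<le> (SUP q::rat. if \<bar>real_of_rat q\<bar> < \<bar>s\<bar> then \<phi> (real_of_rat q) else 0)"
        by (rule SUP_upper) simp
      finally show "b \<le> (SUP q::rat. if \<bar>real_of_rat q\<bar> < \<bar>s\<bar> then \<phi> (real_of_rat q) else 0)" .
    qed
  qed
qed

locale integrand = sigma_finite_measure M for M :: "'a measure" +
  fixes \<Phi> :: "'a \<Rightarrow> 'a \<Rightarrow> real \<Rightarrow> ennreal"
  assumes C: "condition_C M \<Phi>"
begin

lemma \<Phi>_C:
  assumes "x \<in> space M" "y \<in> space M"
  shows "\<Phi> x y 0 = 0" "lsc_real (\<Phi> x y)" "convex_ennreal (\<Phi> x y)" "\<Phi> x y (- s) = \<Phi> x y s"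
  using C assms by (auto simp: condition_C_def)

lemma \<Phi>_mono: "x \<in> space M \<Longrightarrow> y \<in> space M \<Longrightarrow> \<bar>r\<bar> \<le> \<bar>s\<bar> \<Longrightarrow> \<Phi> x y r \<le> \<Phi> x y s"
  by (rule convex_even_mono[OF \<Phi>_C(3,4)])

lemma \<Phi>_convex:
  assumes "x \<in> space M" "y \<in> space M" "0 \<le> c" "c \<le> 1"
  shows "\<Phi> x y ((1 - c) * s + c * t) \<le> ennreal (1 - c) * \<Phi> x y s + ennreal c * \<Phi> x y t"
  using \<Phi>_C(3)[OF assms(1,2)] assms(3,4) by (simp add: convex_ennreal_def)

lemma \<Phi>_measurable:
  assumes w [measurable]: "w \<in> borel_measurable (M \<Otimes>\<^sub>M M)"
  shows "(\<lambda>p. \<Phi> (fst p) (snd p) (w p)) \<in> borel_measurable (M \<Otimes>\<^sub>M M)"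
proof -
  have [measurable]: "(\<lambda>p. \<Phi> (fst p) (snd p) s) \<in> borel_measurable (M \<Otimes>\<^sub>M M)" for s
    using C by (simp add: condition_C_def case_prod_beta')
  have "(\<lambda>p. SUP q::rat. if \<bar>real_of_rat q\<bar> < \<bar>w p\<bar> then \<Phi> (fst p) (snd p) (real_of_rat q) else 0)
      \<in> borel_measurable (M \<Otimes>\<^sub>M M)"
    by measurable
  moreover have "\<Phi> (fst p) (snd p) (w p)
      = (SUP q::rat. if \<bar>real_of_rat q\<bar> < \<bar>w p\<bar> then \<Phi> (fst p) (snd p) (real_of_rat q) else 0)"
    if "p \<in> space (M \<Otimes>\<^sub>M M)" for p
    using that by (intro convex_even_lsc_eq_SUP \<Phi>_C) (auto simp: space_pair_measure)
  ultimately show ?thesis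
    by (subst measurable_cong) auto
qed

section \<open>The energy as a double integral\<close>

text \<open>Twice the energy, as one integral over the product and with values in
  \<open>ennreal\<close>, so that inequalities can be integrated before finiteness is known.\<close>

definition G :: "('a \<Rightarrow> real) \<Rightarrow> ennreal" where
  "G u = (\<integral>\<^sup>+p. \<Phi> (fst p) (snd p) (u (fst p) - u (snd p)) \<partial>(M \<Otimes>\<^sub>M M))"

lemma \<Phi>_diff_measurable:
  assumes [measurable]: "u \<in> borel_measurable M"
  shows "(\<lambda>p. \<Phi> (fst p) (snd p) (u (fst p) - u (snd p))) \<in> borel_measurable (M \<Otimes>\<^sub>M M)"
  by (rule \<Phi>_measurable) measurable

lemma G_eq:
  assumes "u \<in> borel_measurable M"
  shows "(\<integral>\<^sup>+x. \<integral>\<^sup>+y. \<Phi> x y (u x - u y) \<partial>M \<partial>M) = G u"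
  using nn_integral_fst[OF \<Phi>_diff_measurable[OF assms]] by (simp add: G_def)

lemma energy_eq: "u \<in> borel_measurable M \<Longrightarrow> energy M \<Phi> u = enn2ereal (1 / 2 * G u)"
  by (simp add: energy_def G_eq)

lemma W_Phi_0_iff:
  "u \<in> W_Phi_0 M \<Phi> \<longleftrightarrow> u \<in> borel_measurable M \<and> (\<exists>l>0. G (\<lambda>x. u x / l) < \<infinity>)"
proof -
  have "(\<integral>\<^sup>+x. \<integral>\<^sup>+y. \<Phi> x y ((u x - u y) / l) \<partial>M \<partial>M) = G (\<lambda>x. u x / l)"
    if [measurable]: "u \<in> borel_measurable M" for l
    by (subst G_eq[symmetric]) (auto simp: diff_divide_distrib)
  then show ?thesis
    unfolding W_Phi_0_def by auto
qed

text \<open>The truncation controls only the sum of two energies, not each of them. Where fewer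
  summands are wanted, the zero function fills the slot.\<close>

lemma G_mono_sum:
  assumes [measurable]: "u \<in> borel_measurable M" "v \<in> borel_measurable M"
    and le: "\<And>x y. x \<in> space M \<Longrightarrow> y \<in> space M
      \<Longrightarrow> \<Phi> x y (w x - w y) + \<Phi> x y (z x - z y) \<le> \<Phi> x y (u x - u y) + \<Phi> x y (v x - v y)"
    and [measurable]: "w \<in> borel_measurable M" "z \<in> borel_measurable M"
  shows "G w + G z \<le> G u + G v"
proof -
  have "G w + G z = (\<integral>\<^sup>+p. \<Phi> (fst p) (snd p) (w (fst p) - w (snd p)) + \<Phi> (fst p) (snd p) (z (fst p) - z (snd p)) \<partial>(M \<Otimes>\<^sub>M M))"
    unfolding G_def by (intro nn_integral_add[symmetric] \<Phi>_diff_measurable assms)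
  also have "\<dots> \<le> (\<integral>\<^sup>+p. \<Phi> (fst p) (snd p) (u (fst p) - u (snd p)) + \<Phi> (fst p) (snd p) (v (fst p) - v (snd p)) \<partial>(M \<Otimes>\<^sub>M M))"
    by (intro nn_integral_mono le) (auto simp: space_pair_measure)
  also have "\<dots> = G u + G v"
    unfolding G_def by (intro nn_integral_add \<Phi>_diff_measurable assms)
  finally show ?thesis .
qed

lemma G_zero: "G (\<lambda>x. 0) = 0"
proof -
  have "G (\<lambda>x. 0) = (\<integral>\<^sup>+p. 0 \<partial>(M \<Otimes>\<^sub>M M))"
    unfolding G_def by (intro nn_integral_cong) (auto simp: space_pair_measure \<Phi>_C(1))
  then show ?thesis by simp
qed

text \<open>The argument for the triangle inequality of a Luxemburg norm: scales \<open>l\<close>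
  and \<open>m\<close> add up to an admissible scale \<open>l + m\<close>.\<close>

lemma W_Phi_0_bound:
  assumes u: "u \<in> W_Phi_0 M \<Phi>" and v: "v \<in> W_Phi_0 M \<Phi>" and w: "w \<in> borel_measurable M"
    and le: "\<And>x y. x \<in> space M \<Longrightarrow> y \<in> space M \<Longrightarrow> \<bar>w x - w y\<bar> \<le> \<bar>u x - u y\<bar> + \<bar>v x - v y\<bar>"
  shows "w \<in> W_Phi_0 M \<Phi>"
proof -
  obtain l m where l: "0 < l" "G (\<lambda>x. u x / l) < \<infinity>" and m: "0 < m" "G (\<lambda>x. v x / m) < \<infinity>"
    using u v by (auto simp: W_Phi_0_iff)
  have [measurable]: "u \<in> borel_measurable M" "v \<in> borel_measurable M" "w \<in> borel_measurable M"
    using u v w by (auto simp: W_Phi_0_iff)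
  have "G (\<lambda>x. w x / (l + m)) + G (\<lambda>x. 0) \<le> G (\<lambda>x. u x / l) + G (\<lambda>x. v x / m)"
  proof (rule G_mono_sum)
    fix x y assume xy: "x \<in> space M" "y \<in> space M"
    define a b where "a = \<bar>u x - u y\<bar> / l" and "b = \<bar>v x - v y\<bar> / m"
    \<comment> \<open>With this weight the increments \<open>a\<close> at scale \<open>l\<close> and
      \<open>b\<close> at scale \<open>m\<close> combine to the summed increment at scale
      \<open>l + m\<close>.\<close>
    define c where "c = m / (l + m)"
    have c: "0 \<le> c" "c \<le> 1"
      using l m by (auto simp: c_def)
    have ab: "(1 - c) * a + c * b = (\<bar>u x - u y\<bar> + \<bar>v x - v y\<bar>) / (l + m)"
    proof -
      have "1 - c = l / (l + m)"
        using l m by (simp add: c_def field_simps)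
      then show ?thesis
        using l m by (simp add: a_def b_def c_def add_divide_distrib)
    qed
    have "\<bar>w x / (l + m) - w y / (l + m)\<bar> = \<bar>w x - w y\<bar> / (l + m)"
      using l m by (simp flip: diff_divide_distrib)
    also have "\<dots> \<le> (1 - c) * a + c * b"
      unfolding ab using le[OF xy] l m by (intro divide_right_mono) auto
    finally have "\<Phi> x y (w x / (l + m) - w y / (l + m)) \<le> \<Phi> x y ((1 - c) * a + c * b)"
      by (intro \<Phi>_mono[OF xy]) simp
    also have "\<dots> \<le> ennreal (1 - c) * \<Phi> x y a + ennreal c * \<Phi> x y b"
      by (rule \<Phi>_convex[OF xy c])
    also have "\<dots> \<le> 1 * \<Phi> x y a + 1 * \<Phi> x y b"
      using c by (intro add_mono mult_right_mono) auto
    also have "\<dots> \<le> \<Phi> x y (u x / l - u y / l) + \<Phi> x y (v x / m - v y / m)"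
      using l m by (auto simp: a_def b_def simp flip: diff_divide_distrib intro!: add_mono \<Phi>_mono[OF xy])
    finally show "\<Phi> x y (w x / (l + m) - w y / (l + m)) + \<Phi> x y (0 - 0)
        \<le> \<Phi> x y (u x / l - u y / l) + \<Phi> x y (v x / m - v y / m)"
      by (simp add: \<Phi>_C(1)[OF xy])
  qed measurable
  then have "G (\<lambda>x. w x / (l + m)) < \<infinity>"
    using l(2) m(2) by (simp add: G_zero order_le_less_trans)
  then show ?thesis
    unfolding W_Phi_0_iff using l m w by (intro conjI exI[of _ "l + m"]) auto
qed

text \<open>
  The differences of \<open>u - \<phi>\<close> and \<open>v + \<phi>\<close> are complementary convex combinations of those of \<open>u\<close> and
  \<open>v\<close> if \<open>\<phi>\<close> is a nondecreasing contraction applied to \<open>u - v\<close>.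
\<close>

lemma G_truncation:
  assumes [measurable]: "u \<in> borel_measurable M" "v \<in> borel_measurable M"
  shows "G (\<lambda>x. u x - max 0 (u x - v x - k)) + G (\<lambda>x. v x + max 0 (u x - v x - k)) \<le> G u + G v"
proof (rule G_mono_sum)
  fix x y assume xy: "x \<in> space M" "y \<in> space M"
  define a b p where "a = u x - u y" and "b = v x - v y"
    and "p = max 0 (u x - v x - k) - max 0 (u y - v y - k)"
  have "\<exists>c\<in>{0..1}. p = c * (a - b)"
  proof (cases "a = b")
    case True
    then show ?thesis
      by (intro bexI[of _ 0]) (auto simp: a_def b_def p_def max_def)
  next
    case False
    have "0 \<le> p / (a - b)" "p / (a - b) \<le> 1"
      using False by (auto simp: zero_le_divide_iff divide_le_eq_1 a_def b_def p_def max_def)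
    then show ?thesis
      using False by (intro bexI[of _ "p / (a - b)"]) auto
  qed
  then obtain c where c: "0 \<le> c" "c \<le> 1" "p = c * (a - b)"
    by auto
  have "\<Phi> x y (a - p) \<le> ennreal (1 - c) * \<Phi> x y a + ennreal c * \<Phi> x y b"
    using \<Phi>_convex[OF xy c(1,2), of a b] by (simp add: c(3) algebra_simps)
  moreover have "\<Phi> x y (b + p) \<le> ennreal (1 - c) * \<Phi> x y b + ennreal c * \<Phi> x y a"
    using \<Phi>_convex[OF xy c(1,2), of b a] by (simp add: c(3) algebra_simps)
  ultimately have "\<Phi> x y (a - p) + \<Phi> x y (b + p)
      \<le> (ennreal (1 - c) * \<Phi> x y a + ennreal c * \<Phi> x y b) + (ennreal (1 - c) * \<Phi> x y b + ennreal c * \<Phi> x y a)"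
    by (rule add_mono)
  also have "\<dots> = (ennreal (1 - c) + ennreal c) * \<Phi> x y a + (ennreal (1 - c) + ennreal c) * \<Phi> x y b"
    by (simp add: distrib_right add_ac)
  also have "ennreal (1 - c) + ennreal c = 1"
    using c by (simp flip: ennreal_plus)
  finally have "\<Phi> x y (a - p) + \<Phi> x y (b + p) \<le> \<Phi> x y a + \<Phi> x y b"
    by simp
  moreover have eq: "a - p = (u x - max 0 (u x - v x - k)) - (u y - max 0 (u y - v y - k))"
      "b + p = (v x + max 0 (u x - v x - k)) - (v y + max 0 (u y - v y - k))"
    by (simp_all add: a_def b_def p_def)
  ultimately show "\<Phi> x y ((u x - max 0 (u x - v x - k)) - (u y - max 0 (u y - v y - k)))
      + \<Phi> x y ((v x + max 0 (u x - v x - k)) - (v y + max 0 (u y - v y - k)))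
      \<le> \<Phi> x y (u x - u y) + \<Phi> x y (v x - v y)"
    unfolding eq unfolding a_def b_def by simp
qed measurable

text \<open>Membership in the space gives finiteness after division by some \<open>l\<close>.
  Repeated doubling, until \<open>2 ^ n\<close> exceeds \<open>l\<close>, undoes this
  division.\<close>

lemma G_finite:
  assumes delta2: "delta2_condition M \<Phi>" and u: "u \<in> W_Phi_0 M \<Phi>"
  shows "G u < \<infinity>"
proof -
  obtain l where l: "0 < l" "G (\<lambda>x. u x / l) < \<infinity>"
    using u by (auto simp: W_Phi_0_iff)
  have [measurable]: "u \<in> borel_measurable M"
    using u by (simp add: W_Phi_0_iff)
  obtain K h where K: "0 < K" and h: "integrable (M \<Otimes>\<^sub>M M) h"
    and d2: "\<And>x y s. x \<in> space M \<Longrightarrow> y \<in> space M \<Longrightarrow> \<Phi> x y (2 * s) \<le> ennreal K * \<Phi> x y s + ennreal (h (x, y))"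
    using delta2 unfolding delta2_condition_def by blast
  have double: "G (\<lambda>x. 2 * w x) < \<infinity>" if "G w < \<infinity>" and w [measurable]: "w \<in> borel_measurable M" for w
  proof -
    have [measurable]: "h \<in> borel_measurable (M \<Otimes>\<^sub>M M)"
      using h by simp
    note [measurable] = \<Phi>_diff_measurable[OF w]
    have "G (\<lambda>x. 2 * w x) \<le> (\<integral>\<^sup>+p. ennreal K * \<Phi> (fst p) (snd p) (w (fst p) - w (snd p)) + ennreal (h p) \<partial>(M \<Otimes>\<^sub>M M))"
      unfolding G_def
    proof (rule nn_integral_mono)
      fix p assume "p \<in> space (M \<Otimes>\<^sub>M M)"
      then show "\<Phi> (fst p) (snd p) (2 * w (fst p) - 2 * w (snd p))
          \<le> ennreal K * \<Phi> (fst p) (snd p) (w (fst p) - w (snd p)) + ennreal (h p)"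
        using d2[of "fst p" "snd p" "w (fst p) - w (snd p)"]
        by (simp add: space_pair_measure mem_Times_iff right_diff_distrib)
    qed
    also have "\<dots> = (\<integral>\<^sup>+p. ennreal K * \<Phi> (fst p) (snd p) (w (fst p) - w (snd p)) \<partial>(M \<Otimes>\<^sub>M M)) + (\<integral>\<^sup>+p. ennreal (h p) \<partial>(M \<Otimes>\<^sub>M M))"
      by (rule nn_integral_add) measurable
    also have "(\<integral>\<^sup>+p. ennreal K * \<Phi> (fst p) (snd p) (w (fst p) - w (snd p)) \<partial>(M \<Otimes>\<^sub>M M)) = ennreal K * G w"
      unfolding G_def by (rule nn_integral_cmult) measurable
    also have "ennreal K * G w + (\<integral>\<^sup>+p. ennreal (h p) \<partial>(M \<Otimes>\<^sub>M M)) < \<infinity>"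
    proof -
      have "(\<integral>\<^sup>+p. ennreal (h p) \<partial>(M \<Otimes>\<^sub>M M)) < \<infinity>"
      proof (rule order_le_less_trans)
        show "(\<integral>\<^sup>+p. ennreal (h p) \<partial>(M \<Otimes>\<^sub>M M)) \<le> (\<integral>\<^sup>+p. ennreal (norm (h p)) \<partial>(M \<Otimes>\<^sub>M M))"
          by (intro nn_integral_mono ennreal_leI) simp
        show "(\<integral>\<^sup>+p. ennreal (norm (h p)) \<partial>(M \<Otimes>\<^sub>M M)) < \<infinity>"
          using h by (simp add: integrable_iff_bounded)
      qed
      then show ?thesis
        using that(1) by (simp add: ennreal_mult_less_top)
    qed
    finally show ?thesis .
  qed
  have "G (\<lambda>x. 2 ^ n * (u x / l)) < \<infinity>" for n
  proof (induction n)
    case (Suc n)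
    then show ?case
      using double[of "\<lambda>x. 2 ^ n * (u x / l)"] by (simp add: mult.assoc)
  qed (use l in simp)
  moreover obtain n where n: "l < 2 ^ n"
    using real_arch_pow[of 2 l] by auto
  have "G u + G (\<lambda>x. 0) \<le> G (\<lambda>x. 2 ^ n * (u x / l)) + G (\<lambda>x. 0)"
  proof (rule G_mono_sum)
    fix x y assume xy: "x \<in> space M" "y \<in> space M"
    have "\<bar>u x - u y\<bar> * 1 \<le> \<bar>u x - u y\<bar> * (2 ^ n / l)"
      using n l by (intro mult_left_mono) auto
    also have "\<dots> = \<bar>2 ^ n * (u x / l) - 2 ^ n * (u y / l)\<bar>"
      using l by (simp add: abs_mult flip: right_diff_distrib diff_divide_distrib)
    finally show "\<Phi> x y (u x - u y) + \<Phi> x y (0 - 0) \<le> \<Phi> x y (2 ^ n * (u x / l) - 2 ^ n * (u y / l)) + \<Phi> x y (0 - 0)"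
      by (intro add_mono \<Phi>_mono[OF xy]) auto
  qed measurable
  ultimately show ?thesis
    by (metis G_zero add.right_neutral order_le_less_trans)
qed

end

section \<open>The form domain and the \<open>j\<close>-subgradient\<close>

lemma Ltwo_cong:
  assumes "\<And>x. x \<in> space N \<Longrightarrow> u x = v x"
  shows "u \<in> Ltwo N \<longleftrightarrow> v \<in> Ltwo N"
proof -
  have "u \<in> borel_measurable N \<longleftrightarrow> v \<in> borel_measurable N"
    by (rule measurable_cong) (rule assms)
  moreover have "integrable N (\<lambda>x. (u x)\<^sup>2) \<longleftrightarrow> integrable N (\<lambda>x. (v x)\<^sup>2)"
    by (intro Bochner_Integration.integrable_cong) (simp_all add: assms)
  ultimately show ?thesis
    by (simp add: Ltwo_def)
qed

locale form_domain = integrand M \<Phi> for M :: "'a measure" and \<Phi> +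
  fixes \<Omega> :: "'a set"
  assumes \<Omega>: "\<Omega> \<in> sets M"
begin

abbreviation N where "N \<equiv> restrict_space M \<Omega>"

lemma space_N: "space N = \<Omega>"
  using sets.sets_into_space[OF \<Omega>] by (auto simp: space_restrict_space)

lemma j_map_apply: "x \<in> space N \<Longrightarrow> j_map \<Omega> u x = u x"
  by (simp add: space_N j_map_def)

lemma W_Phi_2_iff: "u \<in> W_Phi_2 M \<Omega> \<Phi> \<longleftrightarrow> u \<in> W_Phi_0 M \<Phi> \<and> u \<in> Ltwo N"
  by (simp add: W_Phi_2_def Ltwo_cong[OF j_map_apply])

lemma W_Phi_2_measurable: "u \<in> W_Phi_2 M \<Omega> \<Phi> \<Longrightarrow> u \<in> borel_measurable M"
  by (simp add: W_Phi_2_iff W_Phi_0_iff)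

lemma inner_j_map: "Ltwo_inner N f (j_map \<Omega> u) = Ltwo_inner N f u"
  unfolding Ltwo_inner_def by (rule Bochner_Integration.integral_cong[OF refl]) (simp only: j_map_apply)

text \<open>A common criterion for differences and truncations: increments control the energy,
  values control the \<open>L^2\<close> part.\<close>

lemma W_Phi_2_bound:
  assumes u: "u \<in> W_Phi_2 M \<Omega> \<Phi>" and v: "v \<in> W_Phi_2 M \<Omega> \<Phi>" and w: "w \<in> borel_measurable M"
    and "\<And>x y. \<bar>w x - w y\<bar> \<le> \<bar>u x - u y\<bar> + \<bar>v x - v y\<bar>" and le: "\<And>x. \<bar>w x\<bar> \<le> \<bar>u x\<bar> + \<bar>v x\<bar>"
  shows "w \<in> W_Phi_2 M \<Omega> \<Phi>"
proof -
  have "w \<in> W_Phi_0 M \<Phi>"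
    using assms by (intro W_Phi_0_bound[of u v w]) (auto simp: W_Phi_2_iff)
  moreover have "w \<in> Ltwo N"
  proof (rule Ltwo_bound)
    have abs: "(\<lambda>x. \<bar>y x\<bar>) \<in> Ltwo N" if "y \<in> Ltwo N" for y
      using that Ltwo_measurable[OF that] by (intro Ltwo_bound[OF that]) auto
    show "(\<lambda>x. \<bar>u x\<bar> + \<bar>v x\<bar>) \<in> Ltwo N"
      using u v by (intro Ltwo_add abs) (auto simp: W_Phi_2_iff)
    show "w \<in> borel_measurable N"
      using w by (rule measurable_restrict_space1)
    show "\<bar>w x\<bar> \<le> \<bar>\<bar>u x\<bar> + \<bar>v x\<bar>\<bar>" for x
      using le[of x] by simp
  qed
  ultimately show ?thesis
    by (simp add: W_Phi_2_iff)
qed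

lemma zero_W_Phi_2: "(\<lambda>x. 0) \<in> W_Phi_2 M \<Omega> \<Phi>"
proof -
  have "G (\<lambda>x. 0 / 1) < \<infinity>"
    by (simp add: G_zero)
  then have "\<exists>l>0. G (\<lambda>x. 0 / l) < \<infinity>"
    using zero_less_one by blast
  then show ?thesis
    unfolding W_Phi_2_iff W_Phi_0_iff by (intro conjI Ltwo_zero borel_measurable_const)
qed

lemma zero_j_subgradient: "(\<lambda>x. 0, \<lambda>x. 0) \<in> j_subgradient M \<Omega> \<Phi>"
proof -
  have e0: "energy M \<Phi> (\<lambda>x. 0) = 0"
    by (simp add: energy_eq G_zero zero_ennreal.rep_eq)
  have "0 \<le> energy M \<Phi> v" for v
    by (simp add: energy_def)
  then show ?thesis
    unfolding j_subgradient_def using zero_W_Phi_2 Ltwo_zero[of N]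
    by (auto simp: e0 inner_j_map Ltwo_inner_def j_map_apply intro!: bexI[of _ "\<lambda>x. 0"] simp flip: zero_ereal_def)
qed

lemma W_Phi_2_diff:
  assumes "u \<in> W_Phi_2 M \<Omega> \<Phi>" "v \<in> W_Phi_2 M \<Omega> \<Phi>"
  shows "(\<lambda>x. u x - v x) \<in> W_Phi_2 M \<Omega> \<Phi>"
proof (rule W_Phi_2_bound[OF assms])
  show "(\<lambda>x. u x - v x) \<in> borel_measurable M"
    by (intro borel_measurable_diff W_Phi_2_measurable assms)
qed linarith+

lemma W_Phi_2_pos_part:
  assumes "u \<in> W_Phi_2 M \<Omega> \<Phi>" "v \<in> W_Phi_2 M \<Omega> \<Phi>" "0 \<le> k"
  shows "(\<lambda>x. max 0 (u x - v x - k)) \<in> W_Phi_2 M \<Omega> \<Phi>"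
proof (rule W_Phi_2_bound[OF assms(1,2)])
  show "(\<lambda>x. max 0 (u x - v x - k)) \<in> borel_measurable M"
    by (intro borel_measurable_max borel_measurable_diff borel_measurable_const W_Phi_2_measurable assms)
qed (use assms(3) in linarith)+

lemma energy_real:
  assumes "u \<in> borel_measurable M" "G u < \<infinity>"
  shows "energy M \<Phi> u = ereal (enn2real (G u) / 2)"
proof -
  have "G u = ennreal (enn2real (G u))"
    using assms(2) by (simp add: ennreal_enn2real)
  moreover have "1 / 2 * ennreal r = ennreal (r / 2)" if "0 \<le> r" for r
  proof -
    have eq: "(1 / 2 :: ennreal) = ennreal (1 / 2)"
      using divide_ennreal[of 1 2] by simp
    show ?thesis
      unfolding eq using that by (subst ennreal_mult[symmetric]) auto
  qed
  ultimately have "1 / 2 * G u = ennreal (enn2real (G u) / 2)"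
    by (metis enn2real_nonneg)
  then show ?thesis
    by (simp add: energy_eq[OF assms(1)] enn2ereal_ennreal)
qed

lemma energy_finite_iff: "u \<in> borel_measurable M \<Longrightarrow> energy M \<Phi> u < \<infinity> \<longleftrightarrow> G u < \<infinity>"
proof -
  assume u: "u \<in> borel_measurable M"
  have "G u < \<infinity>" if "energy M \<Phi> u < \<infinity>"
  proof (rule ccontr)
    assume "\<not> G u < \<infinity>"
    then have "G u = top"
      by (metis infinity_ennreal_def less_top)
    then have "energy M \<Phi> u = \<infinity>"
      by (simp add: energy_eq[OF u] ennreal_mult_top)
    then show False
      using that by simp
  qed
  then show ?thesis
    using energy_real[OF u] by auto
qed

text \<open>Testing both inequalities with the truncation gives the T-monotonicity of the subgradient.\<close>

lemma j_subgradient_T_monotone: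
  assumes af: "(a, f) \<in> j_subgradient M \<Omega> \<Phi>" and bg: "(b, g) \<in> j_subgradient M \<Omega> \<Phi>" and k: "0 \<le> k"
  shows "0 \<le> Ltwo_inner N (\<lambda>x. f x - g x) (\<lambda>x. max 0 (a x - b x - k))"
proof -
  obtain u where u: "u \<in> W_Phi_2 M \<Omega> \<Phi>" "energy M \<Phi> u < \<infinity>" "AE x in N. j_map \<Omega> u x = a x"
    and u': "\<And>w. w \<in> W_Phi_2 M \<Omega> \<Phi> \<Longrightarrow>
      ereal (Ltwo_inner N f w) \<le> energy M \<Phi> (\<lambda>x. u x + w x) - energy M \<Phi> u"
    using af unfolding j_subgradient_def inner_j_map by blast
  obtain v where v: "v \<in> W_Phi_2 M \<Omega> \<Phi>" "energy M \<Phi> v < \<infinity>" "AE x in N. j_map \<Omega> v x = b x"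
    and v': "\<And>w. w \<in> W_Phi_2 M \<Omega> \<Phi> \<Longrightarrow>
      ereal (Ltwo_inner N g w) \<le> energy M \<Phi> (\<lambda>x. v x + w x) - energy M \<Phi> v"
    using bg unfolding j_subgradient_def inner_j_map by blast
  have fg: "f \<in> Ltwo N" "g \<in> Ltwo N"
    using af bg by (auto simp: j_subgradient_def)
  define \<phi> where "\<phi> x = max 0 (u x - v x - k)" for x
  have \<phi>: "\<phi> \<in> W_Phi_2 M \<Omega> \<Phi>"
    unfolding \<phi>_def by (rule W_Phi_2_pos_part[OF u(1) v(1) k])
  have m\<phi>: "(\<lambda>x. - \<phi> x) \<in> W_Phi_2 M \<Omega> \<Phi>"
    using W_Phi_2_diff[OF zero_W_Phi_2 \<phi>] by simp
  note meas [measurable] = W_Phi_2_measurable[OF u(1)] W_Phi_2_measurable[OF v(1)] W_Phi_2_measurable[OF \<phi>]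
  have le: "G (\<lambda>x. u x + - \<phi> x) + G (\<lambda>x. v x + \<phi> x) \<le> G u + G v"
    using G_truncation[OF meas(1,2), of k] by (simp add: \<phi>_def)
  have fin: "G u < \<infinity>" "G v < \<infinity>"
    using iffD1[OF energy_finite_iff[OF meas(1)] u(2)] iffD1[OF energy_finite_iff[OF meas(2)] v(2)] .
  then have "G u + G v < \<infinity>"
    by simp
  then have sum_fin: "G (\<lambda>x. u x + - \<phi> x) + G (\<lambda>x. v x + \<phi> x) < \<infinity>"
    using le by (rule order_le_less_trans[rotated])
  then have fin': "G (\<lambda>x. u x + - \<phi> x) < \<infinity>" "G (\<lambda>x. v x + \<phi> x) < \<infinity>"
    by simp_all
  have "enn2real (G (\<lambda>x. u x + - \<phi> x) + G (\<lambda>x. v x + \<phi> x)) \<le> enn2real (G u + G v)"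
    using le fin by (intro enn2real_mono) auto
  then have "enn2real (G (\<lambda>x. u x + - \<phi> x)) + enn2real (G (\<lambda>x. v x + \<phi> x)) \<le> enn2real (G u) + enn2real (G v)"
    using fin fin' by (simp add: enn2real_plus)
  moreover have "Ltwo_inner N f (\<lambda>x. - \<phi> x) \<le> enn2real (G (\<lambda>x. u x + - \<phi> x)) / 2 - enn2real (G u) / 2"
    using u'[OF m\<phi>] fin fin' by (simp add: energy_real)
  moreover have "Ltwo_inner N g \<phi> \<le> enn2real (G (\<lambda>x. v x + \<phi> x)) / 2 - enn2real (G v) / 2"
    using v'[OF \<phi>] fin fin' by (simp add: energy_real)
  ultimately have "Ltwo_inner N f (\<lambda>x. - \<phi> x) + Ltwo_inner N g \<phi> \<le> 0"
    by linarith
  moreover have "Ltwo_inner N f (\<lambda>x. - \<phi> x) = - Ltwo_inner N f \<phi>"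
    by (simp add: Ltwo_inner_def)
  moreover have "Ltwo_inner N (\<lambda>x. f x - g x) \<phi> = Ltwo_inner N f \<phi> - Ltwo_inner N g \<phi>"
    using \<phi> fg by (simp add: Ltwo_inner_def left_diff_distrib Ltwo_integrable_mult W_Phi_2_iff)
  \<comment> \<open>The test function is built from representatives on the whole space; these agree
    with \<open>a\<close> and \<open>b\<close> only almost everywhere on
    \<open>\<Omega>\<close>.\<close>
  moreover have "Ltwo_inner N (\<lambda>x. f x - g x) (\<lambda>x. max 0 (a x - b x - k)) = Ltwo_inner N (\<lambda>x. f x - g x) \<phi>"
  proof -
    have ab: "a \<in> borel_measurable N" "b \<in> borel_measurable N"
      using af bg by (auto simp: j_subgradient_def Ltwo_def)
    have fgm: "f \<in> borel_measurable N" "g \<in> borel_measurable N" "\<phi> \<in> borel_measurable N"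
      using fg \<phi> by (auto simp: W_Phi_2_iff Ltwo_def)
    have "AE x in N. (f x - g x) * max 0 (a x - b x - k) = (f x - g x) * \<phi> x"
      using u(3) v(3) AE_space[of N] by eventually_elim (simp add: \<phi>_def j_map_apply)
    then show ?thesis
      unfolding Ltwo_inner_def using ab fgm by (intro integral_cong_AE) auto
  qed
  ultimately show ?thesis
    by linarith
qed

end

text \<open>
  The inequality of the \<open>j\<close>-subgradient at the resolvent is tested with the difference of \<open>w\<close> and the
  representative of the resolvent.
\<close>

lemma (in form_domain) resolvent_estimate:
  assumes w: "w \<in> W_Phi_2 M \<Omega> \<Phi>" "G w < \<infinity>" and h: "0 < h"
    and z: "(z, \<lambda>x. (j_map \<Omega> w x - z x) / h) \<in> j_subgradient M \<Omega> \<Phi>"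
  shows "(Ltwo_norm N (\<lambda>x. j_map \<Omega> w x - z x))\<^sup>2 \<le> h * (enn2real (G w) / 2)"
proof -
  let ?f = "\<lambda>x. (j_map \<Omega> w x - z x) / h"
  obtain u where u: "u \<in> W_Phi_2 M \<Omega> \<Phi>" "energy M \<Phi> u < \<infinity>" "AE x in N. j_map \<Omega> u x = z x"
    and u': "\<And>v. v \<in> W_Phi_2 M \<Omega> \<Phi> \<Longrightarrow>
      ereal (Ltwo_inner N ?f v) \<le> energy M \<Phi> (\<lambda>x. u x + v x) - energy M \<Phi> u"
    using z unfolding j_subgradient_def inner_j_map by blast
  have zm: "z \<in> Ltwo N" "?f \<in> Ltwo N"
    using z by (auto simp: j_subgradient_def)
  note meas = W_Phi_2_measurable[OF u(1)] W_Phi_2_measurable[OF w(1)]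
  have "G u < \<infinity>"
    using iffD1[OF energy_finite_iff[OF meas(1)] u(2)] .
  moreover have d: "(\<lambda>x. w x - u x) \<in> W_Phi_2 M \<Omega> \<Phi>"
    by (rule W_Phi_2_diff[OF w(1) u(1)])
  ultimately have "Ltwo_inner N ?f (\<lambda>x. w x - u x) \<le> enn2real (G w) / 2 - enn2real (G u) / 2"
    using u'[OF d] w(2) meas by (simp add: energy_real)
  also have "\<dots> \<le> enn2real (G w) / 2"
    by simp
  finally have "h * Ltwo_inner N ?f (\<lambda>x. w x - u x) \<le> h * (enn2real (G w) / 2)"
    using h by (intro mult_left_mono) auto
  moreover have "(Ltwo_norm N (\<lambda>x. j_map \<Omega> w x - z x))\<^sup>2 = h * Ltwo_inner N ?f (\<lambda>x. w x - u x)"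
  proof -
    have "AE x in N. (j_map \<Omega> w x - z x)\<^sup>2 = h * (?f x * (w x - u x))"
      using u(3) AE_space[of N] by eventually_elim (use h in \<open>simp add: j_map_apply power2_eq_square\<close>)
    moreover have "(\<lambda>x. j_map \<Omega> w x - z x) \<in> borel_measurable N"
      using w(1) zm by (intro borel_measurable_diff) (auto simp: W_Phi_2_def Ltwo_def)
    moreover have "(\<lambda>x. w x - u x) \<in> borel_measurable N"
      using d by (auto simp: W_Phi_2_iff Ltwo_def)
    ultimately have "(LINT x|N. (j_map \<Omega> w x - z x)\<^sup>2) = (LINT x|N. h * (?f x * (w x - u x)))"
      by (intro integral_cong_AE) auto
    then show ?thesis
      by (simp only: Ltwo_norm_power2 Ltwo_inner_def integral_mult_right_zero)
  qed
  ultimately show ?thesis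
    by simp
qed

section \<open>From comparison to the Dirichlet form\<close>

text \<open>Contractivity is comparison in both directions, with \<open>k\<close> the essential
  supremum of the initial difference; if that is infinite there is nothing to show.\<close>

lemma semigroup_order_preserving:
  assumes S: "generated_semigroup N F S"
    and mono: "\<And>a f b g k. (a, f) \<in> subgradient N F \<Longrightarrow> (b, g) \<in> subgradient N F \<Longrightarrow> 0 \<le> k
      \<Longrightarrow> 0 \<le> Ltwo_inner N (\<lambda>x. f x - g x) (\<lambda>x. max 0 (a x - b x - k))"
  shows "order_preserving N S \<and> Linf_contractive N S"
proof -
  obtain P where "Ltwo_projection N P"
    using Ltwo_projection_exists by blast
  then interpret Ltwo_projection N P .
  have flow: "gradient_flow N F u0 (\<lambda>t. S t u0)" if "u0 \<in> Ltwo N" for u0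
    using S that by (simp add: generated_semigroup_def)
  have comp: "AE x in N. S t u0 x \<le> S t v0 x + k"
    if "u0 \<in> Ltwo N" "v0 \<in> Ltwo N" "0 \<le> t" "0 \<le> k" "AE x in N. u0 x \<le> v0 x + k" for u0 v0 t k
    by (rule gradient_flow_comparison[OF flow[OF that(1)] flow[OF that(2)] mono]) (use that in auto)
  have "order_preserving N S"
    unfolding order_preserving_def
  proof (intro ballI allI impI)
    fix u0 v0 and t :: real
    assume "u0 \<in> Ltwo N" "v0 \<in> Ltwo N" "0 \<le> t" "AE x in N. u0 x \<le> v0 x"
    then show "AE x in N. S t u0 x \<le> S t v0 x"
      using comp[of u0 v0 t 0] by simp
  qed
  moreover have "Linf_contractive N S"
    unfolding Linf_contractive_def
  proof (intro ballI allI impI)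
    fix u0 v0 and t :: real
    assume uv: "u0 \<in> Ltwo N" "v0 \<in> Ltwo N" and t: "0 \<le> t"
    show "Linf_norm N (\<lambda>x. S t u0 x - S t v0 x) \<le> Linf_norm N (\<lambda>x. u0 x - v0 x)"
    proof (cases "Linf_norm N (\<lambda>x. u0 x - v0 x)")
      case (real k)
      have "AE x in N. ennreal \<bar>u0 x - v0 x\<bar> \<le> ennreal k"
        using esssup_AE[of "\<lambda>x. ennreal \<bar>u0 x - v0 x\<bar>" N] real(2) by (simp add: Linf_norm_def)
      then have ae: "AE x in N. \<bar>u0 x - v0 x\<bar> \<le> k"
        by eventually_elim (use real(1) in \<open>simp add: ennreal_le_iff\<close>)
      have "AE x in N. u0 x \<le> v0 x + k" "AE x in N. v0 x \<le> u0 x + k"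
        using ae by (eventually_elim, simp)+
      then have "AE x in N. S t u0 x \<le> S t v0 x + k" "AE x in N. S t v0 x \<le> S t u0 x + k"
        using comp[OF uv t real(1)] comp[OF uv(2,1) t real(1)] by blast+
      then have "AE x in N. ennreal \<bar>S t u0 x - S t v0 x\<bar> \<le> ennreal k"
        by eventually_elim (intro ennreal_leI, simp)
      moreover have "S t u0 \<in> borel_measurable N" "S t v0 \<in> borel_measurable N"
        using flow[OF uv(1)] flow[OF uv(2)] t by (auto simp: gradient_flow_def Ltwo_def)
      ultimately show ?thesis
        unfolding real(2) unfolding Linf_norm_def by (intro esssup_I) auto
    qed simp
  qed
  ultimately show ?thesis ..
qed

theorem theorem4p4:
  fixes M :: "'a measure" and \<Omega> :: "'a set" and \<Phi> :: "'a \<Rightarrow> 'a \<Rightarrow> real \<Rightarrow> ennreal"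
    and F :: "('a \<Rightarrow> real) \<Rightarrow> ereal"
  assumes "sigma_finite_measure M" and "\<Omega> \<in> sets M"
    and "standard_conditions M \<Omega> \<Phi>"
    and "dense_in_Ltwo (restrict_space M \<Omega>) (j_map \<Omega> ` W_Phi_2 M \<Omega> \<Phi>)"
    and "proper_Ltwo (restrict_space M \<Omega>) F"
    and "lsc_Ltwo (restrict_space M \<Omega>) F"
    and "convex_Ltwo (restrict_space M \<Omega>) F"
    and "j_subgradient M \<Omega> \<Phi> = subgradient (restrict_space M \<Omega>) F"
  shows "dirichlet_form (restrict_space M \<Omega>) F \<and>
    (\<forall>S. generated_semigroup (restrict_space M \<Omega>) F S \<longrightarrow>
       order_preserving (restrict_space M \<Omega>) S \<and> Linf_contractive (restrict_space M \<Omega>) S)"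
proof -
  interpret sigma_finite_measure M
    by fact
  interpret form_domain M \<Phi> \<Omega>
    using assms(2,3) by unfold_locales (auto simp: standard_conditions_def)
  have delta2: "delta2_condition M \<Phi>"
    using assms(3) by (simp add: standard_conditions_def)
  have zero: "(\<lambda>x. 0, \<lambda>x. 0) \<in> subgradient N F"
    using zero_j_subgradient assms(8) by simp
  have F0: "\<bar>F (\<lambda>x. 0)\<bar> \<noteq> \<infinity>"
    using zero assms(5) unfolding subgradient_def proper_Ltwo_def by auto
  have min: "F (\<lambda>x. 0) \<le> F u" if "u \<in> Ltwo N" for u
  proof -
    have i: "Ltwo_inner N (\<lambda>x. 0) (\<lambda>x. u x - 0) = 0"
      by (simp add: Ltwo_inner_def)
    have "ereal (Ltwo_inner N (\<lambda>x. 0) (\<lambda>x. u x - 0)) \<le> F u - F (\<lambda>x. 0)"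
      using zero that unfolding subgradient_def by blast
    then have "ereal 0 \<le> F u - F (\<lambda>x. 0)"
      unfolding i .
    then show ?thesis
      using F0 by (cases "F u"; cases "F (\<lambda>x. 0)") auto
  qed
  obtain P where "Ltwo_projection N P"
    using Ltwo_projection_exists by blast
  then interpret Ltwo_projection N P .
  interpret Ltwo_functional N P F
    using assms(6,7) F0 min by unfold_locales
  have mono: "0 \<le> Ltwo_inner N (\<lambda>x. f x - g x) (\<lambda>x. max 0 (a x - b x - k))"
    if "(a, f) \<in> subgradient N F" "(b, g) \<in> subgradient N F" "0 \<le> k" for a f b g k
    using j_subgradient_T_monotone that unfolding assms(8) by blast
  have dense: "dense_in_Ltwo N (effective_domain N F)"
    unfolding dense_in_Ltwo_def
  proof (intro ballI allI impI)
    fix u and e :: real assume u: "u \<in> Ltwo N" and e: "0 < e"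
    obtain v where "v \<in> j_map \<Omega> ` W_Phi_2 M \<Omega> \<Phi>" "v \<in> Ltwo N" "Ltwo_norm N (\<lambda>x. u x - v x) < e / 2"
      using assms(4) u half_gt_zero[OF e] unfolding dense_in_Ltwo_def by blast
    then obtain w where w: "w \<in> W_Phi_2 M \<Omega> \<Phi>" "j_map \<Omega> w \<in> Ltwo N" "Ltwo_norm N (\<lambda>x. u x - j_map \<Omega> w x) < e / 2"
      by blast
    have Gw: "G w < \<infinity>"
      using G_finite[OF delta2] w(1) by (simp add: W_Phi_2_iff)
    define r where "r = enn2real (G w)"
    have r: "0 \<le> r"
      by (simp add: r_def)
    \<comment> \<open>The squared resolvent error is at most \<open>h * r / 2\<close>, which this
      \<open>h\<close> keeps below \<open>(e / 2)^2\<close>; adding 1 covers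
      \<open>r = 0\<close>.\<close>
    define h where "h = (e / 2)\<^sup>2 / (r + 1)"
    have h: "0 < h"
      using e r by (simp add: h_def)
    obtain z where z: "(z, \<lambda>x. (j_map \<Omega> w x - z x) / h) \<in> subgradient N F"
      using resolvent[OF w(2) h] by blast
    have zL: "z \<in> Ltwo N" "F z < \<infinity>"
      using z by (auto simp: subgradient_def)
    have "(Ltwo_norm N (\<lambda>x. j_map \<Omega> w x - z x))\<^sup>2 \<le> h * (r / 2)"
      unfolding r_def using z by (intro resolvent_estimate w(1) Gw h) (simp add: assms(8))
    also have "\<dots> < h * (r + 1)"
      using h r by (intro mult_strict_left_mono) auto
    also have "\<dots> = (e / 2)\<^sup>2"
      using r by (simp add: h_def)
    finally have "Ltwo_norm N (\<lambda>x. j_map \<Omega> w x - z x) < e / 2"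
      by (rule power2_less_imp_less) (use e in simp)
    moreover have "Ltwo_norm N (\<lambda>x. u x - z x)
        \<le> Ltwo_norm N (\<lambda>x. u x - j_map \<Omega> w x) + Ltwo_norm N (\<lambda>x. j_map \<Omega> w x - z x)"
      using nrm_triangle_diff[of u z "j_map \<Omega> w"] u zL(1) w(2) by (simp add: Ltwo_norm_diff)
    ultimately have "Ltwo_norm N (\<lambda>x. u x - z x) < e"
      using w(3) by linarith
    then show "\<exists>v\<in>effective_domain N F. v \<in> Ltwo N \<and> Ltwo_norm N (\<lambda>x. u x - v x) < e"
      using zL by (intro bexI[of _ z]) (auto simp: effective_domain_def)
  qed
  have contr: "order_preserving N S \<and> Linf_contractive N S" if "generated_semigroup N F S" for S
    using semigroup_order_preserving[OF that mono] .
  then show ?thesis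
    using semigroup_exists[OF dense] dense assms(5,6,7) unfolding dirichlet_form_def by blast
qed

end
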